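(* Let $q$ be a prime power and let $d\le \log n/(8\log\log n)$. Then there is a linear time construction of an $(n,q,d)$-perfect hash family of size $$O\left(\frac{d^3\log n}{g(q,d)}\right),\qquad\text{where } g(q,d)=\left(1-\frac{1}{q}\right)\left(1-\frac{2}{q}\right)\cdots\left(1-\frac{d-1}{q}\right).$$
   Context: For $d\le q$, a family $H$ of functions $h:[n]\to[q]$ is an $(n,q,d)$-perfect hash family if for every subset $S\subseteq[n]$ with $|S|=d$ there is $h\in H$ whose restriction to $S$ is injective. The size of the family is $|H|$. "Linear time construction" means a deterministic algorithm that outputs the family in time linear in the size of its description (number of functions times $n$). *)

theory Defs
  imports Complex_Main "HOL-Library.FuncSet" "HOL-Number_Theory.Prime_Powers"
begin

section \<open>Perfect hash families\<close>

text \<open>The sets \<open>[n]\<close> and \<open>[q]\<close> are represented by \<open>{..<n}\<close> and \<open>{..<q}\<close>. Functions are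
  extensional, so that \<open>card H\<close> counts functions on \<open>[n]\<close>.\<close>

definition perfect_hash_family :: "nat \<Rightarrow> nat \<Rightarrow> nat \<Rightarrow> (nat \<Rightarrow> nat) set \<Rightarrow> bool" where
  "perfect_hash_family n q d H \<longleftrightarrow>
     H \<subseteq> {..<n} \<rightarrow>\<^sub>E {..<q} \<and>
     (\<forall>S. S \<subseteq> {..<n} \<and> card S = d \<longrightarrow> (\<exists>h\<in>H. inj_on h S))"

definition g :: "nat \<Rightarrow> nat \<Rightarrow> real" where
  "g q d = (\<Prod>i = 1..<d. 1 - real i / real q)"


section \<open>Word RAM\<close>

text \<open>
  Algorithms are programs of a word RAM with structured control flow. A program uses finitely
  many registers, a memory of words with indirect addressing, and a write-only output stream.
  All cells are initially zero, except that the first registers contain the input. Every executed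
  instruction and every test costs one unit of time.

  Words are the numbers below \<open>W\<close>. An instruction whose result is not a word has no transition, so
  a terminating run never computes with larger numbers. Subtraction is truncated at \<open>0\<close>, which
  provides comparisons; \<open>x div 0 = 0\<close> and \<open>x mod 0 = x\<close>.
\<close>

datatype binop = Add | Sub | Mul | Div | Mod

fun binop_val :: "binop \<Rightarrow> nat \<Rightarrow> nat \<Rightarrow> nat" where
  "binop_val Add x y = x + y"
| "binop_val Sub x y = x - y"
| "binop_val Mul x y = x * y"
| "binop_val Div x y = x div y"
| "binop_val Mod x y = x mod y"

datatype com =
    Const nat nat             \<comment> \<open>target register, value\<close>
  | Op binop nat nat nat      \<comment> \<open>operation, target register, source registers\<close>
  | Load nat nat              \<comment> \<open>target register, register holding the address\<close>
  | Store nat nat             \<comment> \<open>register holding the address, source register\<close>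
  | Output nat
  | Skip
  | Seq com com
  | If nat com com            \<comment> \<open>a register counts as true iff it is nonzero\<close>
  | While nat com

record state =
  reg :: "nat \<Rightarrow> nat"
  mem :: "nat \<Rightarrow> nat"
  out :: "nat list"

definition set_reg :: "nat \<Rightarrow> nat \<Rightarrow> state \<Rightarrow> state" where
  "set_reg r v s = s\<lparr>reg := (reg s)(r := v)\<rparr>"

text \<open>\<open>exec W P s t s'\<close>: with words below \<open>W\<close>, the program \<open>P\<close> started in \<open>s\<close> terminates in \<open>s'\<close>
  after exactly \<open>t\<close> units of time.\<close>

inductive exec :: "nat \<Rightarrow> com \<Rightarrow> state \<Rightarrow> nat \<Rightarrow> state \<Rightarrow> bool" for W :: nat where
  Const: "v < W \<Longrightarrow> exec W (Const r v) s 1 (set_reg r v s)"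
| Op: "v = binop_val b (reg s r1) (reg s r2) \<Longrightarrow> v < W \<Longrightarrow>
    exec W (Op b r r1 r2) s 1 (set_reg r v s)"
| Load: "exec W (Load r a) s 1 (set_reg r (mem s (reg s a)) s)"
| Store: "exec W (Store a r) s 1 (s\<lparr>mem := (mem s)(reg s a := reg s r)\<rparr>)"
| Output: "exec W (Output r) s 1 (s\<lparr>out := out s @ [reg s r]\<rparr>)"
| Skip: "exec W Skip s 1 s"
| Seq: "exec W c1 s t1 s1 \<Longrightarrow> exec W c2 s1 t2 s2 \<Longrightarrow> exec W (Seq c1 c2) s (t1 + t2) s2"
| IfTrue: "reg s r \<noteq> 0 \<Longrightarrow> exec W c1 s t s' \<Longrightarrow> exec W (If r c1 c2) s (1 + t) s'"
| IfFalse: "reg s r = 0 \<Longrightarrow> exec W c2 s t s' \<Longrightarrow> exec W (If r c1 c2) s (1 + t) s'"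
| WhileFalse: "reg s r = 0 \<Longrightarrow> exec W (While r c) s 1 s"
| WhileTrue: "reg s r \<noteq> 0 \<Longrightarrow> exec W c s t1 s1 \<Longrightarrow> exec W (While r c) s1 t2 s2 \<Longrightarrow>
    exec W (While r c) s (1 + t1 + t2) s2"

inductive_cases ConstE: "exec W (Const r v) s t s'"
inductive_cases OpE: "exec W (Op b r r1 r2) s t s'"
inductive_cases LoadE: "exec W (Load r a) s t s'"
inductive_cases StoreE: "exec W (Store a r) s t s'"
inductive_cases OutputE: "exec W (Output r) s t s'"
inductive_cases SkipE: "exec W Skip s t s'"
inductive_cases SeqE: "exec W (Seq c1 c2) s t s'"
inductive_cases IfE: "exec W (If r c1 c2) s t s'"
inductive_cases WhileE: "exec W (While r c) s t s'"

lemma exec_deterministic: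
  "exec W P s t s' \<Longrightarrow> exec W P s u s'' \<Longrightarrow> u = t \<and> s'' = s'"
proof (induction arbitrary: u s'' rule: exec.induct)
  case (Const v r s)
  from Const.prems show ?case by (rule ConstE) simp_all
next
  case (Op v b s r1 r2 r)
  from Op.prems show ?case by (rule OpE) (simp_all add: Op.hyps)
next
  case (Load r a s)
  from Load.prems show ?case by (rule LoadE) simp_all
next
  case (Store a r s)
  from Store.prems show ?case by (rule StoreE) simp_all
next
  case (Output r s)
  from Output.prems show ?case by (rule OutputE) simp_all
next
  case (Skip s)
  from Skip.prems show ?case by (rule SkipE) simp_all
next
  case (Seq c1 s t1 s1 c2 t2 s2)
  from Seq.prems show ?case
  proof (rule SeqE)
    fix t1' s1' t2'
    assume *: "u = t1' + t2'" "exec W c1 s t1' s1'" "exec W c2 s1' t2' s''"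
    from Seq.IH(1)[OF *(2)] * have **: "t1' = t1" "exec W c2 s1 t2' s''" by simp_all
    from Seq.IH(2)[OF **(2)] *(1) **(1) show ?thesis by simp
  qed
next
  case (IfTrue s r c1 t s' c2)
  from IfTrue.prems show ?case
  proof (rule IfE)
    fix t' assume "u = Suc t'" "exec W c1 s t' s''"
    with IfTrue.IH[of t' s''] show ?thesis by simp
  qed (use IfTrue.hyps in simp_all)
next
  case (IfFalse s r c2 t s' c1)
  from IfFalse.prems show ?case
  proof (rule IfE)
    fix t' assume "u = Suc t'" "exec W c2 s t' s''"
    with IfFalse.IH[of t' s''] show ?thesis by simp
  qed (use IfFalse.hyps in simp_all)
next
  case (WhileFalse s r c)
  from WhileFalse.prems show ?case
    by (rule WhileE) (use WhileFalse.hyps in simp_all)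
next
  case (WhileTrue s r c t1 s1 t2 s2)
  from WhileTrue.prems show ?case
  proof (rule WhileE)
    fix t1' s1' t2'
    assume *: "u = Suc (t1' + t2')" "exec W c s t1' s1'" "exec W (While r c) s1' t2' s''"
    from WhileTrue.IH(1)[OF *(2)] * have **: "t1' = t1" "exec W (While r c) s1 t2' s''"
      by simp_all
    from WhileTrue.IH(2)[OF **(2)] *(1) **(1) show ?thesis by simp
  qed (use WhileTrue.hyps in auto)
qed

definition init_state :: "nat list \<Rightarrow> state" where
  "init_state xs =
     \<lparr>reg = (\<lambda>r. if r < length xs then xs ! r else 0), mem = (\<lambda>_. 0), out = []\<rparr>"

definition computes_in :: "nat \<Rightarrow> com \<Rightarrow> nat list \<Rightarrow> nat list \<Rightarrow> nat \<Rightarrow> bool" where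
  "computes_in W P xs ys t \<longleftrightarrow>
     (\<forall>x\<in>set xs. x < W) \<and> (\<exists>s'. exec W P (init_state xs) t s' \<and> out s' = ys)"


section \<open>Linear time constructions\<close>

text \<open>The description of a family lists the value tables of its functions, each function once.\<close>

definition describes :: "nat \<Rightarrow> nat list \<Rightarrow> (nat \<Rightarrow> nat) set \<Rightarrow> bool" where
  "describes n ys H \<longleftrightarrow>
     (\<exists>hs. distinct hs \<and> set hs = H \<and> ys = concat (map (\<lambda>h. map h [0..<n]) hs))"

text \<open>On input \<open>(n, q, d)\<close> the program outputs the description of \<open>H\<close>, in time at most \<open>K\<close> times its
  size. Since \<open>W = (max n q) ^ c\<close>, the number of bits of a word is at most \<open>c\<close> times the number
  of bits of the larger of \<open>n\<close> and \<open>q\<close>. For a linear time construction, one program with fixed \<open>c\<close>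
  and \<open>K\<close> has to serve all inputs.\<close>

definition constructs_in_linear_time ::
  "com \<Rightarrow> nat \<Rightarrow> real \<Rightarrow> nat \<Rightarrow> nat \<Rightarrow> nat \<Rightarrow> (nat \<Rightarrow> nat) set \<Rightarrow> bool" where
  "constructs_in_linear_time P c K n q d H \<longleftrightarrow>
     (\<exists>ys t. computes_in ((max n q) ^ c) P [n, q, d] ys t \<and> describes n ys H \<and>
        real t \<le> K * (real (card H) * real n))"

end

theory Submission
  imports Defs "HOL-Number_Theory.Cong"
begin

text \<open>
  Let \<open>l = \<lfloor>log n\<rfloor>\<close> and let \<open>K\<close> be least with \<open>n \<le> l ^ K\<close>. A difference of two elements of \<open>[n]\<close> has
  fewer than \<open>K\<close> prime divisors above \<open>l\<close>, so among any \<open>d\<^sup>2 K\<close> primes \<open>p > l\<close> there is one for which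
  \<open>x \<mapsto> x mod p\<close> is injective on a given \<open>d\<close>-set. By a Chebyshev bound enough such primes lie below
  \<open>l\<^sup>3\<close>. For each of them the method of conditional expectations yields an \<open>(p, q, d)\<close>-perfect hash
  family of size \<open>O(d log p / g)\<close>: every new function separates at least a fraction \<open>g\<close> of the \<open>d\<close>-sets
  that are not separated yet. Composing both steps, the factors \<open>log l\<close> cancel and \<open>O(d\<^sup>3 log n / g)\<close>
  functions remain. One greedy step scans the \<open>p ^ d\<close> codes of \<open>d\<close>-sets for each of at most \<open>p q\<close>
  partial assignments; since \<open>l ^ (8 d) \<le> n\<close>, this costs no more than printing one function. A large
  \<open>q\<close> is first reduced to \<open>l\<^sup>3\<close>, which at most halves \<open>g\<close>.
\<close>

section \<open>Counting primes\<close>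

text \<open>The exponents come from counting. The bound on d makes d at most about l / (8 log l),
  and K is about log n / log l, so about l^3 / (log l)^3 moduli may be wanted: primes up to l^2 are
  too few in general, primes up to l^3 suffice with room to spare. With p and q at most l^3,
  potentials are at most p^d q^d <= l^(6 d), and the work p q d^2 p^d of a greedy step is at most
  l^(3 d + 8); both are within l^(8 d) for d >= 2, which is how the 8 in the bound on d is spent. A
  second obstacle is that a description lists each function once, so the printed functions must be
  pairwise distinct, with no time to compare them. For one modulus, every new function separates a
  set that the earlier ones do not. For two moduli, the Chinese remainder theorem applies because p
  p' <= n: lifts from p and p' can agree on [n] only if they are constant. Constant functions are
  excluded by d >= 2, and d = 1 is served by a single constant function.\<close>

lemma card_multiples: "card {k\<in>{1..n}. e dvd k} = n div e" if "e > 0" for n e :: nat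
proof -
  have "{k\<in>{1..n}. e dvd k} = (\<lambda>j. e * j) ` {1..n div e}"
    using that by (auto simp: image_iff less_eq_div_iff_mult_less_eq mult.commute elim!: dvdE)
  also have "card \<dots> = n div e" using that by (subst card_image) (auto simp: inj_on_def)
  finally show ?thesis .
qed

text \<open>Double counting of the pairs e dvd k <= n, with log k written as the sum of
  \<open>mangoldt\<close> over the divisors of k. The cut-off N may exceed n because terms with e >
  n vanish; this lets m and 2 m be expanded over one common range.\<close>

lemma ln_fact_mangoldt:
  assumes "n \<le> N"
  shows "ln (fact n) = (\<Sum>e = 1..N. mangoldt e * real (n div e))"
proof -
  have "ln (fact n :: real) = (\<Sum>k = 1..n. ln (real k))"
    by (subst fact_prod, subst of_nat_prod, subst ln_prod) auto
  also have "\<dots> = (\<Sum>k = 1..n. \<Sum>e | e dvd k. mangoldt e)"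
    by (intro sum.cong refl) (subst mangoldt_sum, auto)
  also have "\<dots> = (\<Sum>k = 1..n. \<Sum>e = 1..N. if e dvd k then mangoldt e else 0)"
  proof (rule sum.cong[OF refl])
    fix k assume "k \<in> {1..n}"
    then have "0 < e \<and> e \<le> N" if "e dvd k" for e
      using assms that dvd_imp_le[of e k] dvd_pos_nat[of k e] by auto
    then have "{e. e dvd k} = {1..N} \<inter> {e. e dvd k}" by (auto simp: Suc_le_eq)
    then show "(\<Sum>e | e dvd k. mangoldt e) = (\<Sum>e = 1..N. if e dvd k then mangoldt e else (0::real))"
      by (simp add: sum.If_cases)
  qed
  also have "\<dots> = (\<Sum>e = 1..N. \<Sum>k = 1..n. if e dvd k then mangoldt e else 0)"
    by (rule sum.swap)
  also have "\<dots> = (\<Sum>e = 1..N. mangoldt e * real (n div e))"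
  proof (rule sum.cong[OF refl])
    fix e assume "e \<in> {1..N}"
    then have "real (card {k\<in>{1..n}. e dvd k}) = real (n div e)" by (subst card_multiples) auto
    then show "(\<Sum>k = 1..n. if e dvd k then mangoldt e else 0) = mangoldt e * real (n div e)"
      by (simp add: sum.If_cases Int_def)
  qed
  finally show ?thesis .
qed

text \<open>The left side is Chebyshev's psi(N). A prime p contributes log p once for each of its
  powers up to N, hence at most log N in total.\<close>

lemma sum_mangoldt_le:
  assumes "N \<ge> 1"
  shows "(\<Sum>e = 1..N. mangoldt e) \<le> real (card {p. prime p \<and> p \<le> N}) * ln (real N)"
proof -
  let ?P = "{p. prime p \<and> p \<le> N}"
  have fin: "finite ?P" by simp
  have "(\<Sum>e = 1..N. mangoldt e :: real) = (\<Sum>e\<in>{e\<in>{1..N}. primepow e}. mangoldt e)"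
    by (intro sum.mono_neutral_right) (auto simp: mangoldt_def)
  also have "\<dots> = (\<Sum>p\<in>?P. \<Sum>e\<in>{e\<in>{e\<in>{1..N}. primepow e}. aprimedivisor e = p}. mangoldt e)"
  proof (rule sum.group[symmetric])
    show "aprimedivisor ` {e \<in> {1..N}. primepow e} \<subseteq> ?P"
      by (auto simp: primepow_gt_Suc_0 aprimedivisor_le_nat intro!: prime_aprimedivisor'
          order.trans[OF aprimedivisor_le_nat])
  qed auto
  also have "\<dots> \<le> (\<Sum>p\<in>?P. ln (real N))"
  proof (rule sum_mono)
    fix p assume "p \<in> ?P"
    then have p: "prime p" "p > 1" by (simp_all add: prime_gt_Suc_0_nat)
    let ?E = "{e\<in>{e\<in>{1..N}. primepow e}. aprimedivisor e = p}"
    define c where "c = nat \<lfloor>log p N\<rfloor>"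
    have "?E \<subseteq> (\<lambda>k. p ^ k) ` {1..c}"
    proof
      fix e assume e: "e \<in> ?E"
      then obtain p' k where k: "prime p'" "k > 0" "e = p' ^ k" unfolding primepow_def by auto
      with e have "p' = p" by (simp add: aprimedivisor_prime_power)
      with k e have "real p ^ k \<le> real N" by (metis (mono_tags, lifting) atLeastAtMost_iff mem_Collect_eq of_nat_le_iff of_nat_power)
      then have "real k \<le> log p N" using p assms by (simp add: le_log_iff powr_realpow)
      then have "k \<le> c" unfolding c_def by linarith
      with k \<open>p' = p\<close> show "e \<in> (\<lambda>k. p ^ k) ` {1..c}" by auto
    qed
    then have "card ?E \<le> card ((\<lambda>k. p ^ k) ` {1..c})" by (intro card_mono) auto
    also have "\<dots> \<le> c" using card_image_le[of "{1..c}" "\<lambda>k. p ^ k"] by simp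
    finally have c: "card ?E \<le> c" .
    have "(\<Sum>e\<in>?E. mangoldt e) = real (card ?E) * ln (real p)"
      by (simp add: mangoldt_def)
    also have "\<dots> \<le> real c * ln (real p)" using c p by (intro mult_right_mono) auto
    also have "\<dots> \<le> log p N * ln (real p)"
      using p assms by (intro mult_right_mono) (auto simp: c_def)
    also have "\<dots> = ln (real N)" using p by (simp add: log_def)
    finally show "(\<Sum>e\<in>?E. mangoldt e) \<le> ln (real N)" .
  qed
  finally show ?thesis by simp
qed

text \<open>Caps at 1 the coefficient of each \<open>mangoldt e\<close> in the logarithm of the
  central binomial coefficient.\<close>

lemma div_double_le: "2 * m div e \<le> 2 * (m div e) + 1" for m e :: nat
proof (cases "e = 0")
  case False
  have "2 * m < e * (2 * (m div e) + 2)"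
  proof -
    have "m = e * (m div e) + m mod e" "m mod e < e" using False by simp_all
    then show ?thesis unfolding distrib_left by linarith
  qed
  then have "2 * m div e < 2 * (m div e) + 2" using False
    by (simp add: div_less_iff_less_mult mult.commute)
  then show ?thesis by simp
qed simp

text \<open>Chebyshev's argument: 4^m / (2 m) is at most the central binomial coefficient, whose
  logarithm combines \<open>mangoldt\<close> values with coefficients at most 1 and so is at most
  psi(2 m). The \<open>+ 1\<close> on the right absorbs the denominator 2 m.\<close>

lemma primes_lower_double:
  assumes "m \<ge> 1"
  shows "real (2 * m) * ln 2 \<le> (real (card {p. prime p \<and> p \<le> 2 * m}) + 1) * ln (real (2 * m))"
proof -
  let ?N = "2 * m"
  have b: "4 ^ m / real ?N \<le> real (?N choose m)"
    using central_binomial_lower_bound[of m] assms by simp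
  have "real (?N choose m) = fact ?N / (fact m * fact m)"
    using binomial_fact[of m ?N, where 'a = real] by simp
  then have "ln (real (?N choose m)) = ln (fact ?N) - 2 * ln (fact m)"
    by (simp add: ln_div ln_mult)
  also have "\<dots> = (\<Sum>e = 1..?N. mangoldt e * (real (?N div e) - 2 * real (m div e)))"
    by (simp add: ln_fact_mangoldt[of _ ?N] sum_distrib_left sum_subtractf algebra_simps)
  also have "\<dots> \<le> (\<Sum>e = 1..?N. mangoldt e * 1)"
  proof (intro sum_mono mult_left_mono mangoldt_nonneg)
    fix e :: nat
    have "real (?N div e) \<le> real (2 * (m div e) + 1)" using div_double_le of_nat_le_iff by blast
    then show "real (?N div e) - 2 * real (m div e) \<le> 1" by simp
  qed
  also have "\<dots> \<le> real (card {p. prime p \<and> p \<le> ?N}) * ln (real ?N)"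
    using sum_mangoldt_le[of ?N] assms by simp
  finally have *: "ln (real (?N choose m)) \<le> real (card {p. prime p \<and> p \<le> ?N}) * ln (real ?N)" .
  have "real ?N * ln 2 - ln (real ?N) = ln (4 ^ m / real ?N)"
    using assms by (simp add: ln_div ln_realpow) (metis ln_realpow mult.commute mult_2_right numeral_Bit0 power2_eq_square of_nat_numeral one_add_one power_mult zero_less_numeral)
  also have "\<dots> \<le> ln (real (?N choose m))" using b assms by (intro ln_mono) auto
  finally show ?thesis using * by (simp add: algebra_simps)
qed

text \<open>Rounding x down to an even number costs the 1 on the left; dividing by ln 2 turns
  natural logarithms into binary ones.\<close>

lemma primes_lower:
  assumes "x \<ge> 2"
  shows "real x - 1 \<le> (real (card {p. prime p \<and> p \<le> x}) + 1) * log 2 (real x)"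
proof -
  define m where "m = x div 2"
  have m: "m \<ge> 1" "2 * m \<le> x" "x \<le> 2 * m + 1" using assms by (auto simp: m_def)
  have "(real x - 1) * ln 2 \<le> real (2 * m) * ln 2" using m by (intro mult_right_mono) auto
  also have "\<dots> \<le> (real (card {p. prime p \<and> p \<le> 2 * m}) + 1) * ln (real (2 * m))"
    by (rule primes_lower_double[OF m(1)])
  also have "\<dots> \<le> (real (card {p. prime p \<and> p \<le> x}) + 1) * ln (real x)"
    using m by (intro mult_mono add_mono) (auto intro!: card_mono)
  finally show ?thesis by (simp add: log_def field_simps)
qed

section \<open>Greedy families by conditional expectations\<close>

text \<open>For increasing \<open>a\<close>, this is \<open>q ^ d\<close> times the probability that \<open>f \<circ> a\<close> becomes injective on \<open>{..<d}\<close>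
  when the values of \<open>f\<close> at the points \<open>\<ge> x\<close> are chosen uniformly from \<open>{..<q}\<close>.\<close>

definition weight :: "nat \<Rightarrow> nat \<Rightarrow> (nat \<Rightarrow> nat) \<Rightarrow> nat \<Rightarrow> (nat \<Rightarrow> nat) \<Rightarrow> nat" where
  "weight q d f x a =
     (\<Prod>i<d. if a i < x then (if \<exists>k<i. f (a k) = f (a i) then 0 else q) else q - i)"

lemma weight_start: "weight q d f 0 a = (\<Prod>i<d. q - i)"
  by (simp add: weight_def)

lemma weight_end:
  assumes "\<And>i. i < d \<Longrightarrow> a i < x" "q > 0"
  shows "weight q d f x a = (if inj_on (f \<circ> a) {..<d} then q ^ d else 0)"
proof (cases "inj_on (f \<circ> a) {..<d}")
  case True
  then have "\<not> (\<exists>k<i. f (a k) = f (a i))" if "i < d" for i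
    using that by (auto simp: inj_on_def)
  then have "weight q d f x a = (\<Prod>i<d. q)"
    unfolding weight_def using assms by (intro prod.cong) auto
  with True show ?thesis by simp
next
  case False
  then obtain i k where "i < d" "k < i" "f (a k) = f (a i)"
    unfolding inj_on_def by auto (metis linorder_neqE_nat)
  then have "weight q d f x a = 0" unfolding weight_def using assms
    by (intro prod_zero) (auto intro!: bexI[of _ i])
  with False show ?thesis by simp
qed

lemma weight_le: "q > 0 \<Longrightarrow> weight q d f x a \<le> q ^ d"
proof -
  assume "q > 0"
  have "weight q d f x a \<le> (\<Prod>i<d. q)" unfolding weight_def by (intro prod_mono) auto
  then show ?thesis by simp
qed

text \<open>The martingale property behind conditional expectations: averaging over the value at x
  leaves the weight unchanged. If x = a j, monotonicity makes the factors before j already fixed and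
  those after j still open, so only the factor q - j is replaced, by q or 0 according to whether v
  avoids the earlier values.\<close>

lemma weight_sum:
  assumes a: "strict_mono_on {..<d} a" and q: "d \<le> q" and f: "\<And>b. b < x \<Longrightarrow> f b < q"
  shows "(\<Sum>v<q. weight q d (f(x := v)) (Suc x) a) = q * weight q d f x a"
proof (cases "x \<in> a ` {..<d}")
  case False
  have "weight q d (f(x := v)) (Suc x) a = weight q d f x a" for v
    unfolding weight_def
  proof (intro prod.cong refl)
    fix i assume i: "i \<in> {..<d}"
    have "a i \<noteq> x" and "\<And>k. k < i \<Longrightarrow> a k \<noteq> x" using i False by (auto simp: image_iff)
    then show "(if a i < Suc x then if \<exists>k<i. (f(x := v)) (a k) = (f(x := v)) (a i) then 0 else q else q - i) =
      (if a i < x then if \<exists>k<i. f (a k) = f (a i) then 0 else q else q - i)"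
      by (auto simp: less_Suc_eq)
  qed
  then show ?thesis by simp
next
  case True
  then obtain j where j: "j < d" "x = a j" by auto
  have mono: "a i < a k \<longleftrightarrow> i < k" if "i < d" "k < d" for i k
    using a that by (metis lessThan_iff linorder_neqE_nat order_less_imp_not_less strict_mono_onD)
  have ne: "a i \<noteq> x" if "i < d" "i \<noteq> j" for i
    using a that j by (metis lessThan_iff linorder_neqE_nat nat_neq_iff strict_mono_onD)
  define A where "A = (\<Prod>i<j. if \<exists>k<i. f (a k) = f (a i) then 0 else q)"
  define B where "B = (\<Prod>i\<in>{j<..<d}. q - i)"
  have split: "{..<d} = {..<j} \<union> ({j} \<union> {j<..<d})" using j by auto
  have w: "(\<Prod>i<d. h i) = (\<Prod>i<j. h i) * (h j * (\<Prod>i\<in>{j<..<d}. h i))" for h :: "nat \<Rightarrow> nat"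
    unfolding split by (subst prod.union_disjoint; (subst prod.union_disjoint)?) auto
  have old: "weight q d f x a = A * ((q - j) * B)"
    unfolding weight_def w A_def B_def using j mono
    by (intro arg_cong2[where f = times] prod.cong) auto
  have new: "weight q d (f(x := v)) (Suc x) a =
      A * ((if v \<in> (f \<circ> a) ` {..<j} then 0 else q) * B)" for v
    unfolding weight_def w A_def B_def
  proof (intro arg_cong2[where f = times] prod.cong refl)
    fix i assume i: "i \<in> {..<j}"
    then have "a i < x" and "\<And>k. k < i \<Longrightarrow> a k \<noteq> x" using j mono ne by auto
    then show "(if a i < Suc x then if \<exists>k<i. (f(x := v)) (a k) = (f(x := v)) (a i) then 0 else q else q - i) =
         (if \<exists>k<i. f (a k) = f (a i) then 0 else q)" by auto
  next
    have "\<And>k. k < j \<Longrightarrow> a k \<noteq> x" using j ne by auto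
    then show "(if a j < Suc x then if \<exists>k<j. (f(x := v)) (a k) = (f(x := v)) (a j) then 0 else q else q - j) =
         (if v \<in> (f \<circ> a) ` {..<j} then 0 else q)" using j by (auto simp: image_iff)
  next
    fix i assume "i \<in> {j<..<d}"
    then have "\<not> a i < Suc x" using j mono[of j i] by auto
    then show "(if a i < Suc x then if \<exists>k<i. (f(x := v)) (a k) = (f(x := v)) (a i) then 0 else q else q - i) = q - i"
      by simp
  qed
  have "(\<Sum>v<q. weight q d (f(x := v)) (Suc x) a) =
      A * B * (\<Sum>v<q. if v \<in> (f \<circ> a) ` {..<j} then 0 else q)"
    by (simp add: new sum_distrib_left mult_ac)
  also have "(\<Sum>v<q. if v \<in> (f \<circ> a) ` {..<j} then 0 else q) = q * card ({..<q} - (f \<circ> a) ` {..<j})"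
    by (simp add: sum.If_cases Diff_eq)
  \<comment> \<open>If the earlier values collide, A = 0 and both sides vanish; otherwise exactly q
    - j values v are free.\<close>
  also have "A * B * (q * card ({..<q} - (f \<circ> a) ` {..<j})) = q * (A * ((q - j) * B))"
  proof (cases "inj_on (f \<circ> a) {..<j}")
    case True
    have "(f \<circ> a) ` {..<j} \<subseteq> {..<q}" using f j mono by auto
    then have "card ({..<q} - (f \<circ> a) ` {..<j}) = q - j"
      using True by (subst card_Diff_subset) (simp_all only: card_image card_lessThan finite_imageI finite_lessThan)
    then show ?thesis by simp
  next
    case False
    then obtain i k where "i < j" "k < i" "f (a k) = f (a i)"
      unfolding inj_on_def by auto (metis linorder_neqE_nat)
    then have "A = 0" unfolding A_def by (intro prod_zero) auto
    then show ?thesis by simp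
  qed
  finally show ?thesis by (simp only: old)
qed

section \<open>Base p codes of d-sets, and the codes not yet separated\<close>

definition digit :: "nat \<Rightarrow> nat \<Rightarrow> nat \<Rightarrow> nat" where
  "digit p y i = y div p ^ i mod p"

lemma digit_less: "p > 0 \<Longrightarrow> digit p y i < p"
  by (simp add: digit_def)

lemma digits_surj:
  assumes "\<And>i. i < d \<Longrightarrow> a i < p"
  shows "\<exists>y<p ^ d. \<forall>i<d. digit p y i = a i"
  using assms
proof (induction d arbitrary: a)
  case (Suc d)
  from Suc.IH[of "\<lambda>i. a (Suc i)"] Suc.prems obtain y where
    y: "y < p ^ d" "\<forall>i<d. digit p y i = a (Suc i)" by auto
  have p: "a 0 < p" using Suc.prems by auto
  have "digit p (a 0 + p * y) i = a i" if "i < Suc d" for i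
  proof (cases i)
    case (Suc k)
    have "(a 0 + p * y) div p ^ Suc k = y div p ^ k" using p
      by (simp add: div_mult2_eq)
    then show ?thesis using y Suc that by (simp add: digit_def)
  qed (use p in \<open>simp add: digit_def\<close>)
  moreover have "a 0 + p * y < p ^ Suc d"
  proof -
    have "a 0 + p * y < p + p * y" using p by simp
    also have "\<dots> = p * Suc y" by simp
    also have "\<dots> \<le> p * p ^ d" using y by (intro mult_le_mono) auto
    finally show ?thesis by simp
  qed
  ultimately show ?case by blast
qed simp

text \<open>A \<open>d\<close>-subset of \<open>{..<p}\<close> is coded by the number whose base \<open>p\<close> digits list it increasingly.\<close>

definition uncovered :: "nat \<Rightarrow> nat \<Rightarrow> (nat \<Rightarrow> nat) list \<Rightarrow> nat set" where
  "uncovered p d fs = {y. y < p ^ d \<and> strict_mono_on {..<d} (digit p y) \<and>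
     (\<forall>f\<in>set fs. \<not> inj_on (f \<circ> digit p y) {..<d})}"

lemma finite_uncovered [simp]: "finite (uncovered p d fs)"
  by (rule finite_subset[of _ "{..<p ^ d}"]) (auto simp: uncovered_def)

lemma uncovered_snoc:
  "uncovered p d (fs @ [f]) = uncovered p d fs - {y\<in>uncovered p d fs. inj_on (f \<circ> digit p y) {..<d}}"
  by (auto simp: uncovered_def)

lemma code_of_set:
  assumes "S \<subseteq> {..<p}" "card S = d" "d > 0"
  obtains y where "y < p ^ d" "strict_mono_on {..<d} (digit p y)" "digit p y ` {..<d} = S"
proof -
  have fin: "finite S" using assms by (metis card_ge_0_finite)
  define xs where "xs = sorted_list_of_set S"
  have xs: "length xs = d" "set xs = S" "sorted_wrt (<) xs"
    using fin assms by (auto simp: xs_def)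
  have "xs ! i < p" if "i < d" for i using that xs assms nth_mem by fastforce
  then obtain y where y: "y < p ^ d" "\<And>i. i < d \<Longrightarrow> digit p y i = xs ! i"
    using digits_surj[of d "(!) xs" p] by blast
  have "strict_mono_on {..<d} (digit p y)"
    using xs y by (auto simp: strict_mono_on_def sorted_wrt_nth_less)
  moreover have "digit p y ` {..<d} = S"
    using xs y by (auto simp: set_conv_nth image_iff)
  ultimately show ?thesis using that y by blast
qed

lemma uncovered_empty_imp_inj:
  assumes "uncovered p d fs = {}" "S \<subseteq> {..<p}" "card S = d" "d > 0"
  shows "\<exists>f\<in>set fs. inj_on f S"
proof -
  obtain y where y: "y < p ^ d" "strict_mono_on {..<d} (digit p y)" "digit p y ` {..<d} = S"
    using code_of_set assms by metis
  then obtain f where "f \<in> set fs" "inj_on (f \<circ> digit p y) {..<d}"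
    using assms unfolding uncovered_def by blast
  then show ?thesis using y by (metis inj_on_imageI)
qed

text \<open>Witnessed by the code of \<open>{..<d}\<close>. Every modulus therefore yields at least
  one function, to which the cost of preparing that modulus can be charged.\<close>

lemma uncovered_Nil_nonempty:
  assumes "0 < d" "d \<le> p"
  shows "uncovered p d [] \<noteq> {}"
  using code_of_set[of "{..<d}" p d] assms by (fastforce simp: uncovered_def)

text \<open>Links the real product \<open>g\<close> to the integer weights: divided by q^d, the
  start weight is \<open>g\<close>, whose absent factor for i = 0 equals 1.\<close>

lemma g_eq: "d \<le> q \<Longrightarrow> 0 < q \<Longrightarrow> g q d = real (\<Prod>i<d. q - i) / real q ^ d"
proof -
  assume d: "d \<le> q" "0 < q"
  have "real (\<Prod>i<d. q - i) / real q ^ d = (\<Prod>i<d. real (q - i) / real q)"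
    by (simp add: prod_dividef)
  also have "\<dots> = (\<Prod>i<d. 1 - real i / real q)"
    using d by (intro prod.cong) (auto simp: field_simps of_nat_diff)
  also have "\<dots> = g q d" unfolding g_def
    using d by (intro prod.mono_neutral_right) (auto simp: not_less)
  finally show ?thesis by simp
qed

lemma g_pos: "d \<le> q \<Longrightarrow> g q d > 0"
  unfolding g_def by (intro prod_pos) auto

lemma g_le_1: "g q d \<le> 1" if "d \<le> q"
  unfolding g_def using that by (intro prod_le_1) (auto simp: field_simps)

text \<open>For a set T of increasing codes this is q^d times the expected number of codes in T that
  f separates, when its values at the points >= x are uniformly random.\<close>

definition potential :: "nat \<Rightarrow> nat \<Rightarrow> nat \<Rightarrow> nat set \<Rightarrow> (nat \<Rightarrow> nat) \<Rightarrow> nat \<Rightarrow> nat" where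
  "potential p q d T f x = (\<Sum>y\<in>T. weight q d f x (digit p y))"

text \<open>The potential is the average of the q potentials after fixing the value at x, so it is
  at most any common bound M of these. With M the largest of them, a best choice never lowers the
  potential.\<close>

lemma potential_step:
  assumes "\<And>y. y \<in> T \<Longrightarrow> strict_mono_on {..<d} (digit p y)" "d \<le> q" "\<And>b. b < x \<Longrightarrow> f b < q" "0 < q"
    and best: "\<And>v. v < q \<Longrightarrow> potential p q d T (f(x := v)) (Suc x) \<le> M"
  shows "potential p q d T f x \<le> M"
proof -
  have "q * potential p q d T f x = (\<Sum>y\<in>T. \<Sum>v<q. weight q d (f(x := v)) (Suc x) (digit p y))"
    using assms by (simp add: potential_def sum_distrib_left weight_sum)
  also have "\<dots> = (\<Sum>v<q. potential p q d T (f(x := v)) (Suc x))"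
    unfolding potential_def by (rule sum.swap)
  also have "\<dots> \<le> (\<Sum>v<q. M)" using best by (intro sum_mono) auto
  finally show ?thesis using assms by simp
qed

lemma potential_end:
  assumes "finite T" "0 < q" "0 < p"
  shows "potential p q d T f p = q ^ d * card {y\<in>T. inj_on (f \<circ> digit p y) {..<d}}"
  using assms by (simp add: potential_def weight_end digit_less sum.If_cases Int_def)

text \<open>At 0 the potential is q^d g times the number of uncovered codes, at p it is q^d times
  the number of newly separated ones. A function built without loss of potential thus separates at
  least a fraction g.\<close>

lemma uncovered_shrinks:
  assumes "potential p q d (uncovered p d fs) f 0 \<le> potential p q d (uncovered p d fs) f p"
    and "d \<le> q" "0 < q" "0 < p"
  shows "real (card (uncovered p d (fs @ [f]))) \<le> (1 - g q d) * real (card (uncovered p d fs))"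
proof -
  let ?T = "uncovered p d fs" and ?G = "{y\<in>uncovered p d fs. inj_on (f \<circ> digit p y) {..<d}}"
  have "card ?T * (\<Prod>i<d. q - i) \<le> q ^ d * card ?G"
    using assms(1) by (simp add: potential_end assms) (simp add: potential_def weight_start)
  from of_nat_mono[OF this, where 'a = real]
  have "real (card ?T) * real (\<Prod>i<d. q - i) \<le> real q ^ d * real (card ?G)"
    by (simp only: of_nat_mult of_nat_power)
  then have "g q d * real (card ?T) \<le> real (card ?G)"
    using assms by (simp add: g_eq divide_le_eq mult.commute del: of_nat_prod)
  moreover have "card (uncovered p d (fs @ [f])) = card ?T - card ?G"
    unfolding uncovered_snoc by (intro card_Diff_subset) auto
  moreover have "card ?G \<le> card ?T" by (intro card_mono) auto
  ultimately show ?thesis by (simp add: of_nat_diff algebra_simps)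
qed

text \<open>Records what the loop of the program guarantees, independently of how f was found. Only
  values below p are constrained, as the functions are applied to residues. Requiring that something
  was still uncovered bounds the length and makes every function separate a new code.\<close>

inductive greedy :: "nat \<Rightarrow> nat \<Rightarrow> nat \<Rightarrow> (nat \<Rightarrow> nat) list \<Rightarrow> bool" for p q d where
  Nil: "greedy p q d []"
| snoc: "greedy p q d fs \<Longrightarrow> uncovered p d fs \<noteq> {} \<Longrightarrow> \<forall>a<p. f a < q \<Longrightarrow>
    real (card (uncovered p d (fs @ [f]))) \<le> (1 - g q d) * real (card (uncovered p d fs)) \<Longrightarrow>
    greedy p q d (fs @ [f])"

section \<open>Length, distinctness and nonconstancy of greedy families\<close>

lemma greedy_range: "greedy p q d fs \<Longrightarrow> f \<in> set fs \<Longrightarrow> a < p \<Longrightarrow> f a < q"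
  by (induction rule: greedy.induct) auto

lemma greedy_card:
  assumes "greedy p q d fs" "d \<le> q"
  shows "real (card (uncovered p d fs)) \<le> real p ^ d * (1 - g q d) ^ length fs"
  using assms
proof (induction rule: greedy.induct)
  case Nil
  have "card (uncovered p d []) \<le> card {..<p ^ d}" by (intro card_mono) (auto simp: uncovered_def)
  then show ?case by (simp flip: of_nat_power)
next
  case (snoc fs f)
  have "real (card (uncovered p d (fs @ [f]))) \<le> (1 - g q d) * real (card (uncovered p d fs))" by fact
  also have "\<dots> \<le> (1 - g q d) * (real p ^ d * (1 - g q d) ^ length fs)"
    using snoc g_le_1[of d q] by (intro mult_left_mono) auto
  finally show ?case by (simp add: mult_ac)
qed

text \<open>Before the last function was added some code was uncovered, so 1 <= p^d (1 - g)^t <= exp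
  (d ln p - t g), where t is one less than the length; the last function accounts for the summand
  1.\<close>

lemma greedy_length:
  assumes "greedy p q d fs" "d \<le> q" "0 < p"
  shows "real (length fs) \<le> 1 + real d * ln (real p) / g q d"
  using assms
proof (cases rule: greedy.cases)
  case (snoc fs0 f)
  let ?G = "g q d" and ?t = "length fs0"
  have G: "0 < ?G" "?G \<le> 1" using g_pos g_le_1 assms by auto
  have "1 \<le> real (card (uncovered p d fs0))" using snoc by (simp add: Suc_le_eq card_gt_0_iff)
  also have "\<dots> \<le> real p ^ d * (1 - ?G) ^ ?t" using greedy_card snoc assms by blast
  also have "\<dots> \<le> real p ^ d * exp (- ?G) ^ ?t"
    using exp_ge_add_one_self[of "- ?G"] G by (intro mult_left_mono power_mono) auto
  also have "\<dots> = exp (real d * ln (real p) - real ?t * ?G)"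
  proof -
    have "real p ^ d = exp (real d * ln (real p))" using assms by (simp add: exp_of_nat_mult)
    moreover have "exp (- ?G) ^ ?t = exp (- (real ?t * ?G))"
      using exp_of_nat_mult[of ?t "- ?G"] by simp
    ultimately show ?thesis by (simp flip: exp_add)
  qed
  finally have "real ?t * ?G \<le> real d * ln (real p)" by simp
  then show ?thesis using snoc G by (simp add: field_simps)
next
  case Nil
  then show ?thesis using assms g_pos[of d q] by (simp add: divide_nonneg_pos)
qed

text \<open>Since g > 0, every round strictly shrinks the uncovered set, so each function separates
  a code that its predecessors miss. Distinctness and nonconstancy both rest on this.\<close>

lemma greedy_new:
  assumes "greedy p q d fs" "d \<le> q"
  shows "j < length fs \<Longrightarrow> \<exists>y\<in>uncovered p d (take j fs). inj_on ((fs ! j) \<circ> digit p y) {..<d}"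
  using assms
proof (induction rule: greedy.induct)
  case (snoc fs f)
  show ?case
  proof (cases "j < length fs")
    case True
    then show ?thesis using snoc by (simp add: nth_append)
  next
    case False
    then have j: "j = length fs" using snoc by simp
    have "uncovered p d (fs @ [f]) \<noteq> uncovered p d fs"
    proof
      assume "uncovered p d (fs @ [f]) = uncovered p d fs"
      then have "g q d * real (card (uncovered p d fs)) \<le> 0" using snoc by (simp add: algebra_simps)
      moreover have "card (uncovered p d fs) > 0" using snoc by (simp add: card_gt_0_iff)
      ultimately show False using g_pos[OF snoc.prems(2)] by (simp add: mult_le_0_iff)
    qed
    then show ?thesis using j unfolding uncovered_snoc by (auto simp: comp_def)
  qed
qed simp

text \<open>The code that \<open>fs ! j\<close> newly separates is not separated by
  \<open>fs ! i\<close>. Its digits are below p, so the two functions differ at a residue and not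
  merely somewhere.\<close>

lemma greedy_distinct:
  assumes "greedy p q d fs" "d \<le> q" "0 < p" "i < j" "j < length fs"
  shows "\<exists>a<p. (fs ! i) a \<noteq> (fs ! j) a"
proof (rule ccontr)
  assume *: "\<not> ?thesis"
  from greedy_new[OF assms(1,2,5)] obtain y where
    y: "y \<in> uncovered p d (take j fs)" "inj_on ((fs ! j) \<circ> digit p y) {..<d}" by blast
  have "(fs ! i) (digit p y k) = (fs ! j) (digit p y k)" for k
    using * digit_less[OF assms(3)] by blast
  then have "inj_on ((fs ! i) \<circ> digit p y) {..<d}" using y by (simp add: inj_on_def)
  moreover have "fs ! i \<in> set (take j fs)" using assms by (auto simp: set_conv_nth intro!: exI[of _ i])
  ultimately show False using y unfolding uncovered_def by blast
qed

text \<open>Injectivity on the first two digits of a separated code suffices. Nonconstancy is what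
  tells apart functions lifted from different moduli.\<close>

lemma greedy_nonconstant:
  assumes "greedy p q d fs" "d \<le> q" "0 < p" "2 \<le> d" "f \<in> set fs"
  shows "\<exists>a<p. \<exists>b<p. f a \<noteq> f b"
proof -
  obtain j where j: "j < length fs" "f = fs ! j" using assms by (auto simp: set_conv_nth)
  from greedy_new[OF assms(1,2) j(1)] obtain y where "inj_on (f \<circ> digit p y) {..<d}" using j by blast
  then have "f (digit p y 0) \<noteq> f (digit p y 1)" using assms(4) inj_onD[of "f \<circ> digit p y" "{..<d}" 0 1] by auto
  then show ?thesis using digit_less[OF assms(3), of y 0] digit_less[OF assms(3), of y 1] by blast
qed

section \<open>Reduction modulo primes\<close>

lemma prod_primes_dvd:
  assumes "finite B" "\<And>p. p \<in> B \<Longrightarrow> prime p \<and> p dvd z"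
  shows "(\<Prod>B) dvd (z :: nat)"
  using assms
proof (induction B rule: finite_induct)
  case (insert p B)
  have "coprime p (\<Prod>B)"
    using insert by (intro prod_coprime_right) (metis insertCI primes_coprime)
  then show ?case using insert by (auto intro: divides_mult)
qed simp

text \<open>The primes in question exceed l and their product divides z, so l to the power of their
  number is at most z < n <= l^K.\<close>

lemma card_prime_divisors_less:
  assumes "finite P" "\<And>p. p \<in> P \<Longrightarrow> prime p \<and> l < p" "0 < z" "z < n" "n \<le> l ^ K" "1 < (l :: nat)"
  shows "card {p\<in>P. p dvd z} < K"
proof -
  let ?B = "{p\<in>P. p dvd z}"
  have "l ^ card ?B = (\<Prod>p\<in>?B. l)" by simp
  also have "\<dots> \<le> (\<Prod>?B)" using assms(2) by (intro prod_mono) (auto intro: less_imp_le)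
  also have "\<dots> \<le> z" using assms by (intro dvd_imp_le prod_primes_dvd) auto
  also have "\<dots> < l ^ K" using assms by simp
  finally show ?thesis using assms by (meson power_less_imp_less_exp)
qed

text \<open>A prime is bad if it divides some difference y - x. There are at most d^2 pairs x < y,
  and each spoils at most K - 1 primes, which is too few to exhaust P.\<close>

lemma exists_injective_modulus:
  fixes n l d K :: nat
  assumes P: "finite P" "\<And>p. p \<in> P \<Longrightarrow> prime p \<and> l < p" "d\<^sup>2 * K \<le> card P"
    and n: "n \<le> l ^ K" "1 < l" "0 < K" and S: "S \<subseteq> {..<n}" "card S = d" "0 < d"
  shows "\<exists>p\<in>P. inj_on (\<lambda>x. x mod p) S"
proof (rule ccontr)
  assume *: "\<not> ?thesis"
  have fin: "finite S" using S by (metis card_ge_0_finite)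
  define D where "D = {(x, y). x \<in> S \<and> y \<in> S \<and> x < y}"
  have D: "finite D" "D \<subseteq> S \<times> S" using fin by (auto simp: D_def intro: finite_subset[of _ "S \<times> S"])
  have "card D \<le> d\<^sup>2" using card_mono[OF _ D(2)] fin S by (simp add: power2_eq_square)
  have "P \<subseteq> (\<Union>(x, y)\<in>D. {p\<in>P. p dvd (y - x)})"
  proof
    fix p assume p: "p \<in> P"
    with * have "\<exists>x\<in>S. \<exists>y\<in>S. x \<noteq> y \<and> x mod p = y mod p" unfolding inj_on_def by blast
    then obtain x y where "x \<in> S" "y \<in> S" "x < y" "x mod p = y mod p"
      by (metis nat_neq_iff)
    moreover from this have "p dvd y - x" using mod_eq_dvd_iff_nat[of x y p] by simp
    ultimately show "p \<in> (\<Union>(x, y)\<in>D. {p\<in>P. p dvd (y - x)})"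
      using p by (auto simp: D_def)
  qed
  then have "card P \<le> card (\<Union>(x, y)\<in>D. {p\<in>P. p dvd (y - x)})"
    using D P by (intro card_mono) auto
  also have "\<dots> \<le> (\<Sum>(x, y)\<in>D. card {p\<in>P. p dvd (y - x)})"
    using card_UN_le[OF D(1), of "\<lambda>(x, y). {p\<in>P. p dvd (y - x)}"] by (simp add: case_prod_unfold)
  also have "\<dots> \<le> (\<Sum>(x, y)\<in>D. K - 1)"
  proof (intro sum_mono)
    fix z assume "z \<in> D"
    then obtain x y where z: "z = (x, y)" "x \<in> S" "y \<in> S" "x < y" by (auto simp: D_def)
    then have "y - x < n" using S by auto
    with z have "card {p\<in>P. p dvd (y - x)} < K"
      using P n by (intro card_prime_divisors_less[where l = l and n = n]) auto
    then show "(case z of (x, y) \<Rightarrow> card {p\<in>P. p dvd (y - x)}) \<le> (case z of (x, y) \<Rightarrow> K - 1)"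
      using z by simp
  qed
  also have "\<dots> = card D * (K - 1)" by (simp add: case_prod_unfold)
  also have "\<dots> \<le> d\<^sup>2 * (K - 1)" using \<open>card D \<le> d\<^sup>2\<close> by (rule mult_le_mono1)
  also have "\<dots> < d\<^sup>2 * K" using S n by simp
  finally show False using P by simp
qed

section \<open>Lifting hash functions from residues to [n]\<close>

definition lifted :: "nat \<Rightarrow> nat \<times> (nat \<Rightarrow> nat) \<Rightarrow> nat \<Rightarrow> nat" where
  "lifted n = (\<lambda>(p, f). restrict (\<lambda>x. f (x mod p)) {..<n})"

definition pairs :: "nat list \<Rightarrow> (nat \<Rightarrow> (nat \<Rightarrow> nat) list) \<Rightarrow> (nat \<times> (nat \<Rightarrow> nat)) list" where
  "pairs ps F = concat (map (\<lambda>p. map (Pair p) (F p)) ps)"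

lemma lifted_neq_same_modulus:
  assumes "a < p" "f a \<noteq> h a" "p \<le> n"
  shows "lifted n (p, f) \<noteq> lifted n (p, h)"
  using assms by (auto simp: lifted_def fun_eq_iff intro!: exI[of _ a])

text \<open>By the Chinese remainder theorem each residue c modulo p has a representative x < p p'
  <= n that is divisible by p'. If the lifts agreed, f c = h 0 would hold for every c, making f
  constant.\<close>

lemma lifted_neq_coprime_moduli:
  assumes "coprime p p'" "p * p' \<le> n" "a < p" "b < p" "f a \<noteq> f b" "0 < p'"
  shows "lifted n (p, f) \<noteq> lifted n (p', h)"
proof
  assume eq: "lifted n (p, f) = lifted n (p', h)"
  have *: "f c = h 0" if c: "c < p" for c
  proof -
    obtain x where x: "x < p * p'" "[x = c] (mod p)" "[x = 0] (mod p')"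
      using binary_chinese_remainder_unique_nat[of p p' c 0] assms by auto
    then have "lifted n (p, f) x = f c" "lifted n (p', h) x = h 0"
      using assms c by (auto simp: lifted_def cong_def)
    then show ?thesis using eq by simp
  qed
  then show False using assms by metis
qed

text \<open>The interface between program and combinatorics: what a finished search has established
  about its moduli and families. The bound p p' <= n serves the Chinese remainder argument.\<close>

locale hash_moduli =
  fixes n q d l K :: nat and ps :: "nat list" and F :: "nat \<Rightarrow> (nat \<Rightarrow> nat) list"
  assumes d: "2 \<le> d" "d \<le> q" "d \<le> l" and K: "0 < K" "n \<le> l ^ K"
    and ps: "distinct ps" "\<And>p. p \<in> set ps \<Longrightarrow> prime p \<and> l < p" "length ps = d\<^sup>2 * K"
    and n: "\<And>p p'. p \<in> set ps \<Longrightarrow> p' \<in> set ps \<Longrightarrow> p * p' \<le> n"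
    and F: "\<And>p. p \<in> set ps \<Longrightarrow> greedy p q d (F p)" "\<And>p. p \<in> set ps \<Longrightarrow> uncovered p d (F p) = {}"
begin

definition "hs = map (lifted n) (pairs ps F)"

lemma modulus_le: "p \<in> set ps \<Longrightarrow> p \<le> n"
  using n[of p p] ps(2)[of p] by (metis le_trans nat_le_linear le_square)

text \<open>Functions over one modulus differ at a residue, those over two moduli by the Chinese
  remainder argument. Hence the printed list is a description, and its length is the size of the
  family.\<close>

lemma distinct_hs: "distinct hs"
proof -
  have "distinct (map (lifted n) (pairs xs F))" if "distinct xs" "set xs \<subseteq> set ps" for xs
    using that
  proof (induction xs)
    case (Cons p xs)
    then have p: "p \<in> set ps" "p \<notin> set xs" "0 < p" "d \<le> p" using ps d by fastforce+
    have "distinct (map (lifted n \<circ> Pair p) (F p))"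
      unfolding distinct_conv_nth
    proof (intro allI impI)
      fix i j assume "i < length (map (lifted n \<circ> Pair p) (F p))" "j < length (map (lifted n \<circ> Pair p) (F p))" "i \<noteq> j"
      then obtain a where "a < p" "(F p ! i) a \<noteq> (F p ! j) a"
        using greedy_distinct[OF F(1)[OF p(1)] d(2) p(3)] by (metis length_map linorder_neqE_nat)
      then show "map (lifted n \<circ> Pair p) (F p) ! i \<noteq> map (lifted n \<circ> Pair p) (F p) ! j"
        using \<open>i < _\<close> \<open>j < _\<close> lifted_neq_same_modulus modulus_le[OF p(1)] by simp
    qed
    moreover have "lifted n (p, f) \<noteq> lifted n (p', h)" if that': "f \<in> set (F p)" "p' \<in> set xs" for f h p'
    proof -
      have p': "p' \<in> set ps" "p' \<noteq> p" using that' p Cons by auto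
      obtain a b where "a < p" "b < p" "f a \<noteq> f b"
        using greedy_nonconstant[OF F(1)[OF p(1)] d(2) p(3) d(1) that'(1)] by blast
      moreover have "coprime p p'"
        using primes_coprime[of p p'] ps(2)[OF p(1)] ps(2)[OF p'(1)] p'(2) by auto
      ultimately show ?thesis using p p' n ps
        by (intro lifted_neq_coprime_moduli) (auto simp: prime_gt_0_nat)
    qed
    ultimately show ?case using Cons by (auto simp: pairs_def)
  qed (simp add: pairs_def)
  then show ?thesis using ps by (auto simp: hs_def)
qed

text \<open>Reduction modulo a suitable prime maps S injectively to residues, where the complete
  greedy family for that prime applies. The range may grow from q to q' because the search runs with
  a reduced range size.\<close>

lemma perfect_hs: 
  assumes "q \<le> q'"
  shows "perfect_hash_family n q' d (set hs)"
  unfolding perfect_hash_family_def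
proof (intro conjI allI impI subsetI)
  fix h assume "h \<in> set hs"
  then obtain p f where h: "p \<in> set ps" "f \<in> set (F p)" "h = lifted n (p, f)"
    by (auto simp: hs_def pairs_def)
  then have "0 < p" using ps by (auto simp: prime_gt_0_nat)
  then have "f (x mod p) < q" for x using greedy_range[OF F(1)] h by simp
  then show "h \<in> {..<n} \<rightarrow>\<^sub>E {..<q'}" using assms h by (auto simp: lifted_def intro: less_le_trans)
next
  fix S assume S: "S \<subseteq> {..<n} \<and> card S = d"
  have "\<exists>p\<in>set ps. inj_on (\<lambda>x. x mod p) S"
    using d K ps S distinct_card[OF ps(1)] by (intro exists_injective_modulus[where l = l and K = K and d = d and n = n]) auto
  then obtain p where p: "p \<in> set ps" "inj_on (\<lambda>x. x mod p) S" by blast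
  then have "0 < p" using ps by (auto simp: prime_gt_0_nat)
  then have "(\<lambda>x. x mod p) ` S \<subseteq> {..<p}" "card ((\<lambda>x. x mod p) ` S) = d"
    using p S by (auto simp: card_image)
  then obtain f where f: "f \<in> set (F p)" "inj_on f ((\<lambda>x. x mod p) ` S)"
    using uncovered_empty_imp_inj[OF F(2)[OF p(1)], of "(\<lambda>x. x mod p) ` S"] d by auto
  have "inj_on (\<lambda>x. f (x mod p)) S" using comp_inj_on[OF p(2) f(2)] by (simp add: comp_def)
  then have "inj_on (lifted n (p, f)) S" using S by (subst inj_on_cong[of _ _ "\<lambda>x. f (x mod p)"]) (auto simp: lifted_def)
  then show "\<exists>h\<in>set hs. inj_on h S" using p f by (auto simp: hs_def pairs_def)
qed

text \<open>Shows that the output contains at least one function, so that additive costs linear in n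
  can be absorbed.\<close>

lemma length_hs_ge: "length ps \<le> length hs"
proof -
  have "1 \<le> length (F p)" if "p \<in> set ps" for p
    using uncovered_Nil_nonempty[of d p] F(2)[OF that] ps(2)[OF that] d by (cases "F p") auto
  then have "(\<Sum>p\<leftarrow>ps. 1) \<le> (\<Sum>p\<leftarrow>ps. length (F p))" by (intro sum_list_mono)
  then show ?thesis by (simp add: hs_def pairs_def length_concat comp_def sum_list_triv)
qed

lemma length_hs_le:
  assumes "\<And>p. p \<in> set ps \<Longrightarrow> p \<le> r"
  shows "real (length hs) \<le> real (d\<^sup>2 * K) * (1 + real d * ln (real r) / g q d)"
proof -
  have "real (length hs) = (\<Sum>p\<leftarrow>ps. real (length (F p)))"
  proof -
    have "real (\<Sum>p\<leftarrow>xs. length (F p)) = (\<Sum>p\<leftarrow>xs. real (length (F p)))" for xs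
      by (induction xs) auto
    then show ?thesis by (simp add: hs_def pairs_def length_concat comp_def)
  qed
  also have "\<dots> \<le> (\<Sum>p\<leftarrow>ps. 1 + real d * ln (real r) / g q d)"
  proof (rule sum_list_mono)
    fix p assume p: "p \<in> set ps"
    then have "0 < p" using ps by (auto simp: prime_gt_0_nat)
    have "real (length (F p)) \<le> 1 + real d * ln (real p) / g q d"
      by (rule greedy_length) (use F p d \<open>0 < p\<close> in auto)
    also have "\<dots> \<le> 1 + real d * ln (real r) / g q d"
      using assms[OF p] \<open>0 < p\<close> g_pos[OF d(2)]
      by (intro add_mono divide_right_mono mult_left_mono) auto
    finally show "real (length (F p)) \<le> 1 + real d * ln (real r) / g q d" .
  qed
  also have "\<dots> = real (length ps) * (1 + real d * ln (real r) / g q d)"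
    by (simp add: sum_list_triv)
  finally show ?thesis using ps by simp
qed

end

section \<open>Parameters\<close>

text \<open>With L = log n, the bound on d reads 8 d log L <= L, that is L^(8 d) <= n. It also
  excludes small n: it yields l^8 < 2^(l + 1), which among l >= 2 fails up to 42.\<close>

lemma floor_log_bounds:
  assumes "1 \<le> d" "real d \<le> log 2 (real n) / (8 * log 2 (log 2 (real n)))"
    and l: "2 ^ l \<le> n" "n < 2 * 2 ^ l"
  shows "43 \<le> l" "l ^ (8 * d) \<le> n" "real d * (8 * log 2 (real l)) \<le> log 2 (real n)"
    "real l \<le> log 2 (real n)" "log 2 (real n) \<le> real l + 1"
proof -
  define L where "L = log 2 (real n)"
  have n: "0 < n" using l by (meson less_le_trans zero_less_numeral zero_less_power)
  have L: "real l \<le> L" "L < real l + 1"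
  proof -
    have "real (2 ^ l) \<le> real n" using l of_nat_le_iff by blast
    then show "real l \<le> L" unfolding L_def using n by (simp add: le_log_iff powr_realpow)
    have "real n < real (2 * 2 ^ l)" using l of_nat_less_iff by blast
    then show "L < real l + 1" unfolding L_def using n by (simp add: log_less_iff powr_add powr_realpow)
  qed
  have d: "real d \<le> L / (8 * log 2 L)" using assms by (simp add: L_def)
  \<comment> \<open>As x / 0 = 0, the bound on d would read d <= 0 in both cases: the numerator
    vanishes for L = 0, and \<open>log 2 L\<close> for L = 1.\<close>
  have "L \<noteq> 0" "L \<noteq> 1" using d assms(1) by auto
  have "1 < L"
  proof (rule ccontr)
    assume "\<not> 1 < L"
    with L \<open>L \<noteq> 1\<close> have "l = 0" by auto
    with l have "n = 1" by simp
    with \<open>L \<noteq> 0\<close> show False by (simp add: L_def)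
  qed
  then have M: "0 < log 2 L" by simp
  with d have dL: "real d * (8 * log 2 L) \<le> L" by (simp add: field_simps)
  have pow: "L ^ (8 * d) \<le> real n"
  proof -
    have "L ^ (8 * d) = 2 powr (log 2 (L ^ (8 * d)))" using \<open>1 < L\<close> by simp
    also have "log 2 (L ^ (8 * d)) = real d * (8 * log 2 L)" using \<open>1 < L\<close> by (simp add: log_nat_power)
    also have "2 powr \<dots> \<le> 2 powr L" using dL by simp
    also have "\<dots> = real n" using n by (simp add: L_def)
    finally show ?thesis .
  qed
  have "real (l ^ (8 * d)) \<le> L ^ (8 * d)" using L by (simp add: power_mono)
  with pow show "l ^ (8 * d) \<le> n" by (metis of_nat_le_iff order_trans)
  have "L ^ 8 \<le> L ^ (8 * d)" using \<open>1 < L\<close> assms(1) by (intro power_increasing) auto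
  with pow have L8: "L ^ 8 \<le> real n" by simp
  have l8: "l ^ 8 < 2 * 2 ^ l"
  proof -
    have "real (l ^ 8) \<le> L ^ 8" using L by (simp add: power_mono)
    with L8 have "l ^ 8 \<le> n" by (metis of_nat_le_iff order_trans)
    with l show ?thesis by simp
  qed
  \<comment> \<open>l = 1 satisfies l^8 < 2^(l + 1) and needs its own argument: n = 2 gives L = 1,
    and n = 3 fails because L >= 3/2 while (3/2)^8 > 3.\<close>
  have "l \<noteq> 1"
  proof
    assume "l = 1"
    with l \<open>L \<noteq> 1\<close> have "n = 3" by (cases "n = 2") (auto simp: L_def)
    have "3 / 2 \<le> L"
    proof -
      have "log 2 ((2::real) ^ 3) \<le> log 2 (3 ^ 2)" by (subst log_le_cancel_iff) auto
      then have "3 * log 2 2 \<le> 2 * log 2 (3::real)" by (simp only: log_nat_power)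
      then show ?thesis using \<open>n = 3\<close> by (simp add: L_def)
    qed
    then have "(3/2) ^ 8 \<le> L ^ 8" by (intro power_mono) auto
    with L8 \<open>n = 3\<close> show False by (simp add: power_divide)
  qed
  moreover have "l \<noteq> 0" using \<open>1 < L\<close> L by auto
  moreover have "\<forall>l\<in>set [2..<43]. \<not> l ^ 8 < 2 * 2 ^ (l::nat)" by (simp add: upt_rec_numeral)
  ultimately show l43: "43 \<le> l" using l8 by (metis One_nat_def Suc_leI less_one linorder_not_le nat_neq_iff one_add_one plus_1_eq_Suc set_upt atLeastLessThan_iff)
  show "real l \<le> log 2 (real n)" "log 2 (real n) \<le> real l + 1" using L by (auto simp: L_def)
  have "log 2 (real l) \<le> log 2 L" using L l43 by simp
  then have "real d * (8 * log 2 (real l)) \<le> real d * (8 * log 2 L)" by (intro mult_left_mono) auto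
  with dL show "real d * (8 * log 2 (real l)) \<le> log 2 (real n)" by (simp add: L_def)
qed

locale parameters =
  fixes n d l K :: nat
  assumes d: "1 \<le> d" "real d * (8 * log 2 (real l)) \<le> log 2 (real n)"
    and l: "43 \<le> l" "real l \<le> log 2 (real n)" "log 2 (real n) \<le> real l + 1" "l ^ (8 * d) \<le> n"
    and K: "K = 0 \<or> l ^ (K - 1) < n"
begin

lemma log_l: "5 \<le> log 2 (real l)" "log 2 (real l) \<le> real l"
proof -
  have "(2::real) powr 5 \<le> real l" using l by simp
  then show "5 \<le> log 2 (real l)" using l by (simp add: le_log_iff)
  have "real l < 2 ^ l" by (metis of_nat_less_two_power)
  then show "log 2 (real l) \<le> real l" using l by (simp add: log_le_iff powr_realpow)
qed

lemma d_small: "40 * d \<le> l + 1"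
proof -
  have "real d * (8 * 5) \<le> real d * (8 * log 2 (real l))" using log_l by (intro mult_left_mono) auto
  also have "\<dots> \<le> real l + 1" using d l by simp
  finally show ?thesis by linarith
qed

lemma d_le: "d \<le> l" using d_small l by simp

lemma log_l_le: "log 2 (real l) \<le> log 2 (real n)"
proof -
  have "log 2 (real l) * 1 \<le> real d * (8 * log 2 (real l))" using d log_l by (simp add: mult_le_cancel_right1)
  with d show ?thesis by simp
qed

text \<open>By minimality of K, (K - 1) log l <= log n; the missing log l is at most log n, whence
  the factor 2.\<close>

lemma K_le: "real K * log 2 (real l) \<le> 2 * log 2 (real n)"
proof (cases "K = 0")
  case False
  with K have "real (l ^ (K - 1)) < real n" using of_nat_less_iff by blast
  then have "log 2 (real (l ^ (K - 1))) \<le> log 2 (real n)" using l by simp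
  then have "(real K - 1) * log 2 (real l) \<le> log 2 (real n)"
    using False l by (simp add: log_nat_power of_nat_diff)
  with log_l_le show ?thesis by (simp add: algebra_simps)
qed (use log_l_le log_l in simp)

text \<open>With M = log l and L = log n, multiplying (8 d M)^2 <= L^2 by K M <= 2 L gives d^2 K M^3
  <= L^3 / 32. Replacing L by l costs a factor 2, and M >= 5 removes a factor M^2 >= 25, so 400 = 16
  * 25.\<close>

lemma moduli_bound: "real (d\<^sup>2 * K) * log 2 (real l) \<le> real l ^ 3 / 400"
proof -
  let ?M = "log 2 (real l)" and ?L = "log 2 (real n)"
  have L: "0 \<le> ?L" using l by linarith
  have "(real d * (8 * ?M))\<^sup>2 \<le> ?L\<^sup>2" using d log_l by (intro power_mono) auto
  then have "(real d * (8 * ?M))\<^sup>2 * (real K * ?M) \<le> ?L\<^sup>2 * (2 * ?L)"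
    by (rule mult_mono[OF _ K_le]) (use L log_l in auto)
  then have 1: "real (d\<^sup>2 * K) * ?M * ?M\<^sup>2 \<le> ?L ^ 3 / 32"
    by (simp add: power2_eq_square power3_eq_cube field_simps)
  \<comment> \<open>As l >= 43, l + 1 is at most 44/43 times l; the cube of 44/43 is below
    2.\<close>
  have "?L \<le> real l * (44/43)" using l by simp
  then have "?L ^ 3 \<le> (real l * (44/43)) ^ 3" using l by (intro power_mono) auto
  also have "\<dots> \<le> 2 * real l ^ 3" by (simp add: power_mult_distrib power_divide)
  finally have 2: "real (d\<^sup>2 * K) * ?M * ?M\<^sup>2 \<le> real l ^ 3 / 16" using 1 by simp
  have "5\<^sup>2 \<le> ?M\<^sup>2" using log_l by (intro power_mono) auto
  then have "real (d\<^sup>2 * K) * ?M * 25 \<le> real (d\<^sup>2 * K) * ?M * ?M\<^sup>2"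
    using log_l by (intro mult_left_mono) auto
  with 2 show ?thesis by simp
qed

text \<open>Counting each prime with weight log l, the Chebyshev bound at l^3 provides about l^3 /
  3. Discarding the primes up to l costs only order l^2, and \<open>moduli_bound\<close> asks for
  l^3 / 400.\<close>

lemma enough_primes: "d\<^sup>2 * K \<le> card {p. prime p \<and> l < p \<and> p \<le> l ^ 3}"
proof -
  let ?M = "log 2 (real l)" and ?c = "card {p. prime p \<and> l < p \<and> p \<le> l ^ 3}"
  have "card {p. prime p \<and> p \<le> l ^ 3} \<le> card ({..l} \<union> {p. prime p \<and> l < p \<and> p \<le> l ^ 3})"
    by (intro card_mono) auto
  also have "\<dots> \<le> (l + 1) + ?c" using card_Un_le[of "{..l}"] by simp
  finally have c: "card {p. prime p \<and> p \<le> l ^ 3} \<le> (l + 1) + ?c" .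
  have "2 \<le> l ^ 3" using l self_le_power[of l 3] by linarith
  from primes_lower[OF this] have "real l ^ 3 - 1 \<le> (real (card {p. prime p \<and> p \<le> l ^ 3}) + 1) * (3 * ?M)"
    using l by (simp add: log_nat_power)
  also have "\<dots> \<le> (real l + 2 + real ?c) * (3 * ?M)"
    using c log_l by (intro mult_right_mono) auto
  finally have "real l ^ 3 - 1 \<le> 3 * ((real l + 2) * ?M) + 3 * (real ?c * ?M)" by (simp add: algebra_simps)
  moreover have "(real l + 2) * ?M \<le> (2 * real l) * real l"
    using l log_l by (intro mult_mono) auto
  moreover have "43 * (real l * real l) \<le> real l ^ 3"
    using l by (simp add: power3_eq_cube mult_right_mono)
  moreover have "43 * 43 \<le> real l * real l" using l by (intro mult_mono) auto
  ultimately have "real l ^ 3 / 400 \<le> real ?c * ?M" by simp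
  with moduli_bound have "real (d\<^sup>2 * K) * ?M \<le> real ?c * ?M" by simp
  then have "real (d\<^sup>2 * K) \<le> real ?c" using log_l by (simp add: mult_le_cancel_right)
  then show ?thesis by linarith
qed

text \<open>For r = l^3 < q, Bernoulli's inequality gives g r d >= (1 - d/r)^(d - 1) >= 1 - d^2/r >=
  1/2, because r >= 2 d^2, while g q d <= 1.\<close>

lemma g_range:
  assumes "d \<le> q"
  shows "g q d \<le> 2 * g (min q (l ^ 3)) d"
proof (cases "q \<le> l ^ 3")
  case True
  then show ?thesis using g_pos[OF assms] by simp
next
  case False
  let ?r = "l ^ 3"
  have l3: "l * d \<le> ?r" "d * d * 2 \<le> ?r"
  proof -
    have "l * d * 1 \<le> l * l * l" by (intro mult_le_mono) (use d_le l in auto)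
    then show "l * d \<le> ?r" by (simp add: power3_eq_cube)
    have "d * d * 2 \<le> l * l * l" by (intro mult_le_mono) (use d_le l in auto)
    then show "d * d * 2 \<le> ?r" by (simp add: power3_eq_cube)
  qed
  have dr: "d \<le> ?r" using l3 d d_le by (metis le_square le_trans mult_le_mono1)
  have "real (d * d * 2) \<le> real ?r" using l3(2) of_nat_le_iff by blast
  moreover have "0 < real ?r" using l by simp
  ultimately have "1 / 2 \<le> 1 - real d * (real d / real ?r)" by (simp add: field_simps del: of_nat_power)
  also have "\<dots> \<le> 1 + real (d - 1) * (- (real d / real ?r))"
  proof -
    have "real (d - 1) * (real d / real ?r) \<le> real d * (real d / real ?r)"
      by (intro mult_right_mono) auto
    then show ?thesis by simp
  qed
  also have "\<dots> \<le> (1 + (- (real d / real ?r))) ^ (d - 1)"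
  proof (rule Bernoulli_inequality)
    have "real d \<le> real ?r" using dr of_nat_le_iff by blast
    then show "-1 \<le> - (real d / real ?r)" using l by (simp add: field_simps)
  qed
  also have "\<dots> = (\<Prod>i = 1..<d. 1 - real d / real ?r)" by simp
  also have "\<dots> \<le> g ?r d" unfolding g_def
  proof (rule prod_mono)
    fix i assume "i \<in> {1..<d}"
    moreover have "real d \<le> real ?r" using dr of_nat_le_iff by blast
    ultimately show "0 \<le> 1 - real d / real ?r \<and> 1 - real d / real ?r \<le> 1 - real i / real ?r"
      using l by (auto simp: field_simps)
  qed
  finally have "1 \<le> 2 * g ?r d" by simp
  with g_le_1[OF assms] False show ?thesis by (simp add: min_def)
qed

text \<open>The 16 is 4 * 2 * 2: ln (l^3) <= 3 log l and one more log l for the summand 1, the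
  halving of g by the reduced range, and K log l <= 2 log n. In the last of these log l
  cancels.\<close>

lemma size_bound:
  assumes "d \<le> q"
  shows "real (d\<^sup>2 * K) * (1 + real d * ln (real (l ^ 3)) / g (min q (l ^ 3)) d)
    \<le> 16 * (real d ^ 3 * log 2 (real n) / g q d)"
proof -
  let ?q = "min q (l ^ 3)" and ?M = "log 2 (real l)"
  have "d \<le> l ^ 3" using d_le l self_le_power[of l 3] by linarith
  then have dq: "d \<le> ?q" using assms by simp
  then have G: "0 < g ?q d" "g ?q d \<le> 1" "0 < g q d" using g_pos g_le_1 assms by auto
  have "ln (real (l ^ 3)) = 3 * (?M * ln 2)" using l by (simp add: ln_realpow log_def)
  also have "\<dots> \<le> 3 * (?M * 1)" using ln_2_less_1 log_l by (intro mult_left_mono) auto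
  finally have ln: "ln (real (l ^ 3)) \<le> 3 * ?M" by simp
  have 1: "1 \<le> real d * ?M / g ?q d"
  proof -
    have "1 * 1 \<le> real d * ?M" using d log_l by (intro mult_mono) auto
    then show ?thesis using G by (simp add: field_simps)
  qed
  have "real d * ln (real (l ^ 3)) / g ?q d \<le> real d * (3 * ?M) / g ?q d"
    using G ln by (intro divide_right_mono mult_left_mono) auto
  also have "\<dots> = 3 * (real d * ?M / g ?q d)" by simp
  finally have "1 + real d * ln (real (l ^ 3)) / g ?q d \<le>
      real d * ?M / g ?q d + 3 * (real d * ?M / g ?q d)"
    by (rule add_mono[OF 1])
  also have "\<dots> = 4 * (real d * ?M / g ?q d)" by simp
  also have "\<dots> \<le> 4 * (real d * ?M * (2 / g q d))"
  proof -
    have "1 / g ?q d \<le> 2 / g q d" using g_range[OF assms] G by (simp add: field_simps)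
    then have "4 * (real d * ?M * (1 / g ?q d)) \<le> 4 * (real d * ?M * (2 / g q d))"
      using log_l by (intro mult_left_mono) auto
    then show ?thesis by simp
  qed
  finally have "real (d\<^sup>2 * K) * (1 + real d * ln (real (l ^ 3)) / g ?q d) \<le>
      real (d\<^sup>2 * K) * (4 * (real d * ?M * (2 / g q d)))"
    by (intro mult_left_mono) auto
  also have "\<dots> = 8 * real d ^ 3 / g q d * (real K * ?M)"
    by (simp add: power2_eq_square power3_eq_cube)
  also have "\<dots> \<le> 8 * real d ^ 3 / g q d * (2 * log 2 (real n))"
    using K_le G by (intro mult_left_mono) auto
  finally show ?thesis by simp
qed

end

section \<open>Weakest preconditions for the word RAM\<close>

datatype expr = Reg nat | Lit nat | Bin binop expr expr | Mem expr

fun ev :: "expr \<Rightarrow> (nat \<Rightarrow> nat) \<Rightarrow> (nat \<Rightarrow> nat) \<Rightarrow> nat" where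
  "ev (Reg x) v m = v x"
| "ev (Lit c) v m = c"
| "ev (Bin b e1 e2) v m = binop_val b (ev e1 v m) (ev e2 v m)"
| "ev (Mem e) v m = m (ev e v m)"

text \<open>Every intermediate value has to be a word, since otherwise the machine has no
  transition; a value read from memory is one by the invariant \<open>words\<close>. The bound 50
  keeps expressions off the scratch registers.\<close>

fun fits :: "nat \<Rightarrow> expr \<Rightarrow> (nat \<Rightarrow> nat) \<Rightarrow> (nat \<Rightarrow> nat) \<Rightarrow> bool" where
  "fits W (Reg x) v m \<longleftrightarrow> x < 50"
| "fits W (Lit c) v m \<longleftrightarrow> c < W"
| "fits W (Bin b e1 e2) v m \<longleftrightarrow> fits W e1 v m \<and> fits W e2 v m \<and>
     binop_val b (ev e1 v m) (ev e2 v m) < W"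
| "fits W (Mem e) v m \<longleftrightarrow> fits W e v m"

fun cost :: "expr \<Rightarrow> nat" where
  "cost (Reg x) = 2"
| "cost (Lit c) = 1"
| "cost (Bin b e1 e2) = cost e1 + cost e2 + 1"
| "cost (Mem e) = cost e + 1"

text \<open>Registers from t on act as an evaluation stack. Lacking a move instruction, the machine
  copies a register by adding it to 0.\<close>

fun compile :: "expr \<Rightarrow> nat \<Rightarrow> com" where
  "compile (Reg x) t = Seq (Const t 0) (Op Add t x t)"
| "compile (Lit c) t = Const t c"
| "compile (Bin b e1 e2) t = Seq (compile e1 t) (Seq (compile e2 (Suc t)) (Op b t t (Suc t)))"
| "compile (Mem e) t = Seq (compile e t) (Load t t)"

definition words :: "nat \<Rightarrow> state \<Rightarrow> bool" where
  "words W s \<longleftrightarrow> (\<forall>i. reg s i < W) \<and> (\<forall>a. mem s a < W)"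

lemma exec_words: "exec W c s t s' \<Longrightarrow> words W s \<Longrightarrow> words W s'"
  by (induction rule: exec.induct) (auto simp: words_def set_reg_def)

lemma fits_cong: "(\<And>i. i < 50 \<Longrightarrow> v i = v' i) \<Longrightarrow> fits W e v m = fits W e v' m"
  and ev_cong: "(\<And>i. i < 50 \<Longrightarrow> v i = v' i) \<Longrightarrow> fits W e v m \<Longrightarrow> ev e v m = ev e v' m"
proof -
  have "(\<forall>i<50. v i = v' i) \<Longrightarrow> fits W e v m = fits W e v' m \<and> (fits W e v m \<longrightarrow> ev e v m = ev e v' m)"
    by (induction e) auto
  then show "(\<And>i. i < 50 \<Longrightarrow> v i = v' i) \<Longrightarrow> fits W e v m = fits W e v' m"
    and "(\<And>i. i < 50 \<Longrightarrow> v i = v' i) \<Longrightarrow> fits W e v m \<Longrightarrow> ev e v m = ev e v' m" by auto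
qed

lemma compile_exec:
  assumes "words W s" "fits W e (reg s) (mem s)" "t \<ge> 50"
  shows "\<exists>s'. exec W (compile e t) s (cost e) s' \<and> mem s' = mem s \<and> out s' = out s \<and>
    reg s' t = ev e (reg s) (mem s) \<and> (\<forall>i<t. reg s' i = reg s i)"
  using assms
proof (induction e arbitrary: s t)
  case (Reg x)
  have "0 < W" "reg s x < W" using Reg by (auto simp: words_def intro: le_less_trans)
  then have "exec W (compile (Reg x) t) s (1+1) (set_reg t (reg s x) (set_reg t 0 s))"
    using Reg exec.Const[of 0 W t s] exec.Op[of "reg s x" Add "set_reg t 0 s" x t W t]
    by (simp only: compile.simps, intro exec.Seq) (auto simp: set_reg_def)
  then show ?case using Reg by (fastforce simp: set_reg_def numeral_2_eq_2)
next
  case (Lit c)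
  then have "exec W (compile (Lit c) t) s 1 (set_reg t c s)" using exec.Const[of c W t s] by simp
  then show ?case by (fastforce simp: set_reg_def)
next
  case (Bin b e1 e2)
  from Bin.IH(1)[OF Bin.prems(1) _ Bin.prems(3)] Bin.prems(2) obtain s1 where
    s1: "exec W (compile e1 t) s (cost e1) s1" "mem s1 = mem s" "out s1 = out s"
     "reg s1 t = ev e1 (reg s) (mem s)" "\<forall>i<t. reg s1 i = reg s i" by auto
  have w1: "words W s1" using exec_words s1(1) Bin.prems by blast
  have a: "fits W e2 (reg s1) (mem s1)" "ev e2 (reg s1) (mem s1) = ev e2 (reg s) (mem s)"
    using fits_cong[of "reg s1" "reg s" W e2 "mem s1"] ev_cong[of "reg s1" "reg s" W e2 "mem s1"] s1 Bin.prems by auto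
  from Bin.IH(2)[OF w1 a(1), of "Suc t"] Bin.prems(3) obtain s2 where
    s2: "exec W (compile e2 (Suc t)) s1 (cost e2) s2" "mem s2 = mem s1" "out s2 = out s1"
     "reg s2 (Suc t) = ev e2 (reg s1) (mem s1)" "\<forall>i<Suc t. reg s2 i = reg s1 i" by auto
  have "exec W (Op b t t (Suc t)) s2 1 (set_reg t (ev (Bin b e1 e2) (reg s) (mem s)) s2)"
    by (rule exec.Op) (use s1 s2 a Bin.prems in auto)
  with s1(1) s2(1) have "exec W (compile (Bin b e1 e2) t) s (cost e1 + (cost e2 + 1))
     (set_reg t (ev (Bin b e1 e2) (reg s) (mem s)) s2)"
    unfolding compile.simps by (intro exec.Seq)
  then show ?case using s1 s2
    by (intro exI[of _ "set_reg t (ev (Bin b e1 e2) (reg s) (mem s)) s2"]) (auto simp: set_reg_def)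
next
  case (Mem e)
  from Mem.IH[OF Mem.prems(1) _ Mem.prems(3)] Mem.prems(2) obtain s1 where
    s1: "exec W (compile e t) s (cost e) s1" "mem s1 = mem s" "out s1 = out s"
     "reg s1 t = ev e (reg s) (mem s)" "\<forall>i<t. reg s1 i = reg s i" by auto
  then have "exec W (compile (Mem e) t) s (cost e + 1) (set_reg t (mem s1 (reg s1 t)) s1)"
    unfolding compile.simps using exec.Load[of W t t s1] by (intro exec.Seq) auto
  then show ?case using s1
    by (intro exI[of _ "set_reg t (mem s1 (reg s1 t)) s1"]) (auto simp: set_reg_def)
qed

text \<open>Registers from 50 on are scratch space for expressions. An assertion sees the other registers,
  the memory, the output, and the time spent so far.\<close>

type_synonym assn = "(nat \<Rightarrow> nat) \<Rightarrow> (nat \<Rightarrow> nat) \<Rightarrow> nat list \<Rightarrow> nat \<Rightarrow> bool"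

definition vars :: "(nat \<Rightarrow> nat) \<Rightarrow> state \<Rightarrow> nat \<Rightarrow> nat" where
  "vars v s i = (if i < 50 then reg s i else v i)"

text \<open>Total correctness with a clock: a final state must be reached, k is the time already
  spent, and Q sees the exact total. From index 50 on, Q is given the old v, so no assertion depends
  on scratch contents.\<close>

definition wp :: "nat \<Rightarrow> com \<Rightarrow> assn \<Rightarrow> assn" where
  "wp W c Q v m o' k \<longleftrightarrow> (\<forall>s. words W s \<and> (\<forall>i<50. reg s i = v i) \<and> mem s = m \<and> out s = o' \<longrightarrow>
     (\<exists>t s'. exec W c s t s' \<and> Q (vars v s') (mem s') (out s') (k + t)))"

definition assign :: "nat \<Rightarrow> expr \<Rightarrow> com" (infix "::=" 60) where
  "x ::= e = Seq (compile e 50) (Seq (Const 51 0) (Op Add x 50 51))"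

definition store :: "expr \<Rightarrow> expr \<Rightarrow> com" where
  "store e1 e2 = Seq (compile e1 50) (Seq (compile e2 51) (Store 50 51))"

definition emit :: "expr \<Rightarrow> com" where
  "emit e = Seq (compile e 50) (Output 50)"

definition ifelse :: "expr \<Rightarrow> com \<Rightarrow> com \<Rightarrow> com" where
  "ifelse e c1 c2 = Seq (compile e 50) (If 50 c1 c2)"

definition while :: "expr \<Rightarrow> com \<Rightarrow> com" where
  "while e c = Seq (compile e 50) (While 50 (Seq c (compile e 50)))"

abbreviation semi :: "com \<Rightarrow> com \<Rightarrow> com" (infixr ";;" 55) where
  "c1 ;; c2 \<equiv> Seq c1 c2"

lemma vars_eqI: "(\<And>i. i < 50 \<Longrightarrow> reg s i = v' i) \<Longrightarrow> (\<And>i. i \<ge> 50 \<Longrightarrow> v i = v' i) \<Longrightarrow> vars v s = v'"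
  by (auto simp: vars_def fun_eq_iff)

lemma wp_conseq:
  assumes "wp W c Q v m o' k" "\<And>v m o' k. Q v m o' k \<Longrightarrow> Q' v m o' k"
  shows "wp W c Q' v m o' k"
  using assms unfolding wp_def by (metis (full_types))

text \<open>Makes the word invariant of memory cells available inside a derivation, for side
  conditions on arithmetic with cell contents.\<close>

lemma wp_words:
  assumes "(\<And>a. m a < W) \<Longrightarrow> wp W c Q v m o' k"
  shows "wp W c Q v m o' k"
  using assms unfolding wp_def words_def by blast

lemma wp_seq: "wp W c1 (wp W c2 Q) v m o' k \<Longrightarrow> wp W (Seq c1 c2) Q v m o' k"
  unfolding wp_def
proof (intro allI impI, goal_cases)
  case (1 s)
  then obtain t s' where 2: "exec W c1 s t s'" and 3: "\<forall>s1. words W s1 \<and> (\<forall>i<50. reg s1 i = vars v s' i) \<and>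
      mem s1 = mem s' \<and> out s1 = out s' \<longrightarrow>
      (\<exists>u s2. exec W c2 s1 u s2 \<and> Q (vars (vars v s') s2) (mem s2) (out s2) (k + t + u))" by blast
  have "words W s'" using exec_words 1 2 by blast
  then obtain u s2 where "exec W c2 s' u s2" "Q (vars (vars v s') s2) (mem s2) (out s2) (k + t + u)"
    using 3 by (auto simp: vars_def)
  moreover have "vars (vars v s') s2 = vars v s2" by (auto simp: vars_def)
  ultimately show ?case using exec.Seq[OF 2] by (metis add.assoc)
qed

lemma wp_skip: "Q v m o' (Suc k) \<Longrightarrow> wp W Skip Q v m o' k"
  unfolding wp_def
proof (intro allI impI, goal_cases)
  case (1 s)
  then have "vars v s = v" by (auto intro!: vars_eqI)
  then show ?case using exec.Skip[of W s] 1 by (metis Suc_eq_plus1)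
qed

lemma wp_assign:
  assumes "Q (v(x := ev e v m)) m o' (k + cost e + 2)" "fits W e v m" "x < 50"
  shows "wp W (x ::= e) Q v m o' k"
  unfolding wp_def
proof (intro allI impI, goal_cases)
  case (1 s)
  have f: "fits W e (reg s) (mem s)" "ev e (reg s) (mem s) = ev e v m"
    using 1 assms fits_cong[of "reg s" v W e m] ev_cong[of "reg s" v W e m] by auto
  obtain s1 where s1: "exec W (compile e 50) s (cost e) s1" "mem s1 = mem s" "out s1 = out s"
     "reg s1 50 = ev e v m" "\<forall>i<50. reg s1 i = reg s i"
    using compile_exec[of W s e 50] 1 f by auto
  have w1: "words W s1" using exec_words s1(1) 1 by blast
  let ?s' = "set_reg x (reg s1 50) (set_reg 51 0 s1)"
  have "exec W (Seq (Const 51 0) (Op Add x 50 51)) s1 (1+1) ?s'"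
  proof (rule exec.Seq)
    show "exec W (Const 51 0) s1 1 (set_reg 51 0 s1)"
      by (rule exec.Const) (use w1 in \<open>auto simp: words_def intro: le_less_trans\<close>)
    show "exec W (Op Add x 50 51) (set_reg 51 0 s1) 1 ?s'"
      by (rule exec.Op) (use w1 in \<open>auto simp: words_def set_reg_def\<close>)
  qed
  with s1(1) have "exec W (x ::= e) s (cost e + (1+1)) ?s'"
    unfolding assign_def by (rule exec.Seq)
  moreover have "vars v ?s' = v(x := ev e v m)" 
    using s1 1 assms by (intro vars_eqI) (auto simp: set_reg_def)
  moreover have "mem ?s' = m" "out ?s' = o'" using s1 1 by (auto simp: set_reg_def)
  ultimately show ?case using assms(1) by (metis add.assoc one_add_one)
qed

lemma wp_store:
  assumes "Q v (m(ev e1 v m := ev e2 v m)) o' (k + cost e1 + cost e2 + 1)" "fits W e1 v m" "fits W e2 v m"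
  shows "wp W (store e1 e2) Q v m o' k"
  unfolding wp_def
proof (intro allI impI, goal_cases)
  case (1 s)
  have f: "fits W e1 (reg s) (mem s)" "ev e1 (reg s) (mem s) = ev e1 v m"
    using 1 assms fits_cong[of "reg s" v W e1 m] ev_cong[of "reg s" v W e1 m] by auto
  obtain s1 where s1: "exec W (compile e1 50) s (cost e1) s1" "mem s1 = mem s" "out s1 = out s"
     "reg s1 50 = ev e1 v m" "\<forall>i<50. reg s1 i = reg s i"
    using compile_exec[of W s e1 50] 1 f by auto
  have w1: "words W s1" using exec_words s1(1) 1 by blast
  have f2: "fits W e2 (reg s1) (mem s1)" "ev e2 (reg s1) (mem s1) = ev e2 v m"
    using 1 s1 assms fits_cong[of "reg s1" v W e2 m] ev_cong[of "reg s1" v W e2 m] by auto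
  obtain s2 where s2: "exec W (compile e2 51) s1 (cost e2) s2" "mem s2 = mem s1" "out s2 = out s1"
     "reg s2 51 = ev e2 v m" "\<forall>i<51. reg s2 i = reg s1 i"
    using compile_exec[of W s1 e2 51] w1 f2 by auto
  let ?s' = "s2\<lparr>mem := (mem s2)(reg s2 50 := reg s2 51)\<rparr>"
  have "exec W (store e1 e2) s (cost e1 + (cost e2 + 1)) ?s'"
    unfolding store_def by (rule exec.Seq[OF s1(1) exec.Seq[OF s2(1) exec.Store]])
  moreover have "vars v ?s' = v" 
    using s1 s2 1 by (intro vars_eqI) auto
  moreover have "mem ?s' = m(ev e1 v m := ev e2 v m)" "out ?s' = o'" using s1 s2 1 by auto
  ultimately show ?case using assms(1) by (metis add.assoc)
qed

lemma wp_emit: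
  assumes "Q v m (o' @ [ev e v m]) (k + cost e + 1)" "fits W e v m"
  shows "wp W (emit e) Q v m o' k"
  unfolding wp_def
proof (intro allI impI, goal_cases)
  case (1 s)
  have f: "fits W e (reg s) (mem s)" "ev e (reg s) (mem s) = ev e v m"
    using 1 assms fits_cong[of "reg s" v W e m] ev_cong[of "reg s" v W e m] by auto
  obtain s1 where s1: "exec W (compile e 50) s (cost e) s1" "mem s1 = mem s" "out s1 = out s"
     "reg s1 50 = ev e v m" "\<forall>i<50. reg s1 i = reg s i"
    using compile_exec[of W s e 50] 1 f by auto
  let ?s' = "s1\<lparr>out := out s1 @ [reg s1 50]\<rparr>"
  have "exec W (emit e) s (cost e + 1) ?s'"
    unfolding emit_def by (rule exec.Seq[OF s1(1) exec.Output])
  moreover have "vars v ?s' = v" 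
    using s1 1 by (intro vars_eqI) auto
  moreover have "mem ?s' = m" "out ?s' = o' @ [ev e v m]" using s1 1 by auto
  ultimately show ?case using assms(1) by (metis add.assoc)
qed

lemma wp_ifelse:
  assumes "ev e v m \<noteq> 0 \<Longrightarrow> wp W c1 Q v m o' (k + cost e + 1)"
    "ev e v m = 0 \<Longrightarrow> wp W c2 Q v m o' (k + cost e + 1)"
    "fits W e v m"
  shows "wp W (ifelse e c1 c2) Q v m o' k"
  unfolding wp_def
proof (intro allI impI, goal_cases)
  case (1 s)
  have f: "fits W e (reg s) (mem s)" "ev e (reg s) (mem s) = ev e v m"
    using 1 assms fits_cong[of "reg s" v W e m] ev_cong[of "reg s" v W e m] by auto
  obtain s1 where s1: "exec W (compile e 50) s (cost e) s1" "mem s1 = mem s" "out s1 = out s"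
     "reg s1 50 = ev e v m" "\<forall>i<50. reg s1 i = reg s i"
    using compile_exec[of W s e 50] 1 f by auto
  have w1: "words W s1" using exec_words s1(1) 1 by blast
  have "\<exists>t s'. exec W (If 50 c1 c2) s1 (1 + t) s' \<and> Q (vars v s') (mem s') (out s') (k + cost e + 1 + t)"
  proof (cases "ev e v m = 0")
    case True
    from assms(2)[OF this] obtain t s' where "exec W c2 s1 t s'" 
      "Q (vars v s') (mem s') (out s') (k + cost e + 1 + t)" 
      unfolding wp_def using w1 s1 1 by metis
    then show ?thesis using True s1 by (metis exec.IfFalse)
  next
    case False
    from assms(1)[OF this] obtain t s' where "exec W c1 s1 t s'" 
      "Q (vars v s') (mem s') (out s') (k + cost e + 1 + t)" 
      unfolding wp_def using w1 s1 1 by metis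
    then show ?thesis using False s1 by (metis exec.IfTrue)
  qed
  then show ?case unfolding ifelse_def using exec.Seq[OF s1(1)] by (metis add.assoc)
qed

text \<open>The first argument of the invariant is a variant.\<close>

lemma wp_while:
  fixes J :: "nat \<Rightarrow> assn"
  assumes "J j v m o' k"
    and fits: "\<And>j v m o' k. J j v m o' k \<Longrightarrow> fits W e v m"
    and step: "\<And>j v m o' k. J j v m o' k \<Longrightarrow> ev e v m \<noteq> 0 \<Longrightarrow> 
      wp W c (\<lambda>v' m' o' k'. \<exists>j'<j. J j' v' m' o' k') v m o' (k + cost e + 1)"
    and fin: "\<And>j v m o' k. J j v m o' k \<Longrightarrow> ev e v m = 0 \<Longrightarrow> Q v m o' (k + cost e + 1)"
  shows "wp W (while e c) Q v m o' k"
  unfolding wp_def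
proof (intro allI impI, goal_cases)
  case (1 s)
  \<comment> \<open>The test is evaluated before the machine loop and again at the end of its body,
    so the induction runs over states in which register 50 already holds its value.\<close>
  have main: "\<exists>t s'. exec W (While 50 (Seq c (compile e 50))) s1 t s' \<and> 
     Q (vars v s') (mem s') (out s') (k + cost e + t)"
    if "J j v m o' k" "words W s1" "\<forall>i<50. reg s1 i = v i" "mem s1 = m" "out s1 = o'" "reg s1 50 = ev e v m"
    for j v m o' k s1
    using that
  proof (induction j arbitrary: v m o' k s1 rule: less_induct)
    case (less j)
    show ?case
    proof (cases "ev e v m = 0")
      case True
      have "vars v s1 = v" using less by (intro vars_eqI) auto
      then show ?thesis using fin[OF less.prems(1) True] exec.WhileFalse[of s1 50 W] less.prems True by metis
    next
      case False
      from step[OF less.prems(1) this] obtain t s2 j' where 2: "exec W c s1 t s2" 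
        "j' < j" "J j' (vars v s2) (mem s2) (out s2) (k + cost e + 1 + t)"
        unfolding wp_def using less.prems by metis
      have w2: "words W s2" using exec_words 2 less.prems by blast
      have f0: "fits W e (vars v s2) (mem s2)" using fits 2 by blast
      then have f: "fits W e (reg s2) (mem s2)" "ev e (reg s2) (mem s2) = ev e (vars v s2) (mem s2)"
        using fits_cong[of "reg s2" "vars v s2" W e] ev_cong[of "reg s2" "vars v s2" W e]
        by (auto simp: vars_def)
      obtain s3 where s3: "exec W (compile e 50) s2 (cost e) s3" "mem s3 = mem s2" "out s3 = out s2"
         "reg s3 50 = ev e (vars v s2) (mem s2)" "\<forall>i<50. reg s3 i = reg s2 i"
        using compile_exec[of W s2 e 50] w2 f by auto
      have w3: "words W s3" using exec_words s3 w2 by blast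
      obtain u s' where 4: "exec W (While 50 (Seq c (compile e 50))) s3 u s'"
        "Q (vars (vars v s2) s') (mem s') (out s') (k + cost e + 1 + t + cost e + u)" 
        using less.IH[OF 2(2,3) w3 _ s3(2,3,4)] s3(5) unfolding vars_def[of v s2] by auto
      have "vars (vars v s2) s' = vars v s'" by (auto simp: vars_def)
      moreover have "exec W (While 50 (Seq c (compile e 50))) s1 (1 + (t + cost e) + u) s'"
        by (rule exec.WhileTrue[OF _ exec.Seq[OF 2(1) s3(1)] 4(1)]) (use False less.prems in auto)
      ultimately show ?thesis using 4(2) by (fastforce simp: add.assoc)
    qed
  qed
  have f0: "fits W e v m" using fits assms by blast
  then have f: "fits W e (reg s) (mem s)" "ev e (reg s) (mem s) = ev e v m"
    using 1 assms fits_cong[of "reg s" v W e m] ev_cong[of "reg s" v W e m] by auto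
  obtain s1 where s1: "exec W (compile e 50) s (cost e) s1" "mem s1 = mem s" "out s1 = out s"
     "reg s1 50 = ev e v m" "\<forall>i<50. reg s1 i = reg s i"
    using compile_exec[of W s e 50] 1 f by auto
  have w1: "words W s1" using exec_words s1(1) 1 by blast
  from main[OF assms(1) w1] s1 1 obtain t s' where "exec W (While 50 (Seq c (compile e 50))) s1 t s'"
     "Q (vars v s') (mem s') (out s') (k + cost e + t)" by auto
  then show ?case unfolding while_def using exec.Seq[OF s1(1)] by (metis add.assoc)
qed

definition loop :: "nat \<Rightarrow> nat \<Rightarrow> com \<Rightarrow> com" where
  "loop i x c = i ::= Lit 0 ;; while (Bin Sub (Reg x) (Reg i)) (c ;; i ::= Bin Add (Reg i) (Lit 1))"

text \<open>The test and the increment cost 6 units each; the other 3 units initialise the counter.\<close>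

lemma wp_loop:
  assumes "i < 50" "x < 50" "x \<noteq> i" "v x < W" "0 < W"
    and "J 0 (v(i := 0)) m o' k"
    and step: "\<And>j v' m' o' k'. j < v x \<Longrightarrow> J j v' m' o' k' \<Longrightarrow> v' i = j \<Longrightarrow> v' x = v x \<Longrightarrow>
      wp W c (\<lambda>v' m' o' k'. v' i = j \<and> v' x = v x \<and> J (Suc j) (v'(i := Suc j)) m' o' (k' + 12)) v' m' o' k'"
    and shift: "\<And>j v m o' k k'. J j v m o' k \<Longrightarrow> k' \<le> k \<Longrightarrow> J j v m o' k'"
    and fin: "\<And>v' m' o' k'. J (v x) v' m' o' k' \<Longrightarrow> v' i = v x \<Longrightarrow> v' x = v x \<Longrightarrow> Q v' m' o' (k' + 9)"
  shows "wp W (loop i x c) Q v m o' k"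
proof -
  let ?e = "Bin Sub (Reg x) (Reg i)"
  \<comment> \<open>Subtracting 3 discounts the initialisation of the counter, so that J at 0 speaks
    of the time at which the whole loop was entered.\<close>
  define L where "L = (\<lambda>jj v' m' o' k'. \<exists>j. jj = v x - j \<and> j \<le> v x \<and> k' \<ge> 3 \<and> J j v' m' o' (k' - 3) \<and> v' i = j \<and> v' x = v x)"
  have "wp W (while ?e (c ;; i ::= Bin Add (Reg i) (Lit 1))) Q (v(i:=0)) m o' (k + 3)"
  proof (rule wp_while[where J = L and j = "v x"])
    show "L (v x) (v(i := 0)) m o' (k + 3)" unfolding L_def using assms by auto
  next
    fix j v' m' o' k' assume "L j v' m' o' k'"
    then show "fits W ?e v' m'" using assms by (auto simp: L_def)
  next
    fix jj v' m' o' k' assume L: "L jj v' m' o' k'" "ev ?e v' m' \<noteq> 0"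
    then obtain j where j: "jj = v x - j" "j < v x" "J j v' m' o' (k' - 3)" "k' \<ge> 3" "v' i = j" "v' x = v x" 
      by (auto simp: L_def)
    define k2 where "k2 = k' - 3"
    have s: "wp W c (\<lambda>v' m' o' k'. v' i = j \<and> v' x = v x \<and> J (Suc j) (v'(i := Suc j)) m' o' (k' + 12)) v' m' o' k2"
      using step j by (auto simp: k2_def)
    \<comment> \<open>A shift of the starting time carries over to the end. The 9 units are the 3 of
      the initialisation and the 6 of the current test.\<close>
    have "wp W c (\<lambda>v' m' o' k'. v' i = j \<and> v' x = v x \<and> J (Suc j) (v'(i := Suc j)) m' o' (k' - 9 + 12) \<and> k' \<ge> 9) v' m' o' (k2 + 9)"
      using s unfolding wp_def by (auto 4 5 simp: algebra_simps)
    then show "wp W (c ;; i ::= Bin Add (Reg i) (Lit 1)) (\<lambda>v' m' o' k'. \<exists>j'<jj. L j' v' m' o' k') v' m' o' (k' + cost ?e + 1)"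
      using j(4) apply (intro wp_seq)
      apply (simp add: k2_def)
      apply (erule wp_conseq)
      apply (rule wp_assign)
      subgoal for v2 m2 o2 k2 using j assms shift by (auto simp: L_def intro!: exI[of _ "v x - Suc j"] exI[of _ "Suc j"])
      subgoal using j assms by auto
      subgoal using assms by auto
      done
  next
    fix jj v' m' o' k' assume L: "L jj v' m' o' k'" "ev ?e v' m' = 0"
    then have "k' \<ge> 3" "J (v x) v' m' o' (k' - 3)" "v' i = v x" "v' x = v x" by (auto simp: L_def)
    from fin[OF this(2-4)] this(1) show "Q v' m' o' (k' + cost ?e + 1)" by (simp add: algebra_simps)
  qed
  then show ?thesis unfolding loop_def using assms
    by (intro wp_seq wp_assign) (auto simp: algebra_simps numeral_3_eq_3)
qed

section \<open>Programs for the greedy step\<close>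

abbreviation (input) rn :: nat where "rn \<equiv> 0"
abbreviation (input) rq :: nat where "rq \<equiv> 1"
abbreviation (input) rd :: nat where "rd \<equiv> 2"
abbreviation (input) rl :: nat where "rl \<equiv> 3"
abbreviation (input) rN :: nat where "rN \<equiv> 4"
abbreviation (input) rp :: nat where "rp \<equiv> 5"
abbreviation (input) rP :: nat where "rP \<equiv> 6"
abbreviation (input) rcnt :: nat where "rcnt \<equiv> 7"
abbreviation (input) rx :: nat where "rx \<equiv> 8"
abbreviation (input) rv :: nat where "rv \<equiv> 9"
abbreviation (input) rbest :: nat where "rbest \<equiv> 10"
abbreviation (input) rbv :: nat where "rbv \<equiv> 11"
abbreviation (input) ry :: nat where "ry \<equiv> 12"
abbreviation (input) rphi :: nat where "rphi \<equiv> 13"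
abbreviation (input) rw :: nat where "rw \<equiv> 14"
abbreviation (input) ri :: nat where "ri \<equiv> 15"
abbreviation (input) rpi :: nat where "rpi \<equiv> 16"
abbreviation (input) ra :: nat where "ra \<equiv> 17"
abbreviation (input) rc :: nat where "rc \<equiv> 18"
abbreviation (input) rk :: nat where "rk \<equiv> 19"
abbreviation (input) rpk :: nat where "rpk \<equiv> 20"
abbreviation (input) rb :: nat where "rb \<equiv> 21"
abbreviation (input) rt :: nat where "rt \<equiv> 22"
abbreviation (input) rz :: nat where "rz \<equiv> 23"

abbreviation digit_expr :: "nat \<Rightarrow> expr" where
  "digit_expr r \<equiv> Bin Mod (Bin Div (Reg ry) (Reg r)) (Reg rp)"

text \<open>Since subtraction is truncated, the two differences add up to 0 exactly for equal
  values.\<close>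

abbreviation distinct_expr :: "expr \<Rightarrow> expr \<Rightarrow> expr" where
  "distinct_expr e1 e2 \<equiv> Bin Add (Bin Sub e1 e2) (Bin Sub e2 e1)"

definition collision_prog :: com where
  "collision_prog =
     rc ::= Reg rq ;; rpk ::= Lit 1 ;;
     loop rk ri
       (ifelse (distinct_expr (Mem (Reg ra)) (Mem (digit_expr rpk))) Skip (rc ::= Lit 0) ;;
        rpk ::= Bin Mul (Reg rpk) (Reg rp))"

definition weight_prog :: com where
  "weight_prog =
     rw ::= Lit 1 ;; rpi ::= Lit 1 ;;
     loop ri rd
       (ra ::= digit_expr rpi ;;
        ifelse (Bin Sub (Reg rx) (Reg ra)) collision_prog (rc ::= Bin Sub (Reg rq) (Reg ri)) ;;
        rw ::= Bin Mul (Reg rw) (Reg rc) ;;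
        rpi ::= Bin Mul (Reg rpi) (Reg rp))"

definition same :: "nat set \<Rightarrow> (nat \<Rightarrow> nat) \<Rightarrow> (nat \<Rightarrow> nat) \<Rightarrow> bool" where
  "same R v v' \<longleftrightarrow> (\<forall>i. i \<notin> R \<longrightarrow> v' i = v i)"

lemma same_refl [simp]: "same R v v" by (simp add: same_def)

lemmas wp_intros = wp_seq wp_assign wp_store wp_emit wp_ifelse wp_skip

text \<open>The first bound says that a greedy step, with p q candidates and p^d codes at cost d^2
  for each, is up to a constant no dearer than printing one function. The second keeps potentials
  within words, the third sums of a few such numbers.\<close>

locale ram =
  fixes W n p q d :: nat
  assumes d2: "2 \<le> d" and dq: "d \<le> q" and p0: "0 < p"
    and budget: "p * q * (d * d) * p ^ d \<le> n" "p ^ d * q ^ d \<le> n" "3 * n < W"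
begin

lemma q0: "0 < q" using d2 dq by simp

lemma bounds: "p ^ d \<le> n" "q ^ d \<le> n" "p \<le> n" "q \<le> n" "d \<le> n" "d * d * p ^ d \<le> n"
    "p * q * (d * d * p ^ d) \<le> n" "0 < n"
proof -
  show 1: "p * q * (d * d * p ^ d) \<le> n" using budget(1) by (simp add: mult_ac)
  have "1 * (d * d * p ^ d) \<le> p * q * (d * d * p ^ d)" by (intro mult_le_mono1) (use p0 q0 in simp)
  from le_trans[OF this 1] show 2: "d * d * p ^ d \<le> n" by (simp only: mult_1)
  have "1 * p ^ d \<le> d * d * p ^ d" by (intro mult_le_mono1) (use d2 in simp)
  from le_trans[OF this 2] show 3: "p ^ d \<le> n" by (simp only: mult_1)
  have "p ^ 1 \<le> p ^ d" by (rule power_increasing) (use p0 d2 in auto)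
  with 3 show "p \<le> n" by simp
  with p0 show "0 < n" by simp
  have "1 * q ^ d \<le> p ^ d * q ^ d" by (intro mult_le_mono1) (use p0 in simp)
  from le_trans[OF this budget(2)] show 4: "q ^ d \<le> n" by (simp only: mult_1)
  have "q ^ 1 \<le> q ^ d" by (rule power_increasing) (use q0 d2 in auto)
  with 4 show "q \<le> n" by simp
  with dq show "d \<le> n" by simp
qed

lemma power_le_n: "j \<le> d \<Longrightarrow> p ^ j \<le> n" "j \<le> d \<Longrightarrow> q ^ j \<le> n"
proof -
  assume j: "j \<le> d"
  have "p ^ j \<le> p ^ d" by (rule power_increasing) (use p0 j in auto)
  with bounds show "p ^ j \<le> n" by simp
  have "q ^ j \<le> q ^ d" by (rule power_increasing) (use q0 j in auto)
  with bounds show "q ^ j \<le> n" by simp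
qed

lemma wp_collision:
  assumes v: "v rp = p" "v rq = q" "v ri = i" "i < d" "v ry < W"
    and post: "\<And>v' k'. same {rc, rk, rpk} v v' \<Longrightarrow>
      v' rc = (if \<exists>j<i. m (digit p (v ry) j) = m (v ra) then 0 else q) \<Longrightarrow>
      k' \<le> k + 50 * d + 50 \<Longrightarrow> Q v' m o' k'"
  shows "wp W collision_prog Q v m o' k"
  unfolding collision_prog_def
proof (rule wp_words, intro wp_intros)
  assume mW: "\<And>a. m a < W"
  define J where "J = (\<lambda>j v' m' o'' k'. same {rc, rk, rpk} v v' \<and> m' = m \<and> o'' = o' \<and>
    v' rpk = p ^ j \<and> v' rc = (if \<exists>i<j. m (digit p (v ry) i) = m (v ra) then 0 else q) \<and> k' \<le> k + 50 * j + 20)"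
  have "q < W" "1 < W" "0 < W" using bounds budget by auto
  let ?v = "v(rc := ev (Reg rq) v m)"
  show "wp W (loop rk ri
       (ifelse (distinct_expr (Mem (Reg ra)) (Mem (digit_expr rpk))) Skip (rc ::= Lit 0) ;;
        rpk ::= Bin Mul (Reg rpk) (Reg rp))) Q (?v(rpk := ev (Lit 1) ?v m)) m o'
       (k + cost (Reg rq) + 2 + cost (Lit 1) + 2)"
  proof (rule wp_loop[where J = J])
    show "J 0 ((?v(rpk := ev (Lit 1) ?v m))(rk := 0)) m o' (k + cost (Reg rq) + 2 + cost (Lit 1) + 2)"
      using v by (auto simp: J_def same_def)
  next
    fix j v1 m1 o1 k1
    assume "j < (?v(rpk := ev (Lit 1) ?v m)) ri" and J: "J j v1 m1 o1 k1" and "v1 rk = j"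
      "v1 ri = (?v(rpk := ev (Lit 1) ?v m)) ri"
    then have j: "j < i" "v1 rk = j" "v1 ri = i" using v by auto
    have e: "v1 rp = p" "v1 ry = v ry" "v1 ra = v ra" "m1 = m" "v1 rpk = p ^ j"
      using J v by (auto simp: J_def same_def)
    have "p ^ Suc j < W" using power_le_n[of "Suc j"] budget bounds v j by auto
    moreover have "v1 ry div v1 rpk mod v1 rp < W" using v e
      by (metis div_le_dividend le_less_trans mod_less_eq_dividend)
    moreover have "v1 ry div v1 rpk < W" using v e by (metis div_le_dividend le_less_trans)
    moreover have "m a - m b + (m b - m a) < W" "m a - m b < W" for a b
      using mW[of a] mW[of b] by auto
    ultimately show "wp W (ifelse (distinct_expr (Mem (Reg ra)) (Mem (digit_expr rpk))) Skip (rc ::= Lit 0) ;;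
        rpk ::= Bin Mul (Reg rpk) (Reg rp)) (\<lambda>v' m' o' k'. v' rk = j \<and>
          v' ri = (?v(rpk := ev (Lit 1) ?v m)) ri \<and> J (Suc j) (v'(rk := Suc j)) m' o' (k' + 12)) v1 m1 o1 k1"
      using J e j v mW \<open>0 < W\<close>
      by (intro wp_intros) (auto simp: J_def digit_def less_Suc_eq same_def mult.commute)
  next
    show "Q v' m' o' (k' + 9)" if "J ((?v(rpk := ev (Lit 1) ?v m)) ri) v' m' o' k'" for v' m' o' k'
      using that v by (auto simp: J_def intro!: post)
  qed (use v \<open>q < W\<close> bounds budget in \<open>auto simp: J_def\<close>)
qed (use v bounds budget in auto)

text \<open>Each of the d factors costs O(d), for its digit and the comparison with earlier ones; d
  >= 2 absorbs the lower terms into 120 d^2.\<close>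

lemma wp_weight:
  assumes v: "v rp = p" "v rq = q" "v rd = d" "v ry < W" "v rx < W"
    and post: "\<And>v' k'. same {rw, ri, rpi, ra, rc, rk, rpk} v v' \<Longrightarrow>
      v' rw = weight q d m (v rx) (digit p (v ry)) \<Longrightarrow>
      k' \<le> k + 120 * (d * d) \<Longrightarrow> Q v' m o' k'"
  shows "wp W weight_prog Q v m o' k"
  unfolding weight_prog_def
proof (intro wp_intros)
  let ?R = "{rw, ri, rpi, ra, rc, rk, rpk}"
  let ?a = "digit p (v ry)" and ?x = "v rx"
  define h where "h = (\<lambda>i. if ?a i < ?x then (if \<exists>k<i. m (?a k) = m (?a i) then 0 else q) else q - i)"
  \<comment> \<open>Partial products stay below q^i <= n or equal to it, so \<open>rw\<close> is a
    word throughout.\<close>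
  have h_le: "prod h {..<i} \<le> q ^ i" for i
    using prod_mono[of "{..<i}" h "\<lambda>_. q"] by (simp add: h_def)
  define J where "J = (\<lambda>j v' m' o'' k'. same ?R v v' \<and> m' = m \<and> o'' = o' \<and>
    v' rpi = p ^ j \<and> v' rw = prod h {..<j} \<and> k' \<le> k + (50 * d + 100) * j + 20)"
  have W: "q < W" "1 < W" "0 < W" "d < W" "p < W" using bounds budget by auto
  let ?v1 = "v(rw := ev (Lit 1) v m)"
  let ?v = "?v1(rpi := ev (Lit 1) ?v1 m)"
  show "wp W (loop ri rd
       (ra ::= digit_expr rpi ;;
        ifelse (Bin Sub (Reg rx) (Reg ra)) collision_prog (rc ::= Bin Sub (Reg rq) (Reg ri)) ;;
        rw ::= Bin Mul (Reg rw) (Reg rc) ;;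
        rpi ::= Bin Mul (Reg rpi) (Reg rp))) Q ?v m o'
       (k + cost (Lit 1) + 2 + cost (Lit 1) + 2)"
  proof (rule wp_loop[where J = J])
    show "J 0 (?v(ri := 0)) m o' (k + cost (Lit 1) + 2 + cost (Lit 1) + 2)"
      using v by (auto simp: J_def same_def)
  next
    fix j v1 m1 o1 k1
    assume "j < ?v rd" and J: "J j v1 m1 o1 k1" and "v1 ri = j" "v1 rd = ?v rd"
    then have j: "j < d" "v1 ri = j" "v1 rd = d" using v by auto
    have e: "v1 rp = p" "v1 rq = q" "v1 ry = v ry" "v1 rx = v rx" "m1 = m" "v1 rpi = p ^ j" "o1 = o'"
      and sm: "same ?R v v1" and w: "v1 rw = prod h {..<j}" and k1: "k1 \<le> k + (50 * d + 100) * j + 20"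
      using J v by (auto simp: J_def same_def)
    have "p ^ Suc j < W" "prod h {..<Suc j} < W"
      using power_le_n[of "Suc j"] h_le[of "Suc j"] budget bounds v j by auto
    then have f: "p ^ j * p < W" "prod h {..<j} * h j < W" by (simp_all add: mult.commute)
    have dg: "v ry div p ^ j mod p = digit p (v ry) j" by (simp add: digit_def)
    have dW: "digit p (v ry) j < W" using digit_less[OF p0] W by (metis less_trans)
    have xW: "v rx - digit p (v ry) j < W" using v by simp
    have vW: "v ry div p ^ j < W" using v by (metis div_le_dividend le_less_trans)
    have h1: "?a j < ?x \<Longrightarrow> h j = (if \<exists>k<j. m (?a k) = m (?a j) then 0 else q)"
      and h2: "\<not> ?a j < ?x \<Longrightarrow> h j = q - j" by (simp_all add: h_def)
    show "wp W (ra ::= digit_expr rpi ;;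
        ifelse (Bin Sub (Reg rx) (Reg ra)) collision_prog (rc ::= Bin Sub (Reg rq) (Reg ri)) ;;
        rw ::= Bin Mul (Reg rw) (Reg rc) ;;
        rpi ::= Bin Mul (Reg rpi) (Reg rp)) (\<lambda>v' m' o' k'. v' ri = j \<and>
          v' rd = ?v rd \<and> J (Suc j) (v'(ri := Suc j)) m' o' (k' + 12)) v1 m1 o1 k1"
      using e w k1 f j v W dW vW xW sm h1 h2
      by (intro wp_intros wp_collision[where i = j]) (simp_all add: dg J_def same_def)
  next
    show "Q v' m' o' (k' + 9)" if "J (?v rd) v' m' o' k'" for v' m' o' k'
    proof -
      have "(50 * d + 100) * d + 29 \<le> 120 * (d * d)" 
      proof -
        have "2 * d \<le> d * d" by (intro mult_le_mono1 d2)
        moreover have "2 * 2 \<le> d * d" by (intro mult_le_mono d2)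
        ultimately show ?thesis unfolding distrib_right by linarith
      qed
      then show ?thesis using that v by (auto simp: J_def h_def weight_def intro!: post)
    qed
  qed (use v W bounds budget in \<open>auto simp: J_def\<close>)
qed (use v bounds budget in auto)

end

text \<open>Memory layout: the value at \<open>a\<close> of the function under construction has address \<open>a < p\<close>, and the mark
  of the code \<open>y\<close> has address \<open>p + y\<close>.\<close>

definition flags :: "nat \<Rightarrow> nat \<Rightarrow> nat set \<Rightarrow> (nat \<Rightarrow> nat) \<Rightarrow> bool" where
  "flags p d T m \<longleftrightarrow> T \<subseteq> {..<p ^ d} \<and> (\<forall>y<p ^ d. m (p + y) = (if y \<in> T then 1 else 0))"

lemma flags_cong: "flags p d T m \<Longrightarrow> (\<And>a. a \<ge> p \<Longrightarrow> m' a = m a) \<Longrightarrow> flags p d T m'"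
  by (simp add: flags_def)

abbreviation flag_expr :: expr where
  "flag_expr \<equiv> Mem (Bin Add (Reg rp) (Reg ry))"

definition potential_prog :: com where
  "potential_prog =
     rphi ::= Lit 0 ;;
     loop ry rP
       (weight_prog ;;
        rphi ::= Bin Add (Reg rphi) (Bin Mul flag_expr (Reg rw)))"

text \<open>The value at \<open>rz\<close> counts as fixed during the trials, hence
  \<open>rx\<close> is one larger. Starting from 0 is safe: if every potential is 0, the value 0 is
  already a maximiser.\<close>

definition choose_prog :: com where
  "choose_prog =
     rx ::= Bin Add (Reg rz) (Lit 1) ;; rbest ::= Lit 0 ;; rbv ::= Lit 0 ;;
     loop rv rq
       (store (Reg rz) (Reg rv) ;;
        potential_prog ;;
        ifelse (Bin Sub (Reg rphi) (Reg rbest)) (rbest ::= Reg rphi ;; rbv ::= Reg rv) Skip) ;;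
     store (Reg rz) (Reg rbv)"

text \<open>With \<open>rx\<close> set to p all points count as fixed, so the weight is q^d or 0 and
  \<open>weight_prog\<close> doubles as an injectivity test.\<close>

definition mark_prog :: com where
  "mark_prog =
     rx ::= Reg rp ;;
     loop ry rP
       (ifelse flag_expr
         (weight_prog ;;
          ifelse (Reg rw)
            (store (Bin Add (Reg rp) (Reg ry)) (Lit 0) ;; rcnt ::= Bin Sub (Reg rcnt) (Lit 1))
            Skip)
         Skip)"

definition print_prog :: com where
  "print_prog = loop ri rn (emit (Mem (Bin Mod (Reg ri) (Reg rp))))"

definition round_prog :: com where
  "round_prog = loop rz rp choose_prog ;; mark_prog ;; print_prog"

context ram
begin

text \<open>The order of the cost of evaluating the potential once.\<close>

definition "D = d * d * p ^ d"

lemma D_ge: "4 \<le> D" "p ^ d \<le> D" "4 * p ^ d \<le> D"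
proof -
  have 4: "4 \<le> d * d" using mult_le_mono[OF d2 d2] by simp
  then show "4 * p ^ d \<le> D" unfolding D_def by (intro mult_le_mono1)
  moreover have "1 \<le> p ^ d" using p0 by simp
  ultimately show "4 \<le> D" "p ^ d \<le> D" by auto
qed

lemma D_distrib: "(120 * (d * d) + c) * p ^ d = 120 * D + c * p ^ d"
  by (simp add: D_def distrib_right)

lemma potential_le:
  assumes "T \<subseteq> {..<p ^ d}"
  shows "potential p q d T f x \<le> n"
proof -
  have "potential p q d T f x \<le> card T * q ^ d"
    unfolding potential_def using q0 weight_le sum_bounded_above[of T "\<lambda>y. weight q d f x (digit p y)" "q ^ d"] by auto
  also have "\<dots> \<le> card {..<p ^ d} * q ^ d" by (intro mult_le_mono1 card_mono assms) auto
  finally show ?thesis using budget by simp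
qed

lemma potential_insert:
  "potential p q d (T \<inter> {..<Suc j}) f x =
   potential p q d (T \<inter> {..<j}) f x + (if j \<in> T then weight q d f x (digit p j) else 0)"
proof (cases "j \<in> T")
  case True
  then have "T \<inter> {..<Suc j} = insert j (T \<inter> {..<j})" by (auto simp: less_Suc_eq)
  then show ?thesis using True by (simp add: potential_def)
next
  case False
  then have "T \<inter> {..<Suc j} = T \<inter> {..<j}" by (auto simp: less_Suc_eq)
  then show ?thesis using False by simp
qed

lemma wp_potential:
  assumes v: "v rp = p" "v rq = q" "v rd = d" "v rP = p ^ d" "v rx < W" and T: "flags p d T m"
    and post: "\<And>v' k'. same {rphi, ry, rw, ri, rpi, ra, rc, rk, rpk} v v' \<Longrightarrow>
      v' rphi = potential p q d T m (v rx) \<Longrightarrow>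
      k' \<le> k + 150 * D \<Longrightarrow> Q v' m o' k'"
  shows "wp W potential_prog Q v m o' k"
  unfolding potential_prog_def
proof (intro wp_intros)
  let ?R = "{rphi, ry, rw, ri, rpi, ra, rc, rk, rpk}"
  define J where "J = (\<lambda>j v' m' o'' k'. same ?R v v' \<and> m' = m \<and> o'' = o' \<and>
    v' rphi = potential p q d (T \<inter> {..<j}) m (v rx) \<and> k' \<le> k + (120 * (d * d) + 50) * j + 20)"
  have W: "q < W" "1 < W" "0 < W" "d < W" "p < W" "p ^ d < W" using bounds budget by auto
  let ?v = "v(rphi := ev (Lit 0) v m)"
  show "wp W (loop ry rP
       (weight_prog ;;
        rphi ::= Bin Add (Reg rphi) (Bin Mul flag_expr (Reg rw)))) Q ?v m o'
       (k + cost (Lit 0) + 2)"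
  proof (rule wp_loop[where J = J])
    show "J 0 (?v(ry := 0)) m o' (k + cost (Lit 0) + 2)"
      using v by (auto simp: J_def same_def potential_def)
  next
    fix j v1 m1 o1 k1
    assume "j < ?v rP" and J: "J j v1 m1 o1 k1" and "v1 ry = j" "v1 rP = ?v rP"
    then have j: "j < p ^ d" "v1 ry = j" "v1 rP = p ^ d" using v by auto
    have e: "v1 rp = p" "v1 rq = q" "v1 rd = d" "v1 rx = v rx" "m1 = m" "o1 = o'"
      and sm: "same ?R v v1" and phi: "v1 rphi = potential p q d (T \<inter> {..<j}) m (v rx)"
      and k1: "k1 \<le> k + (120 * (d * d) + 50) * j + 20"
      using J v by (auto simp: J_def same_def)
    have fl: "m (p + j) = (if j \<in> T then 1 else 0)" using T j by (simp add: flags_def)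
    have b: "p + j < W" "j < W" using j bounds budget by auto
    have w: "weight q d m (v rx) (digit p j) < W"
      using weight_le[OF q0, of d m "v rx" "digit p j"] bounds budget by simp
    have "T \<inter> {..<Suc j} \<subseteq> {..<p ^ d}" using T by (auto simp: flags_def)
    then have "potential p q d (T \<inter> {..<Suc j}) m (v rx) < W"
      using potential_le[of "T \<inter> {..<Suc j}" m "v rx"] budget bounds by simp
    then have s: "potential p q d (T \<inter> {..<j}) m (v rx) + (if j \<in> T then weight q d m (v rx) (digit p j) else 0) < W"
      by (simp add: potential_insert)
    show "wp W (weight_prog ;;
        rphi ::= Bin Add (Reg rphi) (Bin Mul flag_expr (Reg rw))) (\<lambda>v' m' o' k'. v' ry = j \<and>
          v' rP = ?v rP \<and> J (Suc j) (v'(ry := Suc j)) m' o' (k' + 12)) v1 m1 o1 k1"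
      using e phi k1 j v W sm fl b w s
      by (intro wp_intros wp_weight) (simp_all add: J_def same_def potential_insert split: if_splits)
  next
    show "Q v' m2 o2 (k' + 9)" if J: "J (?v rP) v' m2 o2 k'" for v' m2 o2 k'
    proof -
      have TP: "T \<inter> {..<p ^ d} = T" using T by (auto simp: flags_def)
      have k: "(120 * (d * d) + 50) * p ^ d + 29 \<le> 150 * D"
        unfolding D_distrib using D_ge by linarith
      have e: "m2 = m" "o2 = o'" using J by (simp_all add: J_def)
      show ?thesis unfolding e
        by (rule post) (use J v TP k in \<open>simp_all add: J_def\<close>)
    qed
  qed (use v W bounds budget in \<open>auto simp: J_def\<close>)
qed (use v bounds budget in auto)

lemma wp_choose:
  assumes v: "v rp = p" "v rq = q" "v rd = d" "v rP = p ^ d" "v rz = z" "z < p" and T: "flags p d T m"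
    and post: "\<And>v' b k'. same {rx, rv, rbest, rbv, rphi, ry, rw, ri, rpi, ra, rc, rk, rpk} v v' \<Longrightarrow>
      b < q \<Longrightarrow> (\<And>u. u < q \<Longrightarrow>
        potential p q d T (m(z := u)) (Suc z) \<le> potential p q d T (m(z := b)) (Suc z)) \<Longrightarrow>
      k' \<le> k + 200 * (q * D) \<Longrightarrow> Q v' (m(z := b)) o' k'"
  shows "wp W choose_prog Q v m o' k"
  unfolding choose_prog_def
proof (intro wp_intros)
  let ?R = "{rx, rv, rbest, rbv, rphi, ry, rw, ri, rpi, ra, rc, rk, rpk}"
  let ?pot = "\<lambda>u. potential p q d T (m(z := u)) (Suc z)"
  \<comment> \<open>The cell at z keeps the last candidate tried. Only an inequality links
    \<open>rbest\<close> to the potential of \<open>rbv\<close>, because the initial 0 need not be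
    the potential of the value 0.\<close>
  define J where "J = (\<lambda>j v' m' o'' k'. same ?R v v' \<and> o'' = o' \<and>
    m' = (if j = 0 then m else m(z := j - 1)) \<and> v' rx = Suc z \<and> v' rbv < q \<and>
    v' rbest \<le> ?pot (v' rbv) \<and> (\<forall>u<j. ?pot u \<le> v' rbest) \<and> v' rbest < W \<and>
    k' \<le> k + (150 * D + 80) * j + 30)"
  have W: "q < W" "1 < W" "0 < W" "d < W" "p < W" "p ^ d < W" "Suc z < W" using bounds budget v by auto
  let ?v1 = "v(rx := ev (Bin Add (Reg rz) (Lit 1)) v m)"
  let ?v2 = "?v1(rbest := ev (Lit 0) ?v1 m)"
  let ?v = "?v2(rbv := ev (Lit 0) ?v2 m)"
  have pW: "?pot u < W" for u using potential_le[of T "m(z := u)" "Suc z"] T budget bounds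
    by (auto simp: flags_def)
  show "wp W (loop rv rq
       (store (Reg rz) (Reg rv) ;;
        potential_prog ;;
        ifelse (Bin Sub (Reg rphi) (Reg rbest)) (rbest ::= Reg rphi ;; rbv ::= Reg rv) Skip))
       (wp W (store (Reg rz) (Reg rbv)) Q) ?v m o'
       (k + cost (Bin Add (Reg rz) (Lit 1)) + 2 + cost (Lit 0) + 2 + cost (Lit 0) + 2)"
  proof (rule wp_loop[where J = J])
    show "J 0 (?v(rv := 0)) m o' (k + cost (Bin Add (Reg rz) (Lit 1)) + 2 + cost (Lit 0) + 2 + cost (Lit 0) + 2)"
      using v q0 W by (auto simp: J_def same_def)
  next
    fix j v1 m1 o1 k1
    assume "j < ?v rq" and J: "J j v1 m1 o1 k1" and "v1 rv = j" "v1 rq = ?v rq"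
    then have j: "j < q" "v1 rv = j" "v1 rq = q" using v by auto
    have e: "v1 rp = p" "v1 rd = d" "v1 rP = p ^ d" "v1 rz = z" "v1 rx = Suc z" "o1 = o'"
      and m1: "m1(z := j) = m(z := j)"
      using J v by (auto simp: J_def same_def)
    have fl: "flags p d T (m(z := j))" using flags_cong[OF T] v by simp
    have le: "?pot u \<le> ?pot j" if "\<not> ?pot j \<le> v1 rbest" "u < j" for u
    proof -
      have "?pot u \<le> v1 rbest" using J that by (simp add: J_def)
      with that show ?thesis by linarith
    qed
    have diff: "x - y < W" if "x < W" for x y :: nat using that by simp
    show "wp W (store (Reg rz) (Reg rv) ;;
        potential_prog ;;
        ifelse (Bin Sub (Reg rphi) (Reg rbest)) (rbest ::= Reg rphi ;; rbv ::= Reg rv) Skip)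
       (\<lambda>v' m' o' k'. v' rv = j \<and>
          v' rq = ?v rq \<and> J (Suc j) (v'(rv := Suc j)) m' o' (k' + 12)) v1 m1 o1 k1"
      using e j v W fl m1 J pW le
      by (intro wp_intros wp_potential[where T = T]) (simp_all add: J_def same_def less_Suc_eq diff)
  next
    show "wp W (store (Reg rz) (Reg rbv)) Q v' m2 o2 (k' + 9)" if J: "J (?v rq) v' m2 o2 k'" for v' m2 o2 k'
    proof -
      have k: "(150 * D + 80) * q + 60 \<le> 200 * (q * D)"
      proof -
        have "4 * q \<le> q * D" using D_ge by (simp add: mult.commute)
        moreover have "2 \<le> q" using d2 dq by simp
        moreover have "(150 * D + 80) * q = 150 * (q * D) + 80 * q" by (simp add: algebra_simps)
        ultimately show ?thesis by linarith
      qed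
      have m2: "m2(z := v' rbv) = m(z := v' rbv)" "o2 = o'" "v' rz = z"
        using J v q0 by (auto simp: J_def same_def)
      have "Q v' (m(z := v' rbv)) o' (k' + 14)"
      proof (rule post)
        show "same ?R v v'" "v' rbv < q" "k' + 14 \<le> k + 200 * (q * D)"
          using J v k by (simp_all add: J_def)
        show "?pot u \<le> ?pot (v' rbv)" if "u < q" for u
        proof (rule order.trans)
          show "?pot u \<le> v' rbest" "v' rbest \<le> ?pot (v' rbv)" using J v that by (simp_all add: J_def)
        qed
      qed
      then show ?thesis using m2 by (intro wp_intros) (simp_all add: add.commute)
    qed
  qed (use v W bounds budget in \<open>auto simp: J_def\<close>)
qed (use v bounds budget in auto)

end

section \<open>The rounds for one modulus, from conditional expectations to a complete
  family\<close>

definition family_prog :: com where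
  "family_prog = while (Reg rcnt) round_prog"

definition printed :: "nat \<Rightarrow> nat \<Rightarrow> (nat \<Rightarrow> nat) list \<Rightarrow> nat list" where
  "printed n p fs = concat (map (\<lambda>f. map (\<lambda>i. f (i mod p)) [0..<n]) fs)"

definition "family_regs = {rcnt, rz, rx, rv, rbest, rbv, rphi, ry, rw, ri, rpi, ra, rc, rk, rpk}"

context ram
begin

lemma wp_fill:
  assumes v: "v rp = p" "v rq = q" "v rd = d" "v rP = p ^ d" and T: "flags p d T m"
    and mono: "\<And>y. y \<in> T \<Longrightarrow> strict_mono_on {..<d} (digit p y)"
    and post: "\<And>v' m' k'. same {rz, rx, rv, rbest, rbv, rphi, ry, rw, ri, rpi, ra, rc, rk, rpk} v v' \<Longrightarrow>
      flags p d T m' \<Longrightarrow> (\<And>a. a < p \<Longrightarrow> m' a < q) \<Longrightarrow>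
      potential p q d T m' 0 \<le> potential p q d T m' p \<Longrightarrow>
      k' \<le> k + 220 * (p * q * D) \<Longrightarrow> Q v' m' o' k'"
  shows "wp W (loop rz rp choose_prog) Q v m o' k"
proof -
  let ?R = "{rz, rx, rv, rbest, rbv, rphi, ry, rw, ri, rpi, ra, rc, rk, rpk}"
  define J where "J = (\<lambda>j v' m' o'' k'. same ?R v v' \<and> o'' = o' \<and> flags p d T m' \<and>
    (\<forall>a<j. m' a < q) \<and> potential p q d T m 0 \<le> potential p q d T m' j \<and>
    k' \<le> k + (200 * (q * D) + 20) * j + 10)"
  have W: "p < W" "0 < W" using bounds budget by auto
  show ?thesis
  proof (rule wp_loop[where J = J])
    fix j v1 m1 o1 k1
    assume "j < v rp" and "v1 rz = j" "v1 rp = v rp" and J: "J j v1 m1 o1 k1"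
    then have j: "j < p" "v1 rz = j" "v1 rp = p" using v by auto
    have e: "v1 rd = d" "v1 rq = q" "v1 rP = p ^ d" "o1 = o'" and fl1: "flags p d T m1"
      using J v by (auto simp: J_def same_def)
    have step: "potential p q d T m 0 \<le> potential p q d T (m1(j := b)) (Suc j)"
      if "\<And>u. u < q \<Longrightarrow> potential p q d T (m1(j := u)) (Suc j) \<le> potential p q d T (m1(j := b)) (Suc j)" for b
    proof (rule order.trans)
      show "potential p q d T m 0 \<le> potential p q d T m1 j" using J by (simp add: J_def)
      show "potential p q d T m1 j \<le> potential p q d T (m1(j := b)) (Suc j)"
        by (rule potential_step) (use that mono dq q0 J in \<open>auto simp: J_def\<close>)
    qed
    have fl: "flags p d T (m1(j := b))" for b using flags_cong[OF fl1] j by simp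
    show "wp W choose_prog (\<lambda>v' m' o' k'. v' rz = j \<and> v' rp = v rp \<and>
        J (Suc j) (v'(rz := Suc j)) m' o' (k' + 12)) v1 m1 o1 k1"
      using e j v J fl fl1 step
      by (intro wp_choose[where z = j and T = T]) (simp_all add: J_def same_def less_Suc_eq)
  next
    fix v' m2 o2 k' assume J: "J (v rp) v' m2 o2 k'"
    then have e: "o2 = o'" by (simp add: J_def)
    have "(200 * (q * D) + 20) * p + 19 \<le> 220 * (p * q * D)"
    proof -
      have "p * 4 \<le> p * (q * D)" using D_ge q0 mult_le_mono[of 1 q 4 D] by (intro mult_le_mono2) simp
      moreover have "(200 * (q * D) + 20) * p = 200 * (p * (q * D)) + 20 * p" by (simp add: algebra_simps)
      ultimately have "(200 * (q * D) + 20) * p + 19 \<le> 220 * (p * (q * D))" using p0 by linarith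
      then show ?thesis by (simp add: mult.assoc)
    qed
    \<comment> \<open>At 0 no point is fixed, so the potential does not depend on the function and
      the memory may be exchanged.\<close>
    moreover have "potential p q d T m2 0 = potential p q d T m 0"
      by (simp add: potential_def weight_start)
    ultimately show "Q v' m2 o2 (k' + 9)" unfolding e
      by (intro post) (use J v in \<open>simp_all add: J_def\<close>)
  qed (use v W T in \<open>auto simp: J_def same_def potential_def weight_start\<close>)
qed

lemma wp_mark:
  assumes v: "v rp = p" "v rq = q" "v rd = d" "v rP = p ^ d" "v rcnt = card T" and T: "flags p d T m"
    and post: "\<And>v' m' k'. same {rx, rcnt, ry, rw, ri, rpi, ra, rc, rk, rpk} v v' \<Longrightarrow>
      flags p d (T - {y\<in>T. inj_on (m \<circ> digit p y) {..<d}}) m' \<Longrightarrow>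
      (\<And>a. a < p \<Longrightarrow> m' a = m a) \<Longrightarrow>
      v' rcnt = card (T - {y\<in>T. inj_on (m \<circ> digit p y) {..<d}}) \<Longrightarrow>
      k' \<le> k + 160 * D \<Longrightarrow> Q v' m' o' k'"
  shows "wp W mark_prog Q v m o' k"
  unfolding mark_prog_def
proof (intro wp_intros)
  let ?R = "{rx, rcnt, ry, rw, ri, rpi, ra, rc, rk, rpk}"
  define U where "U = (\<lambda>j. T - {y\<in>T. y < j \<and> inj_on (m \<circ> digit p y) {..<d}})"
  define J where "J = (\<lambda>j v' m' o'' k'. same ?R v v' \<and> o'' = o' \<and> v' rx = p \<and>
    flags p d (U j) m' \<and> (\<forall>a<p. m' a = m a) \<and> v' rcnt = card (U j) \<and>
    k' \<le> k + (120 * (d * d) + 80) * j + 20)"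
  have W: "q < W" "1 < W" "0 < W" "d < W" "p < W" "p ^ d < W" using bounds budget by auto
  have fin: "finite (U j)" for j using T by (auto simp: U_def flags_def intro: finite_subset)
  let ?v = "v(rx := ev (Reg rp) v m)"
  show "wp W (loop ry rP
       (ifelse flag_expr
         (weight_prog ;;
          ifelse (Reg rw)
            (store (Bin Add (Reg rp) (Reg ry)) (Lit 0) ;; rcnt ::= Bin Sub (Reg rcnt) (Lit 1))
            Skip)
         Skip)) Q ?v m o' (k + cost (Reg rp) + 2)"
  proof (rule wp_loop[where J = J])
    have "U 0 = T" by (auto simp: U_def)
    then show "J 0 (?v(ry := 0)) m o' (k + cost (Reg rp) + 2)"
      using v T by (auto simp: J_def same_def)
  next
    fix j v1 m1 o1 k1
    assume "j < ?v rP" and J: "J j v1 m1 o1 k1" and "v1 ry = j" "v1 rP = ?v rP"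
    then have j: "j < p ^ d" "v1 ry = j" "v1 rP = p ^ d" using v by auto
    have e: "v1 rp = p" "v1 rq = q" "v1 rd = d" "v1 rx = p" "o1 = o'" "v1 rcnt = card (U j)"
      and sm: "same ?R v v1" and k1: "k1 \<le> k + (120 * (d * d) + 80) * j + 20"
      and m1: "\<And>a. a < p \<Longrightarrow> m1 a = m a" and flJ: "flags p d (U j) m1"
      using J v by (auto simp: J_def same_def)
    have b: "p + j < W" "j < W" using j bounds budget by auto
    have fl: "m1 (p + j) = (if j \<in> T then 1 else 0)"
      using flJ j by (auto simp: flags_def U_def)
    \<comment> \<open>Marks lie at addresses from p on, so clearing them leaves the values of the
      function intact.\<close>
    have "m1 \<circ> digit p j = m \<circ> digit p j" using m1 digit_less[OF p0] by auto
    then have w: "weight q d m1 p (digit p j) = (if inj_on (m \<circ> digit p j) {..<d} then q ^ d else 0)"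
      using weight_end[of d "digit p j" p q m1] digit_less[OF p0] q0 by simp
    have cW: "card (U j) < W"
    proof -
      have "card (U j) \<le> card {..<p ^ d}" using flJ by (intro card_mono) (auto simp: flags_def)
      then show ?thesis using W by simp
    qed
    have U1: "U (Suc j) = U j" if "j \<notin> T \<or> \<not> inj_on (m \<circ> digit p j) {..<d}"
      using that by (auto simp: U_def less_Suc_eq)
    have U2: "U (Suc j) = U j - {j}" "j \<in> U j" if "j \<in> T" "inj_on (m \<circ> digit p j) {..<d}"
      using that by (auto simp: U_def less_Suc_eq)
    have c2: "card (U j) - Suc 0 = card (U (Suc j))" if "j \<in> T" "inj_on (m \<circ> digit p j) {..<d}"
      using U2[OF that] fin[of j] by simp
    have f2: "flags p d (U (Suc j)) (m1(p + j := 0))" if "j \<in> T" "inj_on (m \<circ> digit p j) {..<d}"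
      using flJ U2[OF that] by (auto simp: flags_def)
    show "wp W (ifelse flag_expr
         (weight_prog ;;
          ifelse (Reg rw)
            (store (Bin Add (Reg rp) (Reg ry)) (Lit 0) ;; rcnt ::= Bin Sub (Reg rcnt) (Lit 1))
            Skip)
         Skip) (\<lambda>v' m' o' k'. v' ry = j \<and>
          v' rP = ?v rP \<and> J (Suc j) (v'(ry := Suc j)) m' o' (k' + 12)) v1 m1 o1 k1"
      using e k1 j v W sm fl b w flJ m1 cW U1 c2 f2 q0
      by (intro wp_intros wp_weight) (simp_all add: J_def same_def split: if_splits)
  next
    show "Q v' m2 o2 (k' + 9)" if J: "J (?v rP) v' m2 o2 k'" for v' m2 o2 k'
    proof -
      have UP: "U (p ^ d) = T - {y\<in>T. inj_on (m \<circ> digit p y) {..<d}}"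
        using T by (auto simp: flags_def U_def)
      have k: "(120 * (d * d) + 80) * p ^ d + 29 \<le> 160 * D"
        unfolding D_distrib using D_ge by linarith
      have e: "o2 = o'" using J by (simp add: J_def)
      show ?thesis unfolding e
        by (rule post) (use J v UP k in \<open>simp_all add: J_def\<close>)
    qed
  qed (use v W bounds budget in \<open>auto simp: J_def\<close>)
qed (use v bounds budget in auto)

lemma wp_print:
  assumes v: "v rn = n" "v rp = p"
    and post: "\<And>v' k'. same {ri} v v' \<Longrightarrow> k' \<le> k + 30 * n + 20 \<Longrightarrow>
      Q v' m (o' @ map (\<lambda>i. m (i mod p)) [0..<n]) k'"
  shows "wp W print_prog Q v m o' k"
  unfolding print_prog_def
proof -
  define J where "J = (\<lambda>j v' m' o'' k'. same {ri} v v' \<and> m' = m \<and>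
    o'' = o' @ map (\<lambda>i. m (i mod p)) [0..<j] \<and> k' \<le> k + 30 * j + 10)"
  have W: "n < W" "0 < W" using bounds budget by auto
  show "wp W (loop ri rn (emit (Mem (Bin Mod (Reg ri) (Reg rp))))) Q v m o' k"
  proof (rule wp_loop[where J = J])
    fix j v1 m1 o1 k1
    assume *: "j < v rn" "v1 ri = j" "v1 rn = v rn" and J: "J j v1 m1 o1 k1"
    have "j < W" using * v W by simp
    have "j mod p < W" using \<open>j < W\<close> by (meson le_less_trans mod_less_eq_dividend)
    then show "wp W (emit (Mem (Bin Mod (Reg ri) (Reg rp))))
       (\<lambda>v' m' o' k'. v' ri = j \<and> v' rn = v rn \<and> J (Suc j) (v'(ri := Suc j)) m' o' (k' + 12)) v1 m1 o1 k1"
      using * J v \<open>j < W\<close> by (intro wp_intros) (simp_all add: J_def same_def)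
  next
    fix v' m2 o2 k' assume J: "J (v rn) v' m2 o2 k'"
    then have e: "m2 = m" "o2 = o' @ map (\<lambda>i. m (i mod p)) [0..<n]" using v by (simp_all add: J_def)
    show "Q v' m2 o2 (k' + 9)" unfolding e
      by (rule post) (use J v in \<open>simp_all add: J_def\<close>)
  qed (use v W in \<open>auto simp: J_def same_def\<close>)
qed

text \<open>Finding f, updating the marks and printing are all charged to the n printed values, by p
  q D <= n and D <= n.\<close>

lemma wp_round:
  assumes v: "v rn = n" "v rp = p" "v rq = q" "v rd = d" "v rP = p ^ d"
      "v rcnt = card (uncovered p d fs)"
    and T: "flags p d (uncovered p d fs) m"
    and G: "greedy p q d fs" "uncovered p d fs \<noteq> {}"
    and post: "\<And>v' m' f k'. same family_regs v v' \<Longrightarrow> greedy p q d (fs @ [f]) \<Longrightarrow>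
      flags p d (uncovered p d (fs @ [f])) m' \<Longrightarrow> v' rcnt = card (uncovered p d (fs @ [f])) \<Longrightarrow>
      k' \<le> k + 500 * n \<Longrightarrow> Q v' m' (o' @ map (\<lambda>i. f (i mod p)) [0..<n]) k'"
  shows "wp W round_prog Q v m o' k"
proof -
  let ?T = "uncovered p d fs"
  have mono: "strict_mono_on {..<d} (digit p y)" if "y \<in> ?T" for y using that by (simp add: uncovered_def)
  have cost: "220 * (p * q * D) + 160 * D + 30 * n + 20 \<le> 500 * n"
  proof -
    have "p * q * D \<le> n" "D \<le> n" "1 \<le> n" using bounds by (simp_all add: D_def)
    then show ?thesis by linarith
  qed
  show ?thesis
    unfolding round_prog_def
  proof (intro wp_seq wp_fill[where T = ?T] wp_mark[where T = ?T] wp_print)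
    fix v1 m1 k1 v2 m2 k2 v3 k3
    assume 1: "same {rz, rx, rv, rbest, rbv, rphi, ry, rw, ri, rpi, ra, rc, rk, rpk} v v1"
        "flags p d ?T m1" "\<And>a. a < p \<Longrightarrow> m1 a < q" "potential p q d ?T m1 0 \<le> potential p q d ?T m1 p"
        "k1 \<le> k + 220 * (p * q * D)"
      and 2: "same {rx, rcnt, ry, rw, ri, rpi, ra, rc, rk, rpk} v1 v2"
        "flags p d (?T - {y \<in> ?T. inj_on (m1 \<circ> digit p y) {..<d}}) m2" "\<And>a. a < p \<Longrightarrow> m2 a = m1 a"
        "v2 rcnt = card (?T - {y \<in> ?T. inj_on (m1 \<circ> digit p y) {..<d}})" "k2 \<le> k1 + 160 * D"
      and 3: "same {ri} v2 v3" "k3 \<le> k2 + 30 * n + 20"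
    \<comment> \<open>The memory itself is taken as the new function; \<open>greedy\<close>
      constrains its values below p only.\<close>
    have g: "greedy p q d (fs @ [m1])"
      using G 1 uncovered_shrinks[OF 1(4) dq q0 p0] by (intro greedy.snoc) auto
    have "map (\<lambda>i. m2 (i mod p)) [0..<n] = map (\<lambda>i. m1 (i mod p)) [0..<n]" using 2(3) p0 by simp
    moreover have "Q v3 m2 (o' @ map (\<lambda>i. m1 (i mod p)) [0..<n]) k3"
    proof (rule post)
      show "same family_regs v v3" using 1(1) 2(1) 3(1) unfolding same_def family_regs_def by simp
      show "v3 rcnt = card (uncovered p d (fs @ [m1]))"
        using 2(4) 3(1) by (simp add: uncovered_snoc same_def)
      show "k3 \<le> k + 500 * n" using 1(5) 2(5) 3(2) cost by linarith
    qed (use g 2 in \<open>simp_all add: uncovered_snoc\<close>)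
    ultimately show "Q v3 m2 (o' @ map (\<lambda>i. m2 (i mod p)) [0..<n]) k3" by (simp only:)
  qed (use v T mono in \<open>simp_all add: same_def\<close>)
qed

text \<open>\<open>rcnt\<close> holds the number of uncovered codes and serves as the variant: every
  round lowers it, as the new function separates a code that its predecessors miss.\<close>

lemma wp_family:
  assumes v: "v rn = n" "v rp = p" "v rq = q" "v rd = d" "v rP = p ^ d"
      "v rcnt = card (uncovered p d [])"
    and T: "flags p d (uncovered p d []) m"
    and post: "\<And>v' m' fs k'. same family_regs v v' \<Longrightarrow> greedy p q d fs \<Longrightarrow>
      uncovered p d fs = {} \<Longrightarrow>
      k' \<le> k + 510 * n * length fs + 5 \<Longrightarrow> Q v' m' (o' @ printed n p fs) k'"
  shows "wp W family_prog Q v m o' k"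
  unfolding family_prog_def
proof (rule wp_while[where j = "card (uncovered p d [])" and J = "\<lambda>j v' m' o'' k'.
    \<exists>fs. same family_regs v v' \<and> greedy p q d fs \<and> j = card (uncovered p d fs) \<and> v' rcnt = j \<and>
      flags p d (uncovered p d fs) m' \<and> k' \<le> k + 510 * n * length fs \<and> o'' = o' @ printed n p fs"])
  fix j v1 m1 o1 k1
  assume "\<exists>fs. same family_regs v v1 \<and> greedy p q d fs \<and> j = card (uncovered p d fs) \<and> v1 rcnt = j \<and>
      flags p d (uncovered p d fs) m1 \<and> k1 \<le> k + 510 * n * length fs \<and> o1 = o' @ printed n p fs"
    and *: "ev (Reg rcnt) v1 m1 \<noteq> 0"
  then obtain fs where fs: "same family_regs v v1" "greedy p q d fs" "j = card (uncovered p d fs)" "v1 rcnt = j"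
      "flags p d (uncovered p d fs) m1" "k1 \<le> k + 510 * n * length fs" "o1 = o' @ printed n p fs" by blast
  show "wp W round_prog (\<lambda>v' m' o'' k'. \<exists>j'<j. \<exists>fs. same family_regs v v' \<and> greedy p q d fs \<and>
      j' = card (uncovered p d fs) \<and> v' rcnt = j' \<and> flags p d (uncovered p d fs) m' \<and>
      k' \<le> k + 510 * n * length fs \<and> o'' = o' @ printed n p fs) v1 m1 o1 (k1 + cost (Reg rcnt) + 1)"
  proof (rule wp_round[where fs = fs])
    show ne: "uncovered p d fs \<noteq> {}" using * fs by auto
    fix v' m' f k'
    assume a: "same family_regs v1 v'" "greedy p q d (fs @ [f])" "flags p d (uncovered p d (fs @ [f])) m'"
      "v' rcnt = card (uncovered p d (fs @ [f]))" "k' \<le> k1 + cost (Reg rcnt) + 1 + 500 * n"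
    have "same family_regs v v'" using fs(1) a(1) by (simp add: same_def)
    moreover have "card (uncovered p d (fs @ [f])) < j"
    proof -
      obtain y where "y \<in> uncovered p d fs" "inj_on (f \<circ> digit p y) {..<d}"
        using greedy_new[OF a(2) dq, of "length fs"] by auto
      then show ?thesis unfolding fs(3) uncovered_snoc by (intro psubset_card_mono) auto
    qed
    moreover have "k' \<le> k + 510 * n * length (fs @ [f])"
      using a(5) fs(6) bounds(8) by (simp add: algebra_simps)
    moreover have "o1 @ map (\<lambda>i. f (i mod p)) [0..<n] = o' @ printed n p (fs @ [f])"
      using fs by (simp add: printed_def)
    ultimately show "\<exists>j'<j. \<exists>fs. same family_regs v v' \<and> greedy p q d fs \<and>
      j' = card (uncovered p d fs) \<and> v' rcnt = j' \<and> flags p d (uncovered p d fs) m' \<and>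
      k' \<le> k + 510 * n * length fs \<and> o1 @ map (\<lambda>i. f (i mod p)) [0..<n] = o' @ printed n p fs"
      using a by blast
  qed (use v fs in \<open>simp_all add: same_def family_regs_def\<close>)
next
  fix j v1 m1 o1 k1
  assume "\<exists>fs. same family_regs v v1 \<and> greedy p q d fs \<and> j = card (uncovered p d fs) \<and> v1 rcnt = j \<and>
      flags p d (uncovered p d fs) m1 \<and> k1 \<le> k + 510 * n * length fs \<and> o1 = o' @ printed n p fs"
    and *: "ev (Reg rcnt) v1 m1 = 0"
  then obtain fs where fs: "same family_regs v v1" "greedy p q d fs" "uncovered p d fs = {}"
      "k1 \<le> k + 510 * n * length fs" "o1 = o' @ printed n p fs" by auto
  show "Q v1 m1 o1 (k1 + cost (Reg rcnt) + 1)" unfolding fs(5)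
    by (rule post) (use fs in simp_all)
next
  show "\<exists>fs. same family_regs v v \<and> greedy p q d fs \<and> card (uncovered p d []) = card (uncovered p d fs) \<and>
      v rcnt = card (uncovered p d []) \<and> flags p d (uncovered p d fs) m \<and> k \<le> k + 510 * n * length fs \<and>
      o' = o' @ printed n p fs"
    using v T by (intro exI[of _ "[]"]) (simp add: printed_def greedy.Nil)
qed simp


end

section \<open>The search through the primes\<close>

definition increasing_prog :: com where
  "increasing_prog =
     rb ::= Lit 1 ;; rpi ::= Lit 1 ;;
     loop ri rt
       (rpk ::= Bin Mul (Reg rpi) (Reg rp) ;;
        ifelse (Bin Sub (digit_expr rpk) (digit_expr rpi)) Skip (rb ::= Lit 0) ;;
        rpi ::= Reg rpk)"

text \<open>A mark is written for every code, whether 1 or 0, so remnants of an earlier modulus in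
  memory do no harm.\<close>

definition init_prog :: com where
  "init_prog =
     rP ::= Lit 1 ;; loop ri rd (rP ::= Bin Mul (Reg rP) (Reg rp)) ;;
     rcnt ::= Lit 0 ;;
     loop ry rP
       (increasing_prog ;;
        store (Bin Add (Reg rp) (Reg ry)) (Reg rb) ;;
        rcnt ::= Bin Add (Reg rcnt) (Reg rb))"

text \<open>Reduces the recognition of codes of d-sets to d - 1 comparisons of neighbouring
  digits.\<close>

lemma strict_mono_on_lessThan_iff:
  "strict_mono_on {..<d} a \<longleftrightarrow> (\<forall>i<d - 1. a i < a (Suc i))" for a :: "nat \<Rightarrow> nat"
proof
  assume R: "\<forall>i<d - 1. a i < a (Suc i)"
  have "a i < a j" if "i < j" "j < d" for i j
    using that
  proof (induction j)
    case (Suc j)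
    then have "a j < a (Suc j)" using R by simp
    then show ?case using Suc by (cases "i = j") auto
  qed simp
  then show "strict_mono_on {..<d} a" by (simp add: strict_mono_on_def)
next
  assume L: "strict_mono_on {..<d} a"
  show "\<forall>i<d - 1. a i < a (Suc i)"
  proof (intro allI impI)
    fix i assume "i < d - 1"
    then show "a i < a (Suc i)" by (intro strict_mono_onD[OF L]) auto
  qed
qed

context ram
begin

lemma wp_increasing:
  assumes v: "v rp = p" "v rt = d - 1" "v ry < W"
    and post: "\<And>v' k'. same {rb, rpi, ri, rpk} v v' \<Longrightarrow>
      v' rb = (if strict_mono_on {..<d} (digit p (v ry)) then 1 else 0) \<Longrightarrow>
      k' \<le> k + 50 * d + 40 \<Longrightarrow> Q v' m o' k'"
  shows "wp W increasing_prog Q v m o' k"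
  unfolding increasing_prog_def
proof (intro wp_intros)
  let ?R = "{rb, rpi, ri, rpk}" and ?a = "digit p (v ry)"
  define J where "J = (\<lambda>j v' m' o'' k'. same ?R v v' \<and> m' = m \<and> o'' = o' \<and> v' rpi = p ^ j \<and>
    v' rb = (if \<forall>i<j. ?a i < ?a (Suc i) then 1 else 0) \<and> k' \<le> k + 50 * j + 20)"
  have W: "0 < W" "1 < W" "d < W" "p < W" using bounds budget by auto
  let ?v1 = "v(rb := ev (Lit 1) v m)"
  let ?v = "?v1(rpi := ev (Lit 1) ?v1 m)"
  show "wp W (loop ri rt
       (rpk ::= Bin Mul (Reg rpi) (Reg rp) ;;
        ifelse (Bin Sub (digit_expr rpk) (digit_expr rpi)) Skip (rb ::= Lit 0) ;;
        rpi ::= Reg rpk)) Q ?v m o' (k + cost (Lit 1) + 2 + cost (Lit 1) + 2)"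
  proof (rule wp_loop[where J = J])
    show "J 0 (?v(ri := 0)) m o' (k + cost (Lit 1) + 2 + cost (Lit 1) + 2)"
      using v by (auto simp: J_def same_def)
  next
    fix j v1 m1 o1 k1
    assume *: "j < ?v rt" "v1 ri = j" "v1 rt = ?v rt" and J: "J j v1 m1 o1 k1"
    have j: "j < d - 1" "v1 ri = j" "v1 rt = d - 1" using * v by auto
    have e: "v1 rp = p" "v1 ry = v ry" "m1 = m" "o1 = o'" "v1 rpi = p ^ j"
      using J v by (auto simp: J_def same_def)
    have "p ^ Suc j \<le> n" using j by (intro power_le_n) simp
    then have P: "p ^ j * p < W" "p ^ j * p = p ^ Suc j" using budget bounds by (simp_all add: mult.commute)
    have dg: "v ry div p ^ i mod p = ?a i" for i by (simp add: digit_def)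
    have aW: "?a i < W" for i using digit_less[OF p0, of "v ry" i] W by simp
    have a2: "?a i - ?a i' < W" for i i' using aW[of i] by simp
    have yW: "v ry div x < W" for x using v by (meson div_le_dividend le_less_trans)
    show "wp W (rpk ::= Bin Mul (Reg rpi) (Reg rp) ;;
        ifelse (Bin Sub (digit_expr rpk) (digit_expr rpi)) Skip (rb ::= Lit 0) ;;
        rpi ::= Reg rpk) (\<lambda>v' m' o' k'. v' ri = j \<and> v' rt = ?v rt \<and>
          J (Suc j) (v'(ri := Suc j)) m' o' (k' + 12)) v1 m1 o1 k1"
      using e J j v W P(1) aW a2 yW
      by (intro wp_intros) (simp_all add: J_def same_def P(2) dg less_Suc_eq del: power_Suc, auto)
  next
    fix v' m2 o2 k' assume J: "J (?v rt) v' m2 o2 k'"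
    then have e: "m2 = m" "o2 = o'" by (simp_all add: J_def)
    have "50 * (d - 1) \<le> 50 * d" by simp
    moreover have "k' \<le> k + 50 * (d - 1) + 20" using J v by (simp add: J_def)
    ultimately have kb: "k' + 9 \<le> k + 50 * d + 40" by linarith
    show "Q v' m2 o2 (k' + 9)" unfolding e
      by (rule post) (use J v kb in \<open>simp_all add: J_def strict_mono_on_lessThan_iff\<close>)
  qed (use v W in \<open>auto simp: J_def\<close>)
qed (use bounds budget in auto)

lemma wp_init:
  assumes v: "v rp = p" "v rd = d" "v rt = d - 1"
    and post: "\<And>v' m' k'. same {rP, rcnt, ry, rb, ri, rpi, rpk} v v' \<Longrightarrow> v' rP = p ^ d \<Longrightarrow>
      v' rcnt = card (uncovered p d []) \<Longrightarrow> flags p d (uncovered p d []) m' \<Longrightarrow>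
      k' \<le> k + 300 * n \<Longrightarrow> Q v' m' o' k'"
  shows "wp W init_prog Q v m o' k"
  unfolding init_prog_def
proof (intro wp_intros)
  let ?R = "{rP, rcnt, ry, rb, ri, rpi, rpk}"
  let ?T = "uncovered p d []"
  let ?c2 = "rcnt ::= Lit 0 ;;
     loop ry rP
       (increasing_prog ;;
        store (Bin Add (Reg rp) (Reg ry)) (Reg rb) ;;
        rcnt ::= Bin Add (Reg rcnt) (Reg rb))"
  have W: "0 < W" "1 < W" "d < W" "p < W" "p ^ d < W" using bounds budget by auto
  define J where "J = (\<lambda>j v' (m' :: nat \<Rightarrow> nat) o'' k'. same ?R v v' \<and> o'' = o' \<and> v' rP = p ^ d \<and>
    (\<forall>y<j. m' (p + y) = (if y \<in> ?T then 1 else 0)) \<and> v' rcnt = card (?T \<inter> {..<j}) \<and>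
    k' \<le> k + 30 * d + 40 + (50 * d + 90) * j)"
  define I where "I = (\<lambda>j v' m' o'' k'. same {rP, ri} v v' \<and> m' = m \<and> o'' = o' \<and> v' rP = p ^ j \<and> k' \<le> k + 30 * j + 20)"
  have T: "j \<in> ?T \<longleftrightarrow> j < p ^ d \<and> strict_mono_on {..<d} (digit p j)" for j
    by (simp add: uncovered_def)
  have cost: "30 * d + 40 + (50 * d + 90) * p ^ d + 9 \<le> 300 * n"
  proof -
    have "d * p ^ d \<le> D" unfolding D_def by (intro mult_le_mono1) simp
    moreover have "(50 * d + 90) * p ^ d = 50 * (d * p ^ d) + 90 * p ^ d" by (simp add: algebra_simps)
    moreover have "D \<le> n" using bounds by (simp add: D_def)
    ultimately show ?thesis using D_ge bounds(5,8) by linarith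
  qed
  have second: "wp W ?c2 Q v1 m1 o1 k1" if I: "I d v1 m1 o1 (k1 - 9)" "9 \<le> k1" for v1 m1 o1 k1
  proof (intro wp_intros)
    have v1: "v1 rp = p" "v1 rd = d" "v1 rt = d - 1" "v1 rP = p ^ d" "o1 = o'" "k1 \<le> k + 30 * d + 30"
      "same ?R v v1"
      using I v by (auto simp: I_def same_def)
    let ?v = "v1(rcnt := ev (Lit 0) v1 m1)"
    show "wp W (loop ry rP
       (increasing_prog ;;
        store (Bin Add (Reg rp) (Reg ry)) (Reg rb) ;;
        rcnt ::= Bin Add (Reg rcnt) (Reg rb))) Q ?v m1 o1 (k1 + cost (Lit 0) + 2)"
    proof (rule wp_loop[where J = J])
      show "J 0 (?v(ry := 0)) m1 o1 (k1 + cost (Lit 0) + 2)"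
        using v1 by (auto simp: J_def same_def)
    next
      fix j v2 m2 o2 k2
      assume *: "j < ?v rP" "v2 ry = j" "v2 rP = ?v rP" and J: "J j v2 m2 o2 k2"
      have j: "j < p ^ d" "v2 ry = j" "v2 rP = p ^ d" using * v1 by auto
      have e: "v2 rp = p" "v2 rt = d - 1" using J v by (auto simp: J_def same_def)
      have jW: "j < W" "p + j < W" using j bounds budget by auto
      have c: "card (?T \<inter> {..<Suc j}) = card (?T \<inter> {..<j}) + (if j \<in> ?T then 1 else 0)"
      proof (cases "j \<in> ?T")
        case True
        then have "?T \<inter> {..<Suc j} = insert j (?T \<inter> {..<j})" by (auto simp: less_Suc_eq)
        then show ?thesis using True by simp
      next
        case False
        then have "?T \<inter> {..<Suc j} = ?T \<inter> {..<j}" by (auto simp: less_Suc_eq)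
        then show ?thesis using False by simp
      qed
      have "card (?T \<inter> {..<Suc j}) \<le> card {..<p ^ d}" by (intro card_mono) (auto simp: uncovered_def)
      then have cW: "card (?T \<inter> {..<j}) + (if j \<in> ?T then 1 else 0) < W" using c W by simp
      have t: "strict_mono_on {..<d} (digit p j) \<longleftrightarrow> j \<in> ?T" using T j by simp
      show "wp W (increasing_prog ;;
        store (Bin Add (Reg rp) (Reg ry)) (Reg rb) ;;
        rcnt ::= Bin Add (Reg rcnt) (Reg rb)) (\<lambda>v' m' o' k'. v' ry = j \<and> v' rP = ?v rP \<and>
          J (Suc j) (v'(ry := Suc j)) m' o' (k' + 12)) v2 m2 o2 k2"
        using e J j v v1 W jW cW
        by (intro wp_intros wp_increasing) (simp_all add: J_def same_def less_Suc_eq t c split: if_splits)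
    next
      fix v' m2 o2 k' assume J: "J (?v rP) v' m2 o2 k'"
      have TP: "?T \<inter> {..<p ^ d} = ?T" by (auto simp: uncovered_def)
      have e: "o2 = o'" using J by (simp add: J_def)
      have fl: "flags p d ?T m2" using J v1 by (auto simp: J_def flags_def uncovered_def)
      show "Q v' m2 o2 (k' + 9)" unfolding e
        by (rule post) (use J v1 cost fl TP in \<open>simp_all add: J_def\<close>)
    qed (use v1 W in \<open>auto simp: J_def\<close>)
  qed (use W in auto)
  let ?v = "v(rP := ev (Lit 1) v m)"
  show "wp W (loop ri rd (rP ::= Bin Mul (Reg rP) (Reg rp))) (wp W ?c2 Q) ?v m o' (k + cost (Lit 1) + 2)"
  proof (rule wp_loop[where J = I])
    show "I 0 (?v(ri := 0)) m o' (k + cost (Lit 1) + 2)" by (auto simp: I_def same_def)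
  next
    fix j v1 m1 o1 k1
    assume *: "j < ?v rd" "v1 ri = j" "v1 rd = ?v rd" and I: "I j v1 m1 o1 k1"
    have e: "v1 rp = p" "j < d" using I v * by (auto simp: I_def same_def)
    have "p ^ Suc j \<le> n" using e by (intro power_le_n) simp
    then have P: "p ^ j * p < W" "p ^ j * p = p ^ Suc j" using budget bounds by (simp_all add: mult.commute)
    show "wp W (rP ::= Bin Mul (Reg rP) (Reg rp)) (\<lambda>v' m' o' k'. v' ri = j \<and> v' rd = ?v rd \<and>
          I (Suc j) (v'(ri := Suc j)) m' o' (k' + 12)) v1 m1 o1 k1"
      using e I * v P(1) by (intro wp_intros) (simp_all add: I_def same_def mult.commute)
  next
    fix v' m2 o2 k' assume "I (?v rd) v' m2 o2 k'"
    then show "wp W ?c2 Q v' m2 o2 (k' + 9)" using v by (intro second) simp_all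
  qed (use v W in \<open>auto simp: I_def\<close>)
qed (use bounds budget in auto)

lemma wp_process:
  assumes v: "v rn = n" "v rp = p" "v rq = q" "v rd = d" "v rt = d - 1"
    and post: "\<And>v' m' fs k'. same (family_regs \<union> {rP, rb}) v v' \<Longrightarrow> greedy p q d fs \<Longrightarrow>
      uncovered p d fs = {} \<Longrightarrow> k' \<le> k + 510 * n * length fs + 310 * n \<Longrightarrow>
      Q v' m' (o' @ printed n p fs) k'"
  shows "wp W (init_prog ;; family_prog) Q v m o' k"
proof (intro wp_seq wp_init wp_family)
  fix v1 m1 k1 v2 m2 fs k2
  assume 1: "same {rP, rcnt, ry, rb, ri, rpi, rpk} v v1" "k1 \<le> k + 300 * n"
    and 2: "same family_regs v1 v2" "greedy p q d fs" "uncovered p d fs = {}" "k2 \<le> k1 + 510 * n * length fs + 5"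
  show "Q v2 m2 (o' @ printed n p fs) k2"
    by (rule post) (use 1 2 bounds(8) in \<open>simp_all add: same_def family_regs_def\<close>)
qed (use v in \<open>simp_all add: same_def\<close>)

end

section \<open>Trial division and the loop over candidate moduli\<close>

definition prime_prog :: com where
  "prime_prog =
     rb ::= Lit 1 ;;
     loop rk rp
       (ifelse (Bin Sub (Reg rk) (Lit 1))
         (ifelse (Bin Mod (Reg rp) (Reg rk)) Skip (rb ::= Lit 0))
         Skip)"

lemma prime_iff_no_divisor: "2 \<le> p \<Longrightarrow> prime p \<longleftrightarrow> (\<forall>i<p. 1 < i \<longrightarrow> \<not> i dvd p)" for p :: nat
  unfolding prime_nat_iff' by (auto simp: Suc_le_eq numeral_2_eq_2)

text \<open>Naive trial division is affordable: at most l^3 candidates are tested at cost O(l^3)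
  each, and l^6 <= n.\<close>

lemma wp_prime:
  assumes v: "v rp = p" "2 \<le> p" "p < W"
    and post: "\<And>v' k'. same {rb, rk} v v' \<Longrightarrow> v' rb = (if prime p then 1 else 0) \<Longrightarrow>
      k' \<le> k + 40 * p + 20 \<Longrightarrow> Q v' m o' k'"
  shows "wp W prime_prog Q v m o' k"
  unfolding prime_prog_def
proof (intro wp_intros)
  define J where "J = (\<lambda>j v' m' o'' k'. same {rb, rk} v v' \<and> m' = m \<and> o'' = o' \<and>
    v' rb = (if \<forall>i<j. 1 < i \<longrightarrow> \<not> i dvd p then 1 else 0) \<and> k' \<le> k + 40 * j + 10)"
  let ?v = "v(rb := ev (Lit 1) v m)"
  show "wp W (loop rk rp
       (ifelse (Bin Sub (Reg rk) (Lit 1))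
         (ifelse (Bin Mod (Reg rp) (Reg rk)) Skip (rb ::= Lit 0))
         Skip)) Q ?v m o' (k + cost (Lit 1) + 2)"
  proof (rule wp_loop[where J = J])
    show "J 0 (?v(rk := 0)) m o' (k + cost (Lit 1) + 2)" by (auto simp: J_def same_def)
  next
    fix j v1 m1 o1 k1
    assume *: "j < ?v rp" "v1 rk = j" "v1 rp = ?v rp" and J: "J j v1 m1 o1 k1"
    have e: "v1 rp = p" "j < p" using v * by auto
    have m: "p mod j < W" using v by (meson mod_less_eq_dividend le_less_trans)
    have dv: "0 < p mod j \<longleftrightarrow> \<not> j dvd p" "p mod j = 0 \<longleftrightarrow> j dvd p" by (auto simp: dvd_eq_mod_eq_0)
    show "wp W (ifelse (Bin Sub (Reg rk) (Lit 1))
         (ifelse (Bin Mod (Reg rp) (Reg rk)) Skip (rb ::= Lit 0))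
         Skip) (\<lambda>v' m' o' k'. v' rk = j \<and> v' rp = ?v rp \<and> J (Suc j) (v'(rk := Suc j)) m' o' (k' + 12)) v1 m1 o1 k1"
      using e J * v m by (intro wp_intros) (auto simp add: J_def same_def dv less_Suc_eq)
  next
    fix v' m2 o2 k' assume J: "J (?v rp) v' m2 o2 k'"
    then have e: "m2 = m" "o2 = o'" by (simp_all add: J_def)
    show "Q v' m2 o2 (k' + 9)" unfolding e
      by (rule post) (use J v prime_iff_no_divisor[OF v(2)] in \<open>simp_all add: J_def\<close>)
  qed (use v in \<open>auto simp: J_def\<close>)
qed (use v in auto)

definition search_prog :: com where
  "search_prog =
     while (Reg rN)
       (prime_prog ;;
        ifelse (Reg rb) ((init_prog ;; family_prog) ;; rN ::= Bin Sub (Reg rN) (Lit 1)) Skip ;;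
        rp ::= Bin Add (Reg rp) (Lit 1))"

definition printed_pairs :: "nat \<Rightarrow> nat list \<Rightarrow> (nat \<Rightarrow> (nat \<Rightarrow> nat) list) \<Rightarrow> nat list" where
  "printed_pairs n ps F = concat (map (\<lambda>p. printed n p (F p)) ps)"

lemma printed_pairs_eq: "printed_pairs n ps F = concat (map (\<lambda>h. map h [0..<n]) (map (lifted n) (pairs ps F)))"
proof -
  have "printed n p fs = concat (map (\<lambda>h. map h [0..<n]) (map (lifted n) (map (Pair p) fs)))" for p fs
    by (induction fs) (auto simp: printed_def lifted_def)
  then show ?thesis by (induction ps) (auto simp: printed_pairs_def pairs_def)
qed

text \<open>Here q stands for the range size after reduction to at most l^3. The last assumption
  lets the search meet enough primes before it passes l^3.\<close>

locale prime_search =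
  fixes W n q d l K :: nat
  assumes dq: "2 \<le> d" "d \<le> q" "q \<le> l ^ 3" and l: "d \<le> l" "43 \<le> l" "l ^ (8 * d) \<le> n" and W: "3 * n < W"
    and K: "0 < K" "n \<le> l ^ K" "d\<^sup>2 * K \<le> card {p. prime p \<and> l < p \<and> p \<le> l ^ 3}"
begin

lemma power_l_le: "i \<le> 8 * d \<Longrightarrow> l ^ i \<le> n"
  using l power_increasing[of i "8 * d" l] by linarith

text \<open>The exponent 8 d is used up here: p q d^2 p^d <= l^(3 d + 8) and p^d q^d <= l^(6 d),
  where 3 d + 8 <= 8 d because d >= 2.\<close>

lemma ram: "0 < p \<Longrightarrow> p \<le> l ^ 3 \<Longrightarrow> ram W n p q d"
proof unfold_locales
  assume p: "0 < p" "p \<le> l ^ 3"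
  have pd: "p ^ d \<le> l ^ (3 * d)" "q ^ d \<le> l ^ (3 * d)"
    using p dq by (simp_all add: power_mono power_mult)
  have "p * q * (d * d) * p ^ d \<le> l ^ 3 * l ^ 3 * (l * l) * l ^ (3 * d)"
    by (intro mult_le_mono pd p dq l)
  also have "\<dots> = l ^ (3 * d + 8)" by (simp add: power_add eval_nat_numeral)
  also have "\<dots> \<le> n" by (rule power_l_le) (use dq in simp)
  finally show "p * q * (d * d) * p ^ d \<le> n" .
  have "p ^ d * q ^ d \<le> l ^ (3 * d) * l ^ (3 * d)" by (intro mult_le_mono pd)
  also have "\<dots> = l ^ (6 * d)" by (simp flip: power_add)
  also have "\<dots> \<le> n" by (rule power_l_le) simp
  finally show "p ^ d * q ^ d \<le> n" .
qed (use dq W in auto)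

lemma num_primes_le: "d\<^sup>2 * K \<le> l ^ 3"
proof -
  have "card {p. prime p \<and> l < p \<and> p \<le> l ^ 3} \<le> card {1..l ^ 3}"
    by (intro card_mono) (auto simp: Suc_le_eq prime_gt_0_nat)
  then show ?thesis using K by simp
qed

definition found :: "nat \<Rightarrow> nat list" where
  "found p = filter prime [Suc l..<p]"

lemma found_Suc: "l < p \<Longrightarrow> found (Suc p) = found p @ (if prime p then [p] else [])"
  by (simp add: found_def)

lemma set_found: "p \<in> set (found x) \<longleftrightarrow> prime p \<and> l < p \<and> p < x"
  by (auto simp: found_def)

lemma distinct_found: "distinct (found x)" by (simp add: found_def)

lemma length_found: "length (found (Suc (l ^ 3))) = card {p. prime p \<and> l < p \<and> p \<le> l ^ 3}"
proof -
  have "set (found (Suc (l ^ 3))) = {p. prime p \<and> l < p \<and> p \<le> l ^ 3}" by (auto simp: set_found)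
  then show ?thesis using distinct_card[OF distinct_found, of "Suc (l ^ 3)"] by simp
qed

definition "search_regs = family_regs \<union> {rP, rb, rN, rp}"

text \<open>The primality tests take O(l^6), covered by 200 n. A prime costs 310 n for its
  preparation and 510 n per function; as it yields at least one function, 820 n per function covers
  both.\<close>

lemma wp_search:
  assumes v: "v rn = n" "v rq = q" "v rd = d" "v rt = d - 1" "v rp = Suc l" "v rN = d\<^sup>2 * K"
    and post: "\<And>v' m' ps F k'. hash_moduli n q d l K ps F \<Longrightarrow> (\<And>p. p \<in> set ps \<Longrightarrow> p \<le> l ^ 3) \<Longrightarrow>
      k' \<le> k + 820 * n * length (pairs ps F) + 200 * n \<Longrightarrow>
      Q v' m' (o' @ printed_pairs n ps F) k'"
  shows "wp W search_prog Q v m o' k"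
  unfolding search_prog_def
proof -
  let ?r = "l ^ 3"
  let ?c = "prime_prog ;;
        ifelse (Reg rb) ((init_prog ;; family_prog) ;; rN ::= Bin Sub (Reg rN) (Lit 1)) Skip ;;
        rp ::= Bin Add (Reg rp) (Lit 1)"
  have l3: "l < ?r" using l power_strict_increasing[of 1 3 l] by simp
  have n: "?r * ?r \<le> n" using power_l_le[of 6] dq by (simp flip: power_add)
  have rn: "?r \<le> n" using power_l_le[of 3] dq by simp
  define P where "P = (\<lambda>p F v' (m' :: nat \<Rightarrow> nat) o'' k'. l < p \<and> p \<le> Suc ?r \<and> v' rp = p \<and> same search_regs v v' \<and>
    v' rN + length (found p) = d\<^sup>2 * K \<and>
    (\<forall>x\<in>set (found p). greedy x q d (F x) \<and> uncovered x d (F x) = {}) \<and>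
    o'' = o' @ printed_pairs n (found p) F \<and>
    k' \<le> k + (40 * ?r + 100) * (p - Suc l) + 820 * n * length (pairs (found p) F))"
  define J where "J = (\<lambda>j v' m' o'' k'. \<exists>p F. j = Suc ?r - p \<and> P p F v' m' o'' k')"
  show "wp W (while (Reg rN) ?c) Q v m o' k"
  proof (rule wp_while[where J = J])
    show "J (Suc ?r - Suc l) v m o' k"
      using v l3 by (auto simp: J_def P_def found_def printed_pairs_def intro!: exI[of _ "Suc l"])
  next
    fix j v1 m1 o1 k1
    assume "J j v1 m1 o1 k1" and *: "ev (Reg rN) v1 m1 \<noteq> 0"
    then obtain p F where j: "j = Suc ?r - p" and P: "P p F v1 m1 o1 k1" by (auto simp: J_def)
    have N: "0 < v1 rN" using * by simp
    \<comment> \<open>Once l^3 is passed, all primes of the range have been found, at least d^2 K of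
      them, so the counter of missing primes would be 0.\<close>
    have "p \<noteq> Suc ?r"
    proof
      assume "p = Suc ?r"
      then have "length (found p) \<ge> d\<^sup>2 * K" using K length_found by simp
      moreover have "v1 rN + length (found p) = d\<^sup>2 * K" using P by (simp add: P_def)
      ultimately show False using N by linarith
    qed
    then have p: "l < p" "p \<le> ?r" using P by (auto simp: P_def)
    interpret ram W n p q d by (rule ram) (use p in auto)
    have v1: "v1 rp = p" "v1 rn = n" "v1 rq = q" "v1 rd = d" "v1 rt = d - 1"
      using P v by (auto simp: P_def same_def search_regs_def family_regs_def)
    have pW: "Suc p < W" "2 \<le> p" using p rn W l by auto
    have cont: "wp W (rp ::= Bin Add (Reg rp) (Lit 1)) (\<lambda>v' m' o' k'. \<exists>j'<j. J j' v' m' o' k') v2 m2 o2 k2"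
      if "P (Suc p) F' (v2(rp := Suc p)) m2 o2 (k2 + 6)" "v2 rp = p" for v2 m2 o2 k2 F'
    proof -
      have "\<exists>j'<j. J j' (v2(rp := Suc p)) m2 o2 (k2 + 6)" unfolding J_def
        using that(1) p by (intro exI[of _ "Suc ?r - Suc p"] conjI exI[of _ "Suc p"] exI[of _ F']) (auto simp: j)
      then show ?thesis using that pW by (intro wp_intros) (simp_all add: eval_nat_numeral)
    qed
    have time: "(40 * ?r + 100) * (Suc p - Suc l) = (40 * ?r + 100) * (p - Suc l) + (40 * ?r + 100)"
    proof -
      have "Suc p - Suc l = Suc (p - Suc l)" using p by simp
      then show ?thesis by (simp only: mult_Suc_right add.commute)
    qed
    have pr: "40 * p \<le> 40 * ?r" using p by simp
    show "wp W ?c (\<lambda>v' m' o' k'. \<exists>j'<j. J j' v' m' o' k') v1 m1 o1 (k1 + cost (Reg rN) + 1)"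
    proof (rule wp_seq, rule wp_prime[where p = p])
      fix v2 k2
      assume 2: "same {rb, rk} v1 v2" "v2 rb = (if prime p then 1 else 0)"
          "k2 \<le> k1 + cost (Reg rN) + 1 + 40 * p + 20"
      show "wp W (ifelse (Reg rb) ((init_prog ;; family_prog) ;; rN ::= Bin Sub (Reg rN) (Lit 1)) Skip ;;
          rp ::= Bin Add (Reg rp) (Lit 1)) (\<lambda>v' m' o' k'. \<exists>j'<j. J j' v' m' o' k') v2 m1 o1 k2"
      proof (rule wp_seq, rule wp_ifelse)
        assume b: "ev (Reg rb) v2 m1 \<noteq> 0"
        show "wp W ((init_prog ;; family_prog) ;; rN ::= Bin Sub (Reg rN) (Lit 1))
          (wp W (rp ::= Bin Add (Reg rp) (Lit 1)) (\<lambda>v' m' o' k'. \<exists>j'<j. J j' v' m' o' k'))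
          v2 m1 o1 (k2 + cost (Reg rb) + 1)"
        proof (rule wp_seq, rule wp_process)
          fix v3 m3 fs k3
          assume 3: "same (family_regs \<union> {rP, rb}) v2 v3" "greedy p q d fs" "uncovered p d fs = {}"
            "k3 \<le> k2 + cost (Reg rb) + 1 + 510 * n * length fs + 310 * n"
      have prime: "prime p" using 2 b by (simp split: if_splits)
      \<comment> \<open>p is not among the primes found earlier, so the update leaves their families
        and the output so far unchanged.\<close>
      let ?F = "F(p := fs)"
      have nf: "p \<notin> set (found p)" by (simp add: set_found)
      have same_map: "map (\<lambda>x. printed n x (?F x)) (found p) = map (\<lambda>x. printed n x (F x)) (found p)"
        "map (\<lambda>x. map (Pair x) (?F x)) (found p) = map (\<lambda>x. map (Pair x) (F x)) (found p)"
        using nf by auto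
      have out: "printed_pairs n (found (Suc p)) ?F = printed_pairs n (found p) F @ printed n p fs"
        unfolding printed_pairs_def found_Suc[OF p(1)] using prime by (simp add: same_map(1) fun_upd_same del: fun_upd_apply)
      have len: "length (pairs (found (Suc p)) ?F) = length (pairs (found p) F) + length fs"
        unfolding pairs_def found_Suc[OF p(1)] using prime by (simp add: same_map(2) fun_upd_same del: fun_upd_apply)
      have "fs \<noteq> []" using 3(3) uncovered_Nil_nonempty[of d p] d2 l p by auto
      then have "n * 1 \<le> n * length fs" by (intro mult_le_mono2) (simp add: Suc_le_eq)
      then have "510 * n * length fs + 310 * n \<le> 820 * n * length fs" by simp
      moreover have "k2 \<le> k1 + 40 * p + 23" "k3 \<le> k2 + 510 * n * length fs + 310 * n + 3"
        using 2(3) 3(4) by simp_all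
      ultimately have k3: "k3 + 20 \<le> k1 + 40 * ?r + 100 + 820 * n * length fs" using pr by linarith
      have N3: "v3 rN = v1 rN" using 2(1) 3(1) by (simp add: same_def family_regs_def)
      moreover have "v1 rN \<le> d\<^sup>2 * K" using P unfolding P_def by linarith
      ultimately have NW: "v3 rN - 1 < W" using num_primes_le rn W by linarith
      have e3: "v3 rp = p" using 2(1) 3(1) v1 by (simp add: same_def family_regs_def)
      have "P (Suc p) ?F (v3(rN := v3 rN - 1, rp := Suc p)) m3 (o1 @ printed n p fs) (k3 + 12)"
        unfolding P_def
      proof (intro conjI)
        show "same search_regs v (v3(rN := v3 rN - 1, rp := Suc p))"
          using P 2(1) 3(1) by (simp add: P_def same_def search_regs_def family_regs_def)
        have "v3 rN = v1 rN" using 2(1) 3(1) by (simp add: same_def family_regs_def)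
        moreover have "v1 rN + length (found p) = d\<^sup>2 * K" using P by (simp add: P_def)
        moreover have "length (found (Suc p)) = Suc (length (found p))" using prime found_Suc[OF p(1)] by simp
        ultimately have "v3 rN - 1 + length (found (Suc p)) = d\<^sup>2 * K" using N by linarith
        then show "(v3(rN := v3 rN - 1, rp := Suc p)) rN + length (found (Suc p)) = d\<^sup>2 * K" by simp
        show "\<forall>x\<in>set (found (Suc p)). greedy x q d (?F x) \<and> uncovered x d (?F x) = {}"
          using P 3 prime found_Suc[OF p(1)] by (simp add: P_def)
        show "o1 @ printed n p fs = o' @ printed_pairs n (found (Suc p)) ?F"
          using P out by (simp add: P_def)
        have "k1 \<le> k + (40 * ?r + 100) * (p - Suc l) + 820 * n * length (pairs (found p) F)"
          using P by (simp add: P_def)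
        then show "k3 + 12 \<le> k + (40 * ?r + 100) * (Suc p - Suc l) + 820 * n * length (pairs (found (Suc p)) ?F)"
          unfolding time len distrib_left using k3 by linarith
      qed (use p in auto)
          then show "wp W (rN ::= Bin Sub (Reg rN) (Lit 1))
            (wp W (rp ::= Bin Add (Reg rp) (Lit 1)) (\<lambda>v' m' o' k'. \<exists>j'<j. J j' v' m' o' k'))
            v3 m3 (o1 @ printed n p fs) k3"
            using pW e3 NW by (rule_tac wp_assign, rule_tac cont[where F' = ?F]) (simp_all add: add.commute)
        qed (use 2 v1 in \<open>simp_all add: same_def\<close>)
      next
        assume b: "ev (Reg rb) v2 m1 = 0"
        have "\<not> prime p" using 2 b by (simp split: if_splits)
        then have f: "found (Suc p) = found p" using found_Suc[OF p(1)] by simp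
        have "P (Suc p) F (v2(rp := Suc p)) m1 o1 (k2 + 10)"
          unfolding P_def
        proof (intro conjI)
          show "same search_regs v (v2(rp := Suc p))"
            using P 2(1) by (simp add: P_def same_def search_regs_def family_regs_def)
          have "v2 rN = v1 rN" using 2(1) by (simp add: same_def)
          then show "(v2(rp := Suc p)) rN + length (found (Suc p)) = d\<^sup>2 * K"
            using P f by (simp add: P_def)
          have "k1 \<le> k + (40 * ?r + 100) * (p - Suc l) + 820 * n * length (pairs (found p) F)"
            using P by (simp add: P_def)
          then show "k2 + 10 \<le> k + (40 * ?r + 100) * (Suc p - Suc l) + 820 * n * length (pairs (found (Suc p)) F)"
            unfolding time f using 2(3) pr by simp
        qed (use p P f in \<open>auto simp: P_def\<close>)
        moreover have "v2 rp = p" using 2(1) v1 by (simp add: same_def)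
        ultimately show "wp W Skip (wp W (rp ::= Bin Add (Reg rp) (Lit 1)) (\<lambda>v' m' o' k'. \<exists>j'<j. J j' v' m' o' k'))
            v2 m1 o1 (k2 + cost (Reg rb) + 1)"
          by (intro wp_skip cont[where F' = F]) (simp_all add: add.commute)
      qed simp
    qed (use v1 pW in simp_all)
  next
    fix j v1 m1 o1 k1
    assume "J j v1 m1 o1 k1"
    then show "fits W (Reg rN) v1 m1" by simp
  next
    fix j v1 m1 o1 k1
    assume "J j v1 m1 o1 k1" and *: "ev (Reg rN) v1 m1 = 0"
    then obtain p F where P: "P p F v1 m1 o1 k1" by (auto simp: J_def)
    have N: "v1 rN = 0" using * by simp
    have e: "o1 = o' @ printed_pairs n (found p) F" using P by (simp add: P_def)
    show "Q v1 m1 o1 (k1 + cost (Reg rN) + 1)" unfolding e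
    proof (rule post)
      show "hash_moduli n q d l K (found p) F"
      proof
        show "x * y \<le> n" if "x \<in> set (found p)" "y \<in> set (found p)" for x y
        proof -
          have "x \<le> ?r" "y \<le> ?r" using that P by (auto simp: set_found P_def)
          then have "x * y \<le> ?r * ?r" by (intro mult_le_mono)
          with n show ?thesis by simp
        qed
      qed (use P N dq l K distinct_found in \<open>auto simp: P_def set_found\<close>)
      show "x \<le> ?r" if "x \<in> set (found p)" for x using that P by (auto simp: set_found P_def)
      have "p \<le> Suc ?r" using P by (simp add: P_def)
      then have "p - Suc l \<le> ?r" by linarith
      then have "(40 * ?r + 100) * (p - Suc l) \<le> (40 * ?r + 100) * ?r" by (rule mult_le_mono2)
      also have "\<dots> = 40 * (?r * ?r) + 100 * ?r" by (simp add: algebra_simps)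
      also have "\<dots> \<le> 180 * n" 
      proof -
        have "1 * ?r \<le> ?r * ?r" by (intro mult_le_mono1) (use l3 in simp)
        then show ?thesis using n by linarith
      qed
      finally show "k1 + cost (Reg rN) + 1 \<le> k + 820 * n * length (pairs (found p) F) + 200 * n"
        using P l3 rn by (simp add: P_def)
    qed
  qed
qed

end

section \<open>The construction\<close>

text \<open>\<open>rx\<close> stays one power of 2 ahead of \<open>rl\<close>; by truncated
  subtraction the loop continues exactly while \<open>rx\<close> is at most n.\<close>

definition log_prog :: com where
  "log_prog =
     rl ::= Lit 0 ;; rx ::= Lit 2 ;;
     while (Bin Sub (Bin Add (Reg rn) (Lit 1)) (Reg rx))
       (rx ::= Bin Mul (Reg rx) (Lit 2) ;; rl ::= Bin Add (Reg rl) (Lit 1))"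

definition exponent_prog :: com where
  "exponent_prog =
     rx ::= Lit 1 ;; rz ::= Lit 0 ;;
     while (Bin Sub (Reg rn) (Reg rx))
       (rx ::= Bin Mul (Reg rx) (Reg rl) ;; rz ::= Bin Add (Reg rz) (Lit 1))"

text \<open>For d = 1 a single constant function is printed: a function separating a one-element set
  may be constant, and the distinctness argument across moduli would break down.\<close>

definition hash_prog :: com where
  "hash_prog =
     rt ::= Bin Sub (Reg rd) (Lit 1) ;;
     ifelse (Reg rt)
       (log_prog ;; exponent_prog ;;
        rx ::= Bin Mul (Reg rl) (Bin Mul (Reg rl) (Reg rl)) ;;
        ifelse (Bin Sub (Reg rq) (Reg rx)) (rq ::= Reg rx) Skip ;;
        rN ::= Bin Mul (Bin Mul (Reg rd) (Reg rd)) (Reg rz) ;;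
        rp ::= Bin Add (Reg rl) (Lit 1) ;;
        search_prog)
       (loop ri rn (emit (Lit 0)))"

lemma wp_log:
  assumes v: "v rn = n" "1 \<le> n" "3 * n < W"
    and post: "\<And>v' k'. same {rl, rx} v v' \<Longrightarrow> 2 ^ v' rl \<le> n \<Longrightarrow> n < 2 * 2 ^ v' rl \<Longrightarrow>
      k' \<le> k + 40 * n + 20 \<Longrightarrow> Q v' m o' k'"
  shows "wp W log_prog Q v m o' k"
  unfolding log_prog_def
proof (intro wp_intros)
  let ?v1 = "v(rl := ev (Lit 0) v m)"
  let ?v = "?v1(rx := ev (Lit 2) ?v1 m)"
  let ?g = "Bin Sub (Bin Add (Reg rn) (Lit 1)) (Reg rx)"
  define J where "J = (\<lambda>j v' m' o'' k'. same {rl, rx} v v' \<and> m' = m \<and> o'' = o' \<and> j = Suc n - v' rl \<and>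
    v' rx = 2 * 2 ^ v' rl \<and> 2 ^ v' rl \<le> n \<and> k' \<le> k + 30 * v' rl + 10)"
  show "wp W (while ?g (rx ::= Bin Mul (Reg rx) (Lit 2) ;; rl ::= Bin Add (Reg rl) (Lit 1))) Q ?v m o'
    (k + cost (Lit 0) + 2 + cost (Lit 2) + 2)"
  proof (rule wp_while[where J = J])
    show "J (Suc n) ?v m o' (k + cost (Lit 0) + 2 + cost (Lit 2) + 2)"
      using v by (auto simp: J_def same_def)
  next
    fix j v1 m1 o1 k1
    assume "J j v1 m1 o1 k1"
    then have "v1 rn = n" by (simp add: J_def same_def v)
    then show "fits W ?g v1 m1" using v by auto
  next
    fix j v1 m1 o1 k1
    assume J: "J j v1 m1 o1 k1" and *: "ev ?g v1 m1 \<noteq> 0"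
    have e: "v1 rn = n" "v1 rx \<le> n" "v1 rx = 2 * 2 ^ v1 rl" using J * by (auto simp: J_def same_def v)
    have "v1 rl < 2 ^ v1 rl" by simp
    also have "2 ^ v1 rl \<le> n" using J by (simp add: J_def)
    finally have ln: "v1 rl < n" .
    show "wp W (rx ::= Bin Mul (Reg rx) (Lit 2) ;; rl ::= Bin Add (Reg rl) (Lit 1))
      (\<lambda>v' m' o' k'. \<exists>j'<j. J j' v' m' o' k') v1 m1 o1 (k1 + cost ?g + 1)"
      using e v J ln by (intro wp_intros) (auto simp: J_def same_def)
  next
    fix j v1 m1 o1 k1
    assume J: "J j v1 m1 o1 k1" and *: "ev ?g v1 m1 = 0"
    have e: "m1 = m" "o1 = o'" "v1 rn = n" using J by (auto simp: J_def same_def v)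
    have "v1 rl < 2 ^ v1 rl" by simp
    also have "2 ^ v1 rl \<le> n" using J by (simp add: J_def)
    finally have ln: "v1 rl < n" .
    show "Q v1 m1 o1 (k1 + cost ?g + 1)" unfolding e(1,2)
      by (rule post) (use J * e ln in \<open>auto simp: J_def\<close>)
  qed
qed (use v in auto)

text \<open>The power that stops the loop may exceed n, but arises from a smaller one by a factor l,
  so n l has to be a word.\<close>

lemma wp_exponent:
  assumes v: "v rn = n" "v rl = l" "2 \<le> l" "1 \<le> n" "n * l < W" "3 * n < W"
    and post: "\<And>v' k'. same {rx, rz} v v' \<Longrightarrow> n \<le> l ^ v' rz \<Longrightarrow> v' rz = 0 \<or> l ^ (v' rz - 1) < n \<Longrightarrow>
      k' \<le> k + 40 * n + 60 \<Longrightarrow> Q v' m o' k'"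
  shows "wp W exponent_prog Q v m o' k"
  unfolding exponent_prog_def
proof (intro wp_intros)
  have nW: "2 * n < W" using v by simp
  let ?v1 = "v(rx := ev (Lit 1) v m)"
  let ?v = "?v1(rz := ev (Lit 0) ?v1 m)"
  let ?g = "Bin Sub (Reg rn) (Reg rx)"
  define J where "J = (\<lambda>j v' m' o'' k'. same {rx, rz} v v' \<and> m' = m \<and> o'' = o' \<and> j = Suc n - v' rz \<and>
    v' rx = l ^ v' rz \<and> (v' rz = 0 \<or> l ^ (v' rz - 1) < n) \<and> v' rz \<le> n \<and> k' \<le> k + 30 * v' rz + 10)"
  have lt: "z < l ^ z" for z
    using less_le_trans[OF less_exp power_mono[of 2 l z]] v by simp
  show "wp W (while ?g (rx ::= Bin Mul (Reg rx) (Reg rl) ;; rz ::= Bin Add (Reg rz) (Lit 1))) Q ?v m o'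
    (k + cost (Lit 1) + 2 + cost (Lit 0) + 2)"
  proof (rule wp_while[where J = J])
    show "J (Suc n) ?v m o' (k + cost (Lit 1) + 2 + cost (Lit 0) + 2)"
      using v by (auto simp: J_def same_def)
  next
    fix j v1 m1 o1 k1
    assume "J j v1 m1 o1 k1"
    then have "v1 rn = n" by (simp add: J_def same_def v)
    then show "fits W ?g v1 m1" using nW by auto
  next
    fix j v1 m1 o1 k1
    assume J: "J j v1 m1 o1 k1" and *: "ev ?g v1 m1 \<noteq> 0"
    have e: "v1 rn = n" "v1 rx < n" "v1 rl = l" "v1 rx = l ^ v1 rz" using J * by (auto simp: J_def same_def v)
    have zn: "v1 rz < n" using lt[of "v1 rz"] e by simp
    have "v1 rx * l \<le> n * l" using e by (intro mult_le_mono1) simp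
    from le_less_trans[OF this v(5)] have xl: "l ^ v1 rz * l < W" by (simp only: e(4))
    show "wp W (rx ::= Bin Mul (Reg rx) (Reg rl) ;; rz ::= Bin Add (Reg rz) (Lit 1))
      (\<lambda>v' m' o' k'. \<exists>j'<j. J j' v' m' o' k') v1 m1 o1 (k1 + cost ?g + 1)"
      using e nW J zn xl by (intro wp_intros) (auto simp: J_def same_def mult.commute)
  next
    fix j v1 m1 o1 k1
    assume J: "J j v1 m1 o1 k1" and *: "ev ?g v1 m1 = 0"
    have e: "m1 = m" "o1 = o'" "v1 rn = n" using J by (auto simp: J_def same_def v)
    show "Q v1 m1 o1 (k1 + cost ?g + 1)" unfolding e(1,2)
      by (rule post) (use J * e in \<open>auto simp: J_def\<close>)
  qed
qed (use v in auto)

lemma wp_zeros: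
  assumes v: "v rn = n" "n < W"
    and post: "\<And>v' k'. k' \<le> k + 30 * n + 20 \<Longrightarrow> Q v' m (o' @ replicate n 0) k'"
  shows "wp W (loop ri rn (emit (Lit 0))) Q v m o' k"
proof -
  define J where "J = (\<lambda>j (v' :: nat \<Rightarrow> nat) m' o'' k'. m' = m \<and>
    o'' = o' @ replicate j 0 \<and> k' \<le> k + 30 * j + 10)"
  show ?thesis
  proof (rule wp_loop[where J = J])
    fix j v1 m1 o1 k1
    assume *: "j < v rn" "v1 ri = j" "v1 rn = v rn" and J: "J j v1 m1 o1 k1"
    show "wp W (emit (Lit 0))
       (\<lambda>v' m' o' k'. v' ri = j \<and> v' rn = v rn \<and> J (Suc j) (v'(ri := Suc j)) m' o' (k' + 12)) v1 m1 o1 k1"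
      using * J v by (intro wp_intros) (simp_all add: J_def replicate_append_same)
  next
    fix v' m2 o2 k' assume J: "J (v rn) v' m2 o2 k'"
    then have e: "m2 = m" "o2 = o' @ replicate n 0" using v by (simp_all add: J_def)
    show "Q v' m2 o2 (k' + 9)" unfolding e
      by (rule post) (use J v in \<open>simp_all add: J_def\<close>)
  qed (use v in \<open>auto simp: J_def\<close>)
qed

definition good_output :: "nat \<Rightarrow> nat \<Rightarrow> nat \<Rightarrow> nat list \<Rightarrow> nat \<Rightarrow> bool" where
  "good_output n q d ys t \<longleftrightarrow> (\<exists>H. perfect_hash_family n q d H \<and>
     real (card H) \<le> 16 * (real d ^ 3 * log 2 (real n) / g q d) \<and> describes n ys H \<and>
     t \<le> 2000 * (card H * n))"

lemma wp_hash:
  assumes hyps: "1 \<le> d" "d \<le> q" "real d \<le> log 2 (real n) / (8 * log 2 (log 2 (real n)))"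
    and v: "v rn = n" "v rq = q" "v rd = d" and Wn: "n * n * n \<le> W" "q < W"
  shows "wp W hash_prog (\<lambda>v' m' o' k'. good_output n q d o' k') v m [] 0"
proof -
  \<comment> \<open>As ln 0 = 0, the bound on d would read d <= 0.\<close>
  have "n \<noteq> 0"
  proof
    assume "n = 0"
    with hyps(1,3) show False by (simp add: log_def)
  qed
  then obtain l0 where "2 ^ l0 \<le> n" "n < 2 * 2 ^ l0" using ex_power_ivl1[of 2 n] by auto
  note b = floor_log_bounds[OF hyps(1,3) this]
  have n0: "l0 \<le> n" using b(2) hyps(1) self_le_power[of l0 "8 * d"] b(1) by simp
  have n43: "43 \<le> n" using n0 b(1) by simp
  have "4 * n \<le> n * n" using n43 by simp
  also have "n * n * 1 \<le> n * n * n" by (intro mult_le_mono2) (use n43 in simp)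
  finally have n4: "4 * n \<le> n * n * n" by simp
  have nn: "n * n < n * n * n" using n43 by simp
  have W3: "3 * n < W" "n < W" "n * n < W" using n4 nn Wn(1) n43 by linarith+
  show ?thesis
    unfolding hash_prog_def
  proof (rule wp_seq, rule wp_assign, rule wp_ifelse)
    let ?v = "v(rt := ev (Bin Sub (Reg rd) (Lit 1)) v m)"
    let ?k = "0 + cost (Bin Sub (Reg rd) (Lit 1)) + 2 + cost (Reg rt) + 1"
    {
      assume "ev (Reg rt) ?v m = 0"
      then have d1: "d = 1" using v hyps by simp
      show "wp W (loop ri rn (emit (Lit 0))) (\<lambda>v' m' o' k'. good_output n q d o' k') ?v m [] ?k"
      proof (rule wp_zeros)
        fix k' assume k': "k' \<le> ?k + 30 * n + 20"
        let ?h = "restrict (\<lambda>_. 0 :: nat) {..<n}"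
        have "perfect_hash_family n q d {?h}"
          using hyps d1 by (auto simp: perfect_hash_family_def card_1_singleton_iff)
        moreover have "real (card {?h}) \<le> 16 * (real d ^ 3 * log 2 (real n) / g q d)"
          using d1 b(1,4) by (simp add: g_def)
        moreover have "describes n (replicate n 0) {?h}"
          unfolding describes_def by (intro exI[of _ "[?h]"]) (auto intro!: nth_equalityI)
        ultimately show "good_output n q d ([] @ replicate n 0) k'"
          unfolding good_output_def using k' n43 by (intro exI[of _ "{?h}"]) simp
      qed (use v W3 in simp_all)
    }
    assume "ev (Reg rt) ?v m \<noteq> 0"
    then have d2: "2 \<le> d" using v by simp
    show "wp W (log_prog ;; exponent_prog ;;
        rx ::= Bin Mul (Reg rl) (Bin Mul (Reg rl) (Reg rl)) ;;
        ifelse (Bin Sub (Reg rq) (Reg rx)) (rq ::= Reg rx) Skip ;;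
        rN ::= Bin Mul (Bin Mul (Reg rd) (Reg rd)) (Reg rz) ;;
        rp ::= Bin Add (Reg rl) (Lit 1) ;;
        search_prog) (\<lambda>v' m' o' k'. good_output n q d o' k') ?v m [] ?k"
    proof (rule wp_seq, rule wp_log)
      fix v1 k1
      assume 1: "same {rl, rx} ?v v1" "2 ^ v1 rl \<le> n" "n < 2 * 2 ^ v1 rl" "k1 \<le> ?k + 40 * n + 20"
      define l where "l = v1 rl"
      note c = floor_log_bounds[OF hyps(1,3) 1(2,3), folded l_def]
      have ll: "l \<le> n" "l * l * l \<le> n"
      proof -
        have "l ^ 1 \<le> l ^ (8 * d)" "l ^ 3 \<le> l ^ (8 * d)" using c(1) hyps by (intro power_increasing; simp)+
        with c(2) show "l \<le> n" "l * l * l \<le> n" by (simp_all add: power3_eq_cube)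
      qed
      show "wp W (exponent_prog ;;
        rx ::= Bin Mul (Reg rl) (Bin Mul (Reg rl) (Reg rl)) ;;
        ifelse (Bin Sub (Reg rq) (Reg rx)) (rq ::= Reg rx) Skip ;;
        rN ::= Bin Mul (Bin Mul (Reg rd) (Reg rd)) (Reg rz) ;;
        rp ::= Bin Add (Reg rl) (Lit 1) ;;
        search_prog) (\<lambda>v' m' o' k'. good_output n q d o' k') v1 m [] k1"
      proof (rule wp_seq, rule wp_exponent[where l = l])
        have "n * l \<le> n * n" using ll by (intro mult_le_mono2)
        from le_less_trans[OF this W3(3)] show "n * l < W" .
        fix v2 k2
        assume 2: "same {rx, rz} v1 v2" "n \<le> l ^ v2 rz" "v2 rz = 0 \<or> l ^ (v2 rz - 1) < n" "k2 \<le> k1 + 40 * n + 60"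
        define K where "K = v2 rz"
        define q' where "q' = min q (l ^ 3)"
        have e2: "v2 rn = n" "v2 rq = q" "v2 rd = d" "v2 rt = d - 1" "v2 rl = l"
          using 1(1) 2(1) v by (simp_all add: same_def l_def)
        interpret parameters n d l K
          by unfold_locales (use c hyps 2 in \<open>auto simp: K_def\<close>)
        have K0: "0 < K" using 2(2) n43 by (auto simp: K_def intro!: Nat.gr0I)
        have dl3: "d \<le> l ^ 3" using d_le self_le_power[of l 3] c(1) by simp
        interpret prime_search W n q' d l K
          using d2 hyps dl3 d_le c W3 K0 2 enough_primes by unfold_locales (auto simp: q'_def K_def)
        have N: "d * d * K < W" "d * d < W"
        proof -
          have "d * d * K \<le> l ^ 3" using num_primes_le by (simp add: power2_eq_square)
          then show N: "d * d * K < W" using ll W3 by (simp add: power3_eq_cube)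
          have "d * d \<le> d * d * K" using K0 by simp
          from le_less_trans[OF this N] show "d * d < W" .
        qed
        have lW: "l * (l * l) < W" "l * l < W" "Suc l < W" "q - x < W" for x
        proof -
          show l3: "l * (l * l) < W" using ll W3 by (simp add: mult.assoc)
          have "l * l \<le> l * (l * l)" using c(1) by simp
          from le_less_trans[OF this l3] show "l * l < W" .
          show "Suc l < W" using ll W3 n43 by simp
          show "q - x < W" using Wn by simp
        qed
        have fin: "wp W search_prog (\<lambda>v' m' o' k'. good_output n q d o' k') v3 m [] k3"
          if v3: "v3 rn = n" "v3 rq = q'" "v3 rd = d" "v3 rt = d - 1" "v3 rp = Suc l" "v3 rN = d\<^sup>2 * K"
            and k3: "k3 \<le> k2 + 100" for v3 k3
        proof (rule wp_search[OF v3])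
          fix m' ps F k'
          assume H: "hash_moduli n q' d l K ps F" and ps: "\<And>p. p \<in> set ps \<Longrightarrow> p \<le> l ^ 3"
            and k': "k' \<le> k3 + 820 * n * length (pairs ps F) + 200 * n"
          interpret H: hash_moduli n q' d l K ps F by (rule H)
          let ?S = "set H.hs"
          have card: "card ?S = length (pairs ps F)" using distinct_card[OF H.distinct_hs] by (simp add: H.hs_def)
          have "0 < length ps" using H.ps(3) K0 d2 by simp
          moreover have "length ps \<le> length (pairs ps F)" using H.length_hs_ge by (simp add: H.hs_def)
          ultimately have S1: "1 \<le> length (pairs ps F)" by linarith
          have "perfect_hash_family n q d ?S" by (rule H.perfect_hs) (simp add: q'_def)
          moreover have "real (card ?S) \<le> 16 * (real d ^ 3 * log 2 (real n) / g q d)"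
          proof -
            have "real (card ?S) = real (length H.hs)" by (simp only: distinct_card[OF H.distinct_hs])
            also have "\<dots> \<le> real (d\<^sup>2 * K) * (1 + real d * ln (real (l ^ 3)) / g q' d)"
              by (rule H.length_hs_le) (rule ps)
            also have "\<dots> \<le> 16 * (real d ^ 3 * log 2 (real n) / g q d)"
              unfolding q'_def by (rule size_bound[OF hyps(2)])
            finally show ?thesis .
          qed
          moreover have "describes n ([] @ printed_pairs n ps F) ?S"
            unfolding describes_def printed_pairs_eq H.hs_def[symmetric]
            using H.distinct_hs by (intro exI[of _ H.hs]) simp
          \<comment> \<open>At least one function is printed, which absorbs the 80 n for computing l
            and K, the 200 n of the search and the constants.\<close>
          moreover have "k' \<le> 2000 * (card ?S * n)"
          proof -
            have "k' \<le> 820 * (n * length (pairs ps F)) + 280 * n + 300"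
              using k' k3 2(4) 1(4) by simp
            moreover have "n * 1 \<le> n * length (pairs ps F)" by (intro mult_le_mono2 S1)
            ultimately have "k' \<le> 2000 * (n * length (pairs ps F))" using n43 by linarith
            then show ?thesis unfolding card by (simp add: mult.commute)
          qed
          ultimately show "good_output n q d ([] @ printed_pairs n ps F) k'"
            unfolding good_output_def by blast
        qed
        show "wp W (rx ::= Bin Mul (Reg rl) (Bin Mul (Reg rl) (Reg rl)) ;;
          ifelse (Bin Sub (Reg rq) (Reg rx)) (rq ::= Reg rx) Skip ;;
          rN ::= Bin Mul (Bin Mul (Reg rd) (Reg rd)) (Reg rz) ;;
          rp ::= Bin Add (Reg rl) (Lit 1) ;;
          search_prog) (\<lambda>v' m' o' k'. good_output n q d o' k') v2 m [] k2"
          using e2 lW N K_def W3 n43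
          by (intro wp_intros fin)
            (simp_all add: q'_def power3_eq_cube power2_eq_square min_def mult.assoc)
      qed (use 1 v c n43 W3 in \<open>simp_all add: same_def l_def\<close>)
    qed (use v n43 W3 in simp_all)
  qed (use v W3 hyps(2) Wn(2) n43 in simp_all)
qed

text \<open>Words below (max n q)^3 hold the inputs and every intermediate result; the most
  demanding is the overshooting power in the computation of K, which is below n l <= n^2.\<close>

theorem theorem2:
  shows "\<exists>(P::com) (c::nat) (K::real) (C::real). \<forall>n q d :: nat.
           primepow q \<and> 1 \<le> d \<and> d \<le> q \<and>
           real d \<le> log 2 (real n) / (8 * log 2 (log 2 (real n))) \<longrightarrow>
           (\<exists>H. perfect_hash_family n q d H \<and>
                real (card H) \<le> C * (real d ^ 3 * log 2 (real n) / g q d) \<and>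
                constructs_in_linear_time P c K n q d H)"
proof (rule exI[of _ hash_prog], rule exI[of _ 3], rule exI[of _ 2000], rule exI[of _ 16], intro allI impI)
  fix n q d :: nat
  assume *: "primepow q \<and> 1 \<le> d \<and> d \<le> q \<and>
    real d \<le> log 2 (real n) / (8 * log 2 (log 2 (real n)))"
  let ?W = "(max n q) ^ 3" and ?s = "init_state [n, q, d]"
  have n2: "2 \<le> n"
  proof (rule ccontr)
    assume "\<not> 2 \<le> n"
    then have "n = 0 \<or> n = 1" by auto
    with * show False by (auto simp: log_def)
  qed
  then have m: "2 \<le> max n q" by simp
  have "max n q * 1 < max n q * (max n q * max n q)"
    using mult_le_mono[OF m m] m by (intro mult_less_mono2) linarith+
  then have W: "max n q < ?W" by (simp add: power3_eq_cube)
  have "n ^ 3 \<le> ?W" by (intro power_mono) auto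
  then have W3: "n * n * n \<le> ?W" "q < ?W" using W by (simp_all add: power3_eq_cube)
  have words: "words ?W ?s"
    using W * by (auto simp: words_def init_state_def nth_Cons split: nat.splits)
  have "wp ?W hash_prog (\<lambda>v' m' o' k'. good_output n q d o' k') (reg ?s) (mem ?s) [] 0"
    using * W3 by (intro wp_hash) (simp_all add: init_state_def)
  then obtain t s' where t: "exec ?W hash_prog ?s t s'" "good_output n q d (out s') (0 + t)"
    unfolding wp_def using words by (auto simp: init_state_def)
  then obtain H where H: "perfect_hash_family n q d H"
     "real (card H) \<le> 16 * (real d ^ 3 * log 2 (real n) / g q d)" "describes n (out s') H"
     "t \<le> 2000 * (card H * n)" unfolding good_output_def by auto
  have "computes_in ?W hash_prog [n, q, d] (out s') t"
    unfolding computes_in_def using t W * by auto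
  moreover have "real t \<le> 2000 * (real (card H) * real n)"
    using of_nat_mono[OF H(4), where 'a = real] by simp
  ultimately have "constructs_in_linear_time hash_prog 3 2000 n q d H"
    unfolding constructs_in_linear_time_def using H(3) by blast
  with H show "\<exists>H. perfect_hash_family n q d H \<and>
      real (card H) \<le> 16 * (real d ^ 3 * log 2 (real n) / g q d) \<and>
      constructs_in_linear_time hash_prog 3 2000 n q d H" by blast
qed

end
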